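(* Let $(n_k)_{k\ge 0}$ be a strictly increasing sequence of positive integers such that $n_k$ divides $n_{k+1}$ for each $k\ge 1$. Then for every $p\in\mathbb{Z}$, the set $\{n_k-p : k\ge 0\}\cap\mathbb{N}$ is a non-recurrence set for some weakly mixing linear dynamical system. In particular (case $p=0$) the set $\{n_k : k\ge 0\}$ is a non-recurrence set for some weakly mixing linear dynamical system.
   Context: $\mathbb{N}$ denotes the set of positive integers. A Borel probability measure $m$ on a complex separable Banach space $X$ is (centered) Gaussian if every $x^*\in X^*$, as a random variable on $(X,\mathcal{B},m)$, has a centered complex Gaussian law; it is non-degenerate if $m(U)>0$ for every non-empty open $U\subseteq X$. A weakly mixing linear dynamical system is a bounded linear operator $T$ on a complex separable infinite-dimensional Banach space $X$ together with a non-degenerate Gaussian measure $m$ on the Borel $\sigma$-algebra $\mathcal{B}$ of $X$ such that $T$ is a measure-preserving, weakly mixing transformation of $(X,\mathcal{B},m)$. A set $\{m_k\}$ of positive integers is a non-recurrence set for a measure-preserving system $(X,\mathcal{B},m,T)$ if there is $A\in\mathcal{B}$ with $m(A)>0$ and $m(T^{-m_k}A\cap A)=0$ for every $k$. *)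

theory Defs
  imports "HOL-Analysis.Analysis" "HOL-Probability.Probability"
begin

text \<open>Ambient space: complex l-infinity, i.e. bounded complex sequences with the sup norm.
  Every complex separable Banach space embeds complex-linearly and isometrically into it,
  so complex separable Banach spaces are represented as closed complex-linear subspaces X.\<close>

type_synonym linf = "nat \<Rightarrow>\<^sub>C complex"

definition cscale :: "complex \<Rightarrow> linf \<Rightarrow> linf" where
  "cscale c f = Bcontfun (\<lambda>n. c * apply_bcontfun f n)"

definition complex_subspace :: "linf set \<Rightarrow> bool" where
  "complex_subspace X \<longleftrightarrow> 0 \<in> X \<and> (\<forall>x\<in>X. \<forall>y\<in>X. x + y \<in> X) \<and> (\<forall>c. \<forall>x\<in>X. cscale c x \<in> X)"

definition sep_inf_banach :: "linf set \<Rightarrow> bool" where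
  "sep_inf_banach X \<longleftrightarrow> complex_subspace X \<and> closed X
     \<and> (\<exists>D. countable D \<and> D \<subseteq> X \<and> X \<subseteq> closure D)
     \<and> \<not> (\<exists>B. finite B \<and> X \<subseteq> span B)"

definition bounded_op :: "linf set \<Rightarrow> (linf \<Rightarrow> linf) \<Rightarrow> bool" where
  "bounded_op X T \<longleftrightarrow> T ` X \<subseteq> X
     \<and> (\<forall>x\<in>X. \<forall>y\<in>X. T (x + y) = T x + T y)
     \<and> (\<forall>c. \<forall>x\<in>X. T (cscale c x) = cscale c (T x))
     \<and> (\<exists>C. \<forall>x\<in>X. norm (T x) \<le> C * norm x)"

definition dual_elem :: "linf set \<Rightarrow> (linf \<Rightarrow> complex) \<Rightarrow> bool" where
  "dual_elem X \<phi> \<longleftrightarrow> (\<forall>x\<in>X. \<forall>y\<in>X. \<phi> (x + y) = \<phi> x + \<phi> y)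
     \<and> (\<forall>c. \<forall>x\<in>X. \<phi> (cscale c x) = c * \<phi> x)
     \<and> continuous_on X \<phi>"

text \<open>Centered complex Gaussian law on the complex plane (Bayart--Grivaux convention):
  either the Dirac mass at 0, or the law with density
  (1/(2 pi s^2)) exp(-|z|^2/(2 s^2)) with respect to Lebesgue measure on C = R^2.\<close>
definition centered_complex_gaussian :: "complex measure \<Rightarrow> bool" where
  "centered_complex_gaussian \<mu> \<longleftrightarrow>
     \<mu> = return borel 0 \<or>
     (\<exists>\<sigma>::real. \<sigma> > 0 \<and>
        \<mu> = density lborel (\<lambda>z. ennreal (exp (- (cmod z)\<^sup>2 / (2 * \<sigma>\<^sup>2)) / (2 * pi * \<sigma>\<^sup>2))))"

definition gaussian_measure :: "linf set \<Rightarrow> linf measure \<Rightarrow> bool" where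
  "gaussian_measure X m \<longleftrightarrow> prob_space m \<and> space m = X \<and> sets m = sets (restrict_space borel X)
     \<and> (\<forall>\<phi>. dual_elem X \<phi> \<longrightarrow> centered_complex_gaussian (distr m borel \<phi>))"

definition non_degenerate :: "linf set \<Rightarrow> linf measure \<Rightarrow> bool" where
  "non_degenerate X m \<longleftrightarrow> (\<forall>U. openin (top_of_set X) U \<and> U \<noteq> {} \<longrightarrow> measure m U > 0)"

definition weakly_mixing :: "linf measure \<Rightarrow> (linf \<Rightarrow> linf) \<Rightarrow> bool" where
  "weakly_mixing m T \<longleftrightarrow> T \<in> measurable m m \<and> distr m m T = m \<and>
     (\<forall>A\<in>sets m. \<forall>B\<in>sets m.
        (\<lambda>N. (\<Sum>n<N. \<bar>measure m ((T ^^ n) -` A \<inter> space m \<inter> B) - measure m A * measure m B\<bar>) / real N)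
          \<longlonglongrightarrow> 0)"

definition wm_linear_dyn_system :: "linf set \<Rightarrow> (linf \<Rightarrow> linf) \<Rightarrow> linf measure \<Rightarrow> bool" where
  "wm_linear_dyn_system X T m \<longleftrightarrow> sep_inf_banach X \<and> bounded_op X T
     \<and> gaussian_measure X m \<and> non_degenerate X m \<and> weakly_mixing m T"

definition non_recurrence_set :: "nat set \<Rightarrow> linf measure \<Rightarrow> (linf \<Rightarrow> linf) \<Rightarrow> bool" where
  "non_recurrence_set S m T \<longleftrightarrow> (\<exists>A\<in>sets m. measure m A > 0 \<and>
     (\<forall>k\<in>S. measure m ((T ^^ k) -` A \<inter> space m \<inter> A) = 0))"

end

theory Submission
  imports Defs
begin

text \<open>
  Write \<open>e(x) = exp (2 \<pi> i x)\<close>. First choose \<open>\<theta>\<close> such that \<open>e((n\<^sub>k - p) \<theta>)\<close> stays away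
  from 1: for \<open>p \<noteq> 0\<close> a rational number \<open>1 / n\<^sub>K\<close> works, for \<open>p = 0\<close> compactness gives \<open>\<theta>\<close> with
  all \<open>n\<^sub>k \<theta>\<close> (\<open>k \<ge> 1\<close>) in the middle half of the circle. Then perturb \<open>\<theta>\<close> by a random number
  \<open>\<xi> = \<Sum> \<beta>\<^sub>i / n\<^sub>i\<close> with independent Bernoulli digits of parameter \<open>c / i\<close>. Since \<open>\<Sum> c / i = \<infinity>\<close>, the
  law of \<open>\<lambda> = e(\<theta> + \<xi>)\<close> has no atoms, so the stationary Gaussian process with this spectral
  measure is weakly mixing; since \<open>E |\<lambda>^n\<^sub>k - e(n\<^sub>k \<theta>)|\<^sup>2 = O(c / k)\<close> is square summable, with
  positive probability the process satisfies \<open>X (n\<^sub>k + v) \<approx> e(n\<^sub>k \<theta>) X v\<close> for all \<open>k\<close> at once, which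
  prevents a set on which \<open>X 0 \<approx> 1\<close> from returning at the times \<open>n\<^sub>k - p\<close>.

  The process is a triangular linear image \<open>X n = \<Sum>\<^bsub>j \<le> n\<^esub> a n j g j\<close> of independent standard complex
  Gaussians, where \<open>a\<close> comes from orthogonalising the powers of \<open>\<lambda>\<close> in \<open>L\<^sup>2\<close>. The Banach space is the
  closed span in \<open>\<ell>\<^sup>\<infinity>\<close> of the columns of \<open>a\<close> with weights \<open>2\<^sup>-\<^sup>n\<close>, on which the backward shift is
  bounded and the law of the weighted process is Gaussian and has full support.
\<close>

subsection \<open>Uniqueness of laws with given characteristic function\<close>

text \<open>Two demands compete for the digit probabilities: excluding atoms needs a divergent sum
  of parameters, while a union bound over all times n_k needs summable exceptional probabilities. A
  variance of order c/k is not summable by itself, but the fourth moment of a Gaussian turns it into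
  c^2/k^2; so c/k meets both demands, and a small c pushes the union bound below the probability
  that X 0 is near 1. Weak mixing rests on the Cesaro decay of a n j in n for fixed j: early
  Gaussians are gradually forgotten, and replacing them by fresh copies decouples distant times.
  Triangularity makes this possible; it also lets the weighted column j start at row j, so that its
  norm is at most 2^-j and the random series converges. Multiplication by \<lambda> in the
  orthonormal basis has entries of modulus at most 1, which keeps the closed span invariant under
  the shift. The rational rotation used for p \<noteq> 0 fails for p = 0, because n_K divides every
  later n_k.\<close>

lemma weighted_char_unique:
  fixes X :: "'a \<Rightarrow> real" and Y :: "'b \<Rightarrow> real"
  assumes M: "prob_space M" and N: "prob_space N"
    and [measurable]: "X \<in> borel_measurable M" "Y \<in> borel_measurable N"
      "w \<in> borel_measurable M" "w' \<in> borel_measurable N"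
    and w: "\<And>x. 1 \<le> w x" "\<And>x. w x \<le> K" and w': "\<And>x. 1 \<le> w' x" "\<And>x. w' x \<le> K"
    and eq: "\<And>s. (LINT x|M. of_real (w x) * iexp (s * X x)) = (LINT x|N. of_real (w' x) * iexp (s * Y x))"
    and A: "A \<in> sets borel"
  shows "(LINT x|M. w x * indicator A (X x)) = (LINT x|N. w' x * indicator A (Y x))"
proof -
  \<comment> \<open>Divided by its mean \<open>k\<close>, the weight is a probability density, and
    the law of \<open>X\<close> under it is a real distribution to which Levy uniqueness applies.
    The bound 1 \<le> w secures k > 0; the hypothesis at s = 0 shows that both normalisations
    agree.\<close>
  have *: "\<exists>k D. k > 0 \<and> k = (LINT x|M. w x) \<and> real_distribution D
      \<and> (\<forall>s. char D s = (LINT x|M. of_real (w x) * iexp (s * X x)) / k)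
      \<and> (\<forall>A\<in>sets borel. measure D A = (LINT x|M. w x * indicator A (X x)) / k)"
    if "prob_space M" and [measurable]: "X \<in> borel_measurable M" "w \<in> borel_measurable M"
      and w: "\<And>x. 1 \<le> w x" "\<And>x. w x \<le> K"
    for M :: "'c measure" and X :: "'c \<Rightarrow> real" and w :: "'c \<Rightarrow> real"
  proof -
    interpret prob_space M by fact
    have w0: "0 \<le> w x" for x using w(1)[of x] by linarith
    have wK: "norm (w x) \<le> K" for x using w0[of x] w(2)[of x] by simp
    have iw: "integrable M w" by (rule integrable_const_bound[of _ K]) (use wK in auto)
    define k where "k = (LINT x|M. w x)"
    have "(LINT x|M. 1) \<le> k" unfolding k_def
      by (intro integral_mono iw) (auto simp: w)
    hence k: "k > 0" by (simp add: prob_space)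
    define D0 where "D0 = density M (\<lambda>x. ennreal (w x / k))"
    define D where "D = distr D0 borel X"
    have "emeasure D0 (space D0) = (\<integral>\<^sup>+x. ennreal (w x / k) \<partial>M)"
      unfolding D0_def by (subst emeasure_density) (auto intro!: nn_integral_cong)
    also have "\<dots> = ennreal (LINT x|M. w x / k)"
      using iw w0 k by (intro nn_integral_eq_integral) (auto intro: divide_nonneg_pos)
    also have "\<dots> = 1" using k by (simp add: k_def)
    finally interpret D0: prob_space D0 by (rule prob_spaceI)
    have [measurable]: "X \<in> borel_measurable D0" by (simp add: D0_def)
    have rd: "real_distribution D"
      unfolding D_def by (auto simp: real_distribution_def real_distribution_axioms_def intro!: D0.prob_space_distr)
    have c: "char D s = (LINT x|M. of_real (w x) * iexp (s * X x)) / k" for s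
    proof -
      have "char D s = (LINT x|D0. iexp (s * X x))" unfolding char_def D_def
        by (subst integral_distr) auto
      also have "\<dots> = (LINT x|M. (w x / k) *\<^sub>R iexp (s * X x))" unfolding D0_def
        using k w0 by (subst integral_density) auto
      also have "\<dots> = (LINT x|M. (of_real (w x) * iexp (s * X x)) / k)"
        by (simp add: scaleR_conv_of_real)
      finally show ?thesis by simp
    qed
    have m: "measure D A = (LINT x|M. w x * indicator A (X x)) / k" if "A \<in> sets borel" for A
    proof -
      interpret D: real_distribution D by (rule rd)
      have [measurable]: "A \<in> sets borel" by fact
      have "measure D A = (LINT x|D. indicator A x)" using that by simp
      also have "\<dots> = (LINT x|D0. indicator A (X x))" unfolding D_def
        by (subst integral_distr) auto
      also have "\<dots> = (LINT x|M. (w x / k) *\<^sub>R indicator A (X x))" unfolding D0_def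
        using k w0 by (subst integral_density) auto
      finally show ?thesis by simp
    qed
    show ?thesis using k rd c m k_def by blast
  qed
  obtain k D where D: "k > 0" "k = (LINT x|M. w x)" "real_distribution D"
      "\<And>s. char D s = (LINT x|M. of_real (w x) * iexp (s * X x)) / k"
      "\<And>A. A\<in>sets borel \<Longrightarrow> measure D A = (LINT x|M. w x * indicator A (X x)) / k"
    using *[OF M assms(3,5) w] by blast
  obtain k' D' where D': "k' > 0" "k' = (LINT x|N. w' x)" "real_distribution D'"
      "\<And>s. char D' s = (LINT x|N. of_real (w' x) * iexp (s * Y x)) / k'"
      "\<And>A. A\<in>sets borel \<Longrightarrow> measure D' A = (LINT x|N. w' x * indicator A (Y x)) / k'"
    using *[OF N assms(4,6) w'] by blast
  have kk: "k = k'" using eq[of 0] unfolding D(2) D'(2) by simp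
  have "D = D'"
    by (rule Levy_uniqueness[OF D(3) D'(3)]) (simp add: fun_eq_iff D(4) D'(4) eq kk del: of_real_mult)
  with D(5)[OF A] D'(5)[OF A] kk D(1) show ?thesis by simp
qed

text \<open>Reduction to one-dimensional uniqueness: coordinates are converted one at a time from a
  term in the exponential into an indicator, the remaining factors serving as a weight.\<close>

lemma char_unique_real_sequence:
  fixes M N :: "(nat \<Rightarrow> real) measure"
  assumes M: "prob_space M" and N: "prob_space N"
    and sM[measurable_cong]: "sets M = sets (PiM UNIV (\<lambda>_. borel))"
    and sN[measurable_cong]: "sets N = sets (PiM UNIV (\<lambda>_. borel))"
    and eq: "\<And>d t. (LINT x|M. iexp (\<Sum>i<d. t i * x i)) = (LINT x|N. iexp (\<Sum>i<d. t i * x i))"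
  shows "M = N"
proof -
  interpret M: prob_space M by fact
  interpret N: prob_space N by fact
  \<comment> \<open>\<open>t\<close> and \<open>d\<close> stay arbitrary in the induction, because
    treating coordinate \<open>k\<close> uses the hypothesis at the modified frequencies
    \<open>a * \<theta> x + s * x k\<close>.\<close>
  have main: "(LINT x|M. of_real (\<Prod>i\<in>J. indicator (A i) (x i)) * iexp (\<Sum>i<d. t i * x i))
     = (LINT x|N. of_real (\<Prod>i\<in>J. indicator (A i) (x i)) * iexp (\<Sum>i<d. t i * x i))"
    if "finite J" "\<And>i. i \<in> J \<Longrightarrow> A i \<in> sets borel" for J A d t
    using that
  proof (induction J arbitrary: d t rule: finite_induct)
    case empty
    then show ?case using eq by simp
  next
    case (insert k J)
    define h where "h x = (\<Prod>i\<in>J. indicator (A i) (x i) :: real)" for x :: "nat \<Rightarrow> real"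
    define \<theta> where "\<theta> x = (\<Sum>i<d. t i * x i)" for x :: "nat \<Rightarrow> real"
    have [measurable]: "A i \<in> sets borel" if "i \<in> J" for i using insert that by auto
    have [measurable]: "A k \<in> sets borel" using insert by auto
    have [measurable]: "h \<in> borel_measurable (PiM UNIV (\<lambda>_. borel))" unfolding h_def by measurable
    have [measurable]: "\<theta> \<in> borel_measurable (PiM UNIV (\<lambda>_. borel))" unfolding \<theta>_def by measurable
    have h01: "0 \<le> h x" "h x \<le> 1" for x unfolding h_def
      by (auto intro!: prod_nonneg prod_le_1)
    have hb: "\<bar>h x * y\<bar> \<le> 1" if "\<bar>y\<bar> \<le> 1" for x y
      using h01[of x] that by (simp add: abs_mult mult_le_one)
    have IH: "(LINT x|M. of_real (h x) * iexp (a * \<theta> x + s * x k))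
       = (LINT x|N. of_real (h x) * iexp (a * \<theta> x + s * x k))" for a s
    proof -
      define d' where "d' = max d (Suc k)"
      define t' where "t' i = a * (if i < d then t i else 0) + s * (if i = k then 1 else 0)" for i
      have "(\<Sum>i<d'. t' i * x i) = a * \<theta> x + s * x k" for x
      proof -
        have "(\<Sum>i<d'. t' i * x i) = a * (\<Sum>i<d'. (if i < d then t i else 0) * x i) + s * (\<Sum>i<d'. (if i = k then 1 else 0) * x i)"
          by (simp add: t'_def algebra_simps sum.distrib sum_distrib_left)
        also have "(\<Sum>i<d'. (if i < d then t i else 0) * x i) = \<theta> x"
          unfolding \<theta>_def by (rule sum.mono_neutral_cong_right) (auto simp: d'_def)
        also have "(\<Sum>i<d'. (if i = k then 1 else 0) * x i) = (\<Sum>i\<in>{k}. x i)"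
          by (rule sum.mono_neutral_cong_right) (auto simp: d'_def)
        finally show ?thesis by simp
      qed
      with insert.IH[of t' d'] insert.prems show ?thesis
        by (simp add: h_def)
    qed
    have int[simp]: "integrable M (\<lambda>x. of_real (h x) * iexp (a * \<theta> x + s * x k))"
      "integrable N (\<lambda>x. of_real (h x) * iexp (a * \<theta> x + s * x k))" for a s
      by (auto intro!: M.integrable_const_bound[of _ 1] N.integrable_const_bound[of _ 1]
          simp: norm_mult h01)
    have E1: "(LINT x|M. iexp (s * x k)) = (LINT x|N. iexp (s * x k))" for s
    proof -
      have "(\<Sum>i<Suc k. (if i = k then s else 0) * x i) = s * x k" for x
      proof -
        have "(\<Sum>i<Suc k. (if i = k then s else 0) * x i) = (\<Sum>i\<in>{k}. s * x i)"
          by (rule sum.mono_neutral_cong_right) auto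
        then show ?thesis by simp
      qed
      with eq[where t="\<lambda>i. if i = k then s else 0" and d="Suc k"] show ?thesis by simp
    qed
    have int1: "integrable M (\<lambda>x. iexp (s * x k))" "integrable N (\<lambda>x. iexp (s * x k))" for s
      by (auto intro!: M.integrable_const_bound[of _ 1] N.integrable_const_bound[of _ 1])
    \<comment> \<open>A weight has to be real and at least 1. Since \<open>h * g\<close> lies in
      [-1, 1], \<open>2 + h * g\<close> qualifies; the part due to the constant 2 is known from the
      marginal law of \<open>x k\<close> and is subtracted at the end. Taking cos and sin for
      \<open>g\<close> recovers the complex exponential.\<close>
    have real_w: "(LINT x|M. h x * g (\<theta> x) * indicator (A k) (x k)) = (LINT x|N. h x * g (\<theta> x) * indicator (A k) (x k))"
      if g[measurable]: "g \<in> borel_measurable borel" "\<And>y. \<bar>g y\<bar> \<le> 1"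
        and gexp: "\<And>y. of_real (g y) = u * iexp (a * y) + v * iexp (-(a * y))" for g :: "real \<Rightarrow> real" and u v a
    proof -
      have wb: "1 \<le> 2 + h x * g (\<theta> x)" "2 + h x * g (\<theta> x) \<le> 3" for x
        using hb[of "g (\<theta> x)" x] that(2)[of "\<theta> x"] by (auto simp: abs_le_iff)
      have ex: "of_real (2 + h x * g (\<theta> x)) * iexp (s * x k) = 2 * iexp (s * x k)
         + u * (of_real (h x) * iexp (a * \<theta> x + s * x k)) + v * (of_real (h x) * iexp ((-a) * \<theta> x + s * x k))" for x s
        by (simp add: gexp ring_distribs exp_add exp_minus exp_diff field_simps)
      have "(LINT x|M. of_real (2 + h x * g (\<theta> x)) * iexp (s * x k)) = (LINT x|N. of_real (2 + h x * g (\<theta> x)) * iexp (s * x k))" for s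
      proof -
        define F where "F b x = of_real (h x) * iexp (b * \<theta> x + s * x k)" for b x
        define G where "G x = iexp (s * x k)" for x :: "nat \<Rightarrow> real"
        have "integrable M (F b)" "integrable N (F b)" "integrable M G" "integrable N G"
          "(LINT x|M. F b x) = (LINT x|N. F b x)" "(LINT x|M. G x) = (LINT x|N. G x)" for b
          using int[of b s] IH[of b s] E1[of s] int1[of s] unfolding F_def G_def by blast+
        moreover have "of_real (2 + h x * g (\<theta> x)) * G x = 2 * G x + u * F a x + v * F (-a) x" for x
          unfolding F_def G_def by (rule ex)
        ultimately show ?thesis unfolding G_def[symmetric] by (simp only:) simp
      qed
      from weighted_char_unique[OF M N _ _ _ _ wb wb this, of "A k"]
      have 1: "(LINT x|M. (2 + h x * g (\<theta> x)) * indicator (A k) (x k)) = (LINT x|N. (2 + h x * g (\<theta> x)) * indicator (A k) (x k))"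
        by simp
      have "(LINT x|M. 1 * indicator (A k) (x k)) = (LINT x|N. 1 * indicator (A k) (x k) :: real)"
        by (rule weighted_char_unique[OF M N, where K=1]) (auto simp: E1 simp del: of_real_mult)
      hence 2: "(LINT x|M. indicator (A k) (x k)) = (LINT x|N. indicator (A k) (x k) :: real)" by simp
      have i1: "integrable M (\<lambda>x. indicator (A k) (x k) :: real)" "integrable N (\<lambda>x. indicator (A k) (x k) :: real)"
        by (auto intro!: M.integrable_const_bound[of _ 1] N.integrable_const_bound[of _ 1])
      have b: "\<bar>h x * g (\<theta> x) * indicator (A k) (x k)\<bar> \<le> 1" for x
        using hb[of "g (\<theta> x)" x] that(2)[of "\<theta> x"] by (auto simp: indicator_def)
      have i2: "integrable M (\<lambda>x. h x * g (\<theta> x) * indicator (A k) (x k) :: real)" "integrable N (\<lambda>x. h x * g (\<theta> x) * indicator (A k) (x k) :: real)"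
        using b by (auto intro!: M.integrable_const_bound[of _ 1] N.integrable_const_bound[of _ 1])
      show ?thesis using 1 2 i1 i2 by (simp add: distrib_right)
    qed
    have C: "(LINT x|M. h x * cos (\<theta> x) * indicator (A k) (x k)) = (LINT x|N. h x * cos (\<theta> x) * indicator (A k) (x k))"
      by (rule real_w[of _ "1/2" 1 "1/2"]) (auto simp: cos_of_real[symmetric] cos_exp_eq field_simps)
    have S: "(LINT x|M. h x * sin (\<theta> x) * indicator (A k) (x k)) = (LINT x|N. h x * sin (\<theta> x) * indicator (A k) (x k))"
      by (rule real_w[of _ "1/(2*\<i>)" 1 "-1/(2*\<i>)"]) (auto simp: sin_of_real[symmetric] sin_exp_eq field_simps)
    have cb: "\<bar>h x * cos (\<theta> x) * indicator (A k) (x k)\<bar> \<le> 1" "\<bar>h x * sin (\<theta> x) * indicator (A k) (x k)\<bar> \<le> 1" for x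
      using hb[of "cos (\<theta> x)" x] hb[of "sin (\<theta> x)" x] by (auto simp: indicator_def)
    have i: "integrable M (\<lambda>x. h x * cos (\<theta> x) * indicator (A k) (x k))" "integrable N (\<lambda>x. h x * cos (\<theta> x) * indicator (A k) (x k))"
      "integrable M (\<lambda>x. h x * sin (\<theta> x) * indicator (A k) (x k))" "integrable N (\<lambda>x. h x * sin (\<theta> x) * indicator (A k) (x k))"
      using cb by (auto intro!: M.integrable_const_bound[of _ 1] N.integrable_const_bound[of _ 1])
    have "of_real (\<Prod>i\<in>insert k J. indicator (A i) (x i)) * iexp (\<Sum>i<d. t i * x i)
      = of_real (h x * cos (\<theta> x) * indicator (A k) (x k)) + \<i> * of_real (h x * sin (\<theta> x) * indicator (A k) (x k))" for x
      using insert.hyps by (simp add: h_def[symmetric] \<theta>_def[symmetric] exp_Euler cos_of_real sin_of_real algebra_simps)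
    then show ?case using i C S
      by (simp del: of_real_mult)
  qed
  show ?thesis
  proof (rule measure_eqI_PiM_infinite[OF sM sN])
    show "finite_measure M" by unfold_locales
    fix A and J :: "nat set" assume J: "finite J" and A: "\<And>i. i \<in> J \<Longrightarrow> A i \<in> sets (borel :: real measure)"
    let ?E = "prod_emb UNIV (\<lambda>_. borel) J (Pi\<^sub>E J A) :: (nat \<Rightarrow> real) set"
    have E: "indicator ?E x = (\<Prod>i\<in>J. indicator (A i) (x i) :: real)" for x
    proof (cases "\<forall>i\<in>J. x i \<in> A i")
      case True
      then show ?thesis by (auto simp: prod_emb_iff PiE_iff indicator_def)
    next
      case False
      then have "(\<Prod>i\<in>J. indicator (A i) (x i) :: real) = 0" using J by (intro prod_zero) (auto simp: indicator_def)
      with False show ?thesis by (auto simp: prod_emb_iff PiE_iff indicator_def)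
    qed
    have [measurable]: "?E \<in> sets (PiM UNIV (\<lambda>_. borel))" using J A by (auto intro!: sets_PiM_I)
    have "(LINT x|M. of_real (indicator ?E x) :: complex) = (LINT x|N. of_real (indicator ?E x))"
    proof -
      have "(LINT x|M. of_real (\<Prod>i\<in>J. indicator (A i) (x i)) * iexp (\<Sum>i<0. 0 * x i))
        = (LINT x|N. of_real (\<Prod>i\<in>J. indicator (A i) (x i)) * iexp (\<Sum>i<0. 0 * x i))"
        by (rule main[OF J A])
      then show ?thesis unfolding E by simp
    qed
    hence "(LINT x|M. indicator ?E x :: real) = (LINT x|N. indicator ?E x)"
      by (simp only: integral_complex_of_real of_real_eq_iff)
    then show "emeasure M ?E = emeasure N ?E"
      by (simp add: M.emeasure_eq_measure N.emeasure_eq_measure)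
  qed
qed

text \<open>Real and imaginary parts are interleaved at even and odd positions. As Re (Complex s
  (-t) * z) = s * Re z + t * Im z, every real linear form in them has the shape required by the
  hypothesis.\<close>

lemma char_unique_complex_sequence:
  fixes M N :: "(nat \<Rightarrow> complex) measure"
  assumes M: "prob_space M" and N: "prob_space N"
    and sM[measurable_cong]: "sets M = sets (PiM UNIV (\<lambda>_. borel))"
    and sN[measurable_cong]: "sets N = sets (PiM UNIV (\<lambda>_. borel))"
    and eq: "\<And>d c. (LINT x|M. iexp (Re (\<Sum>i<d. c i * x i))) = (LINT x|N. iexp (Re (\<Sum>i<d. c i * x i)))"
  shows "M = N"
proof -
  interpret M: prob_space M by fact
  interpret N: prob_space N by fact
  define \<rho> where "\<rho> x = (\<lambda>i. if even i then Re (x (i div 2)) else Im (x (i div 2)))" for x :: "nat \<Rightarrow> complex"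
  define \<kappa> where "\<kappa> y = (\<lambda>i. Complex (y (2*i)) (y (2*i+1)))" for y :: "nat \<Rightarrow> real"
  have \<kappa>\<rho>: "\<kappa> (\<rho> x) = x" for x by (simp add: \<kappa>_def \<rho>_def)
  have [measurable]: "\<rho> \<in> PiM UNIV (\<lambda>_. borel) \<rightarrow>\<^sub>M PiM UNIV (\<lambda>_. borel)"
    unfolding \<rho>_def
    by (rule measurable_PiM_single') (auto simp: space_PiM)
  have [measurable]: "\<kappa> \<in> PiM UNIV (\<lambda>_. borel) \<rightarrow>\<^sub>M PiM UNIV (\<lambda>_. borel)"
    unfolding \<kappa>_def
    by (rule measurable_PiM_single') (auto simp: space_PiM Complex_eq)
  let ?R = "PiM UNIV (\<lambda>_. borel) :: (nat \<Rightarrow> real) measure"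
  have sum2: "(\<Sum>i<2*d. f i) = (\<Sum>i<d. f (2*i) + f (2*i+1))" for f :: "nat \<Rightarrow> real" and d
    by (induction d) auto
  have ceq: "(LINT x|M. iexp (\<Sum>i<d. t i * \<rho> x i)) = (LINT x|N. iexp (\<Sum>i<d. t i * \<rho> x i))" for d t
  proof -
    define t' where "t' i = (if i < d then t i else 0)" for i
    have "(\<Sum>i<d. t i * \<rho> x i) = Re (\<Sum>i<d. Complex (t' (2*i)) (- t' (2*i+1)) * x i)" for x
    proof -
      have "(\<Sum>i<d. t i * \<rho> x i) = (\<Sum>i<2*d. t' i * \<rho> x i)"
        by (rule sum.mono_neutral_cong_left) (auto simp: t'_def)
      also have "\<dots> = (\<Sum>i<d. t' (2*i) * Re (x i) + t' (2*i+1) * Im (x i))"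
        by (subst sum2) (simp add: \<rho>_def)
      finally show ?thesis by simp
    qed
    then show ?thesis using eq[where d=d and c="\<lambda>i. Complex (t' (2*i)) (- t' (2*i+1))"] by presburger
  qed
  have "distr M ?R \<rho> = distr N ?R \<rho>"
    by (rule char_unique_real_sequence)
       (auto intro!: M.prob_space_distr N.prob_space_distr simp: integral_distr ceq simp del: of_real_mult of_real_sum)
  hence "distr (distr M ?R \<rho>) M \<kappa> = distr (distr N ?R \<rho>) M \<kappa>" by simp
  hence "distr M M id = distr N M id"
    by (simp add: distr_distr comp_def \<kappa>\<rho> id_def)
  then show ?thesis
    by (metis distr_cong distr_id id_apply sM sN)
qed

text \<open>A single variable is viewed as a constant sequence; a linear form in its coordinates is
  then multiplication by the sum of the coefficients.\<close>

lemma char_unique_complex: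
  fixes M N :: "complex measure"
  assumes M: "prob_space M" and N: "prob_space N"
    and sM[measurable_cong]: "sets M = sets borel" and sN[measurable_cong]: "sets N = sets borel"
    and eq: "\<And>c. (LINT x|M. iexp (Re (c * x))) = (LINT x|N. iexp (Re (c * x)))"
  shows "M = N"
proof -
  interpret M: prob_space M by fact
  interpret N: prob_space N by fact
  let ?R = "PiM UNIV (\<lambda>_::nat. borel) :: (nat \<Rightarrow> complex) measure"
  have cM: "(\<lambda>x _. x) \<in> M \<rightarrow>\<^sub>M ?R" and cN: "(\<lambda>x _. x) \<in> N \<rightarrow>\<^sub>M ?R"
    by (rule measurable_PiM_single'; auto simp: space_PiM)+
  have f: "(\<lambda>x. iexp (Re (\<Sum>i<d. c i * x i))) \<in> borel_measurable ?R" for d :: nat and c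
    by measurable
  have e: "(\<lambda>x. x 0) \<in> ?R \<rightarrow>\<^sub>M M" by measurable
  have *: "(LINT x|M. iexp (Re (\<Sum>i<d. c i * x))) = (LINT x|N. iexp (Re (\<Sum>i<d. c i * x)))" for d :: nat and c
    using eq[of "\<Sum>i<d. c i"] by (simp only: sum_distrib_right)
  have "distr M ?R (\<lambda>x _. x) = distr N ?R (\<lambda>x _. x)"
  proof (rule char_unique_complex_sequence)
    show "(LINT x|distr M ?R (\<lambda>x _. x). iexp (Re (\<Sum>i<d. c i * x i)))
      = (LINT x|distr N ?R (\<lambda>x _. x). iexp (Re (\<Sum>i<d. c i * x i)))" for d c
      unfolding integral_distr[OF cM f] integral_distr[OF cN f] by (rule *)
  qed (simp_all add: M.prob_space_distr[OF cM] N.prob_space_distr[OF cN])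
  hence "distr (distr M ?R (\<lambda>x _. x)) M (\<lambda>x. x 0) = distr (distr N ?R (\<lambda>x _. x)) M (\<lambda>x. x 0)" by simp
  hence "distr M M (\<lambda>x. x) = distr N M (\<lambda>x. x)"
    unfolding distr_distr[OF e cM] distr_distr[OF e cN] comp_def .
  then show ?thesis
    by (metis distr_cong distr_id sM sN)
qed

subsection \<open>The standard complex Gaussian law and Gaussian sequences\<close>

text \<open>The density alternative of \<open>centered_complex_gaussian\<close>; real and imaginary
  part each have variance s^2. At s = 0 division by zero makes it the zero measure, so Dirac masses
  are always treated separately.\<close>

definition cgauss :: "real \<Rightarrow> complex measure" where
  "cgauss s = density lborel (\<lambda>z. ennreal (exp (- (cmod z)\<^sup>2 / (2 * s\<^sup>2)) / (2 * pi * s\<^sup>2)))"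

lemma sets_cgauss[simp, measurable_cong]: "sets (cgauss s) = sets borel"
  by (simp add: cgauss_def)

lemma space_cgauss[simp]: "space (cgauss s) = UNIV"
  by (simp add: cgauss_def)

lemma measurable_Complex[measurable]: "(\<lambda>(x, y). Complex x y) \<in> borel_measurable (borel \<Otimes>\<^sub>M borel)"
  by (simp add: Complex_eq split_beta')

text \<open>Links planar Lebesgue measure to pairs of reals, which reduces the complex Gaussian to
  two independent real normal variables.\<close>

lemma lborel_complex:
  "(lborel :: complex measure) = distr (lborel \<Otimes>\<^sub>M lborel) borel (\<lambda>(x, y). Complex x y)"
proof (rule lborel_eqI)
  fix l u :: complex assume le: "\<And>b. b \<in> Basis \<Longrightarrow> l \<bullet> b \<le> u \<bullet> b"
  have lu: "Re l \<le> Re u" "Im l \<le> Im u" using le[of 1] le[of \<i>] by (auto simp: Basis_complex_def)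
  have "emeasure (distr (lborel \<Otimes>\<^sub>M lborel) borel (\<lambda>(x, y). Complex x y)) (box l u)
    = emeasure (lborel \<Otimes>\<^sub>M lborel) ({Re l <..< Re u} \<times> {Im l <..< Im u})"
    by (subst emeasure_distr)
       (auto simp: in_box_complex_iff space_pair_measure intro!: arg_cong2[where f=emeasure])
  also have "\<dots> = ennreal (Re u - Re l) * ennreal (Im u - Im l)"
    using lu by (subst lborel.emeasure_pair_measure_Times) auto
  also have "\<dots> = (\<Prod>b\<in>Basis. (u - l) \<bullet> b)"
    using lu by (simp add: Basis_complex_def ennreal_mult)
  finally show "emeasure (distr (lborel \<Otimes>\<^sub>M lborel) borel (\<lambda>(x, y). Complex x y)) (box l u) = (\<Prod>b\<in>Basis. (u - l) \<bullet> b)" .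
qed simp

lemma cgauss_1_eq:
  "cgauss 1 = distr (std_normal_distribution \<Otimes>\<^sub>M std_normal_distribution) borel (\<lambda>(x, y). Complex x y)"
proof -
  have "cgauss 1 = distr (density (lborel \<Otimes>\<^sub>M lborel)
      ((\<lambda>z. ennreal (exp (- (cmod z)\<^sup>2 / 2) / (2 * pi))) \<circ> (\<lambda>(x, y). Complex x y))) borel (\<lambda>(x, y). Complex x y)"
    unfolding cgauss_def by (subst lborel_complex, subst density_distr) (auto simp: comp_def)
  also have "(\<lambda>z. ennreal (exp (- (cmod z)\<^sup>2 / 2) / (2 * pi))) \<circ> (\<lambda>(x, y). Complex x y)
     = (\<lambda>(x, y). ennreal (std_normal_density x) * ennreal (std_normal_density y))"
  proof -
    have "exp (- (x\<^sup>2 + y\<^sup>2) / 2) / (2 * pi) = std_normal_density x * std_normal_density y" for x y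
      by (simp add: std_normal_density_def exp_add[symmetric] real_sqrt_mult[symmetric] add_divide_distrib)
    then show ?thesis
      by (auto simp: fun_eq_iff cmod_def ennreal_mult[symmetric] normal_density_nonneg)
  qed
  also have "density (lborel \<Otimes>\<^sub>M lborel) \<dots> = std_normal_distribution \<Otimes>\<^sub>M std_normal_distribution"
    by (rule pair_measure_density[symmetric])
       (use prob_space_imp_sigma_finite[OF prob_space_normal_density[of 1 0]] in \<open>auto intro: sigma_finite_lborel\<close>)
  finally show ?thesis .
qed

lemma cgauss_scale:
  assumes "s > 0"
  shows "cgauss s = distr (cgauss 1) borel (\<lambda>z. s *\<^sub>R z)"
proof -
  define f where "f z = ennreal (exp (- (cmod z)\<^sup>2 / (2 * s\<^sup>2)) / (2 * pi * s\<^sup>2))" for z :: complex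
  have [measurable]: "f \<in> borel_measurable borel" unfolding f_def by measurable
  have "cgauss s = density (density (distr lborel borel (\<lambda>x. 0 + s *\<^sub>R x)) (\<lambda>_. \<bar>s\<bar>^DIM(complex))) f"
    unfolding cgauss_def f_def[abs_def]
    by (subst lborel_affine[of s 0]) (use assms in auto)
  also have "\<dots> = density (distr lborel borel (\<lambda>x. s *\<^sub>R x)) (\<lambda>x. ennreal (s\<^sup>2) * f x)"
    by (subst density_density_eq) auto
  also have "\<dots> = distr (density lborel (\<lambda>x. ennreal (s\<^sup>2) * f (s *\<^sub>R x))) borel (\<lambda>x. s *\<^sub>R x)"
    by (subst density_distr) (auto simp: comp_def)
  also have "density lborel (\<lambda>x. ennreal (s\<^sup>2) * f (s *\<^sub>R x)) = cgauss 1"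
    unfolding cgauss_def f_def using assms
    by (intro density_cong) (auto simp: ennreal_mult[symmetric] power_mult_distrib)
  finally show ?thesis .
qed

lemma prob_space_cgauss_1: "prob_space (cgauss 1)"
proof -
  interpret N: prob_space std_normal_distribution by (rule prob_space_normal_density) simp
  interpret pair_prob_space std_normal_distribution std_normal_distribution ..
  show ?thesis unfolding cgauss_1_eq by (rule prob_space_distr) auto
qed

lemma prob_space_cgauss: "s > 0 \<Longrightarrow> prob_space (cgauss s)"
  unfolding cgauss_scale by (rule prob_space.prob_space_distr[OF prob_space_cgauss_1]) simp

lemma char_cgauss_1:
  "(LINT z|cgauss 1. iexp (Re (c * z))) = of_real (exp (- (cmod c)\<^sup>2 / 2))"
proof -
  let ?N = std_normal_distribution
  interpret N: prob_space ?N by (rule prob_space_normal_density) simp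
  interpret P: pair_prob_space ?N ?N ..
  have "(LINT z|cgauss 1. iexp (Re (c * z))) = (LINT p|(?N \<Otimes>\<^sub>M ?N). iexp (Re c * fst p) * iexp (- Im c * snd p))"
    unfolding cgauss_1_eq
    by (subst integral_distr) (auto simp: split_beta' exp_add[symmetric] algebra_simps intro!: Bochner_Integration.integral_cong)
  also have "\<dots> = (LINT x|?N. LINT y|?N. iexp (Re c * x) * iexp (- Im c * y))"
    by (subst P.integral_fst'[symmetric])
       (auto intro!: P.P.integrable_const_bound[of _ 1] simp: norm_mult)
  also have "\<dots> = char ?N (Re c) * char ?N (- Im c)"
    unfolding char_def by simp
  also have "\<dots> = of_real (exp (- (Re c)\<^sup>2 / 2) * exp (- (Im c)\<^sup>2 / 2))"
    by (simp add: char_std_normal_distribution)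
  also have "exp (- (Re c)\<^sup>2 / 2) * exp (- (Im c)\<^sup>2 / 2) = exp (- (cmod c)\<^sup>2 / 2)"
    by (simp add: exp_add[symmetric] cmod_def algebra_simps add_divide_distrib)
  finally show ?thesis .
qed

lemma char_cgauss:
  assumes "s > 0"
  shows "(LINT z|cgauss s. iexp (Re (c * z))) = of_real (exp (- (s * cmod c)\<^sup>2 / 2))"
proof -
  have "(LINT z|cgauss s. iexp (Re (c * z))) = (LINT z|cgauss 1. iexp (Re ((of_real s * c) * z)))"
    unfolding cgauss_scale[OF assms]
    by (subst integral_distr) (auto simp: algebra_simps)
  also have "\<dots> = of_real (exp (- (s * cmod c)\<^sup>2 / 2))"
    unfolding char_cgauss_1 using assms by (simp add: norm_mult)
  finally show ?thesis .
qed

text \<open>Prepares a Markov bound with fourth powers; (x^2 + y^2)^2 \<le> 2 x^4 + 2 y^4 reduces it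
  to real normal moments.\<close>

lemma integrable_cgauss_4: "integrable (cgauss 1) (\<lambda>z. cmod z ^ 4)"
proof -
  let ?N = std_normal_distribution
  interpret N: prob_space ?N by (rule prob_space_normal_density) simp
  interpret P: pair_prob_space ?N ?N ..
  have 4: "integrable ?N (\<lambda>x. x ^ 4)" by (rule integrable_std_normal_distribution_moment)
  have f: "integrable (?N \<Otimes>\<^sub>M ?N) (\<lambda>p. fst p ^ 4)"
    by (rule integrable_distr[of fst "?N \<Otimes>\<^sub>M ?N" ?N "\<lambda>x. x^4"]) (auto simp: N.distr_pair_fst 4)
  have distr_pair_snd_std: "distr (?N \<Otimes>\<^sub>M ?N) ?N snd = ?N"
  proof -
    have "distr (?N \<Otimes>\<^sub>M ?N) ?N snd = distr (distr (?N \<Otimes>\<^sub>M ?N) (?N \<Otimes>\<^sub>M ?N) (\<lambda>(x, y). (y, x))) ?N fst"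
      by (subst distr_distr) (auto simp: comp_def split_beta')
    then show ?thesis
      by (simp only: P.distr_pair_swap[symmetric] N.distr_pair_fst)
  qed
  have s: "integrable (?N \<Otimes>\<^sub>M ?N) (\<lambda>p. snd p ^ 4)"
    by (rule integrable_distr[of snd "?N \<Otimes>\<^sub>M ?N" ?N "\<lambda>x. x^4"]) (auto simp: distr_pair_snd_std 4)
  have le: "cmod (Complex x y) ^ 4 \<le> 2 * x ^ 4 + 2 * y ^ 4" for x y
  proof -
    have "cmod (Complex x y) ^ 4 = ((cmod (Complex x y))\<^sup>2)\<^sup>2" by (simp flip: power_mult)
    also have "\<dots> = (x\<^sup>2 + y\<^sup>2)\<^sup>2" by (subst cmod_power2) simp
    also have "\<dots> \<le> 2 * x ^ 4 + 2 * y ^ 4"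
      using zero_le_power2[of "x\<^sup>2 - y\<^sup>2"] by (simp add: power2_eq_square power4_eq_xxxx algebra_simps)
    finally show ?thesis .
  qed
  have "integrable (?N \<Otimes>\<^sub>M ?N) (\<lambda>p. cmod (Complex (fst p) (snd p)) ^ 4)"
  proof (rule Bochner_Integration.integrable_bound)
    show "integrable (?N \<Otimes>\<^sub>M ?N) (\<lambda>p. 2 * fst p ^ 4 + 2 * snd p ^ 4)"
      using f s by simp
    show "AE p in ?N \<Otimes>\<^sub>M ?N. norm (cmod (Complex (fst p) (snd p)) ^ 4) \<le> norm (2 * fst p ^ 4 + 2 * snd p ^ 4)"
      using le by (intro AE_I2) (simp only: real_norm_def, smt (verit) zero_le_even_power even_numeral)
  qed (simp add: Complex_eq)
  then show ?thesis unfolding cgauss_1_eq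
    by (subst integrable_distr_eq) (auto simp: split_beta')
qed

text \<open>The density vanishes nowhere, so a null ball would be Lebesgue-negligible.\<close>

lemma cgauss_ball_pos:
  assumes "r > 0"
  shows "measure (cgauss 1) (ball a r) > 0"
proof -
  interpret prob_space "cgauss 1" by (rule prob_space_cgauss_1)
  let ?f = "\<lambda>z. ennreal (exp (- (cmod z)\<^sup>2 / (2 * 1\<^sup>2)) / (2 * pi * 1\<^sup>2))"
  have "ball a r \<notin> null_sets (cgauss 1)"
  proof
    assume "ball a r \<in> null_sets (cgauss 1)"
    hence "AE z in lborel. z \<in> ball a r \<longrightarrow> ?f z = 0"
      unfolding cgauss_def by (subst (asm) null_sets_density_iff) auto
    hence "AE z in lborel. z \<notin> ball a r"
      by eventually_elim (use pi_gt_zero in \<open>auto simp: ennreal_eq_0_iff divide_le_0_iff not_le\<close>)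
    then have "ball a r \<in> null_sets lborel" by (rule AE_iff_null_sets[THEN iffD2, rotated]) auto
    then have "negligible (ball a r)"
      using negligible_iff_null_sets null_sets_completionI by blast
    then show False using assms by (metis ball_eq_empty not_le open_ball open_not_negligible)
  qed
  then have "measure (cgauss 1) (ball a r) \<noteq> 0"
    by (auto simp: null_sets_def emeasure_eq_measure)
  then show ?thesis by (simp add: zero_less_measure_iff)
qed

section \<open>Independent standard complex Gaussians and their linear images\<close>

lemma indep_vars_PiM_coordinates:
  assumes M: "\<And>i. prob_space (M i)"
  shows "prob_space.indep_vars (PiM UNIV M) M (\<lambda>i \<omega>. \<omega> i) (UNIV :: 'i set)"
proof -
  interpret P: prob_space "PiM UNIV M" by (rule prob_space_PiM) (rule M)
  show ?thesis
  proof (subst P.indep_vars_iff_distr_eq_PiM)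
    have "distr (PiM UNIV M) (M i) (\<lambda>\<omega>. \<omega> i) = M i" for i
      by (rule distr_PiM_component) (auto simp: M)
    then show "distr (PiM UNIV M) (PiM UNIV M) (\<lambda>x. \<lambda>i\<in>UNIV. x i) =
        (\<Pi>\<^sub>M i\<in>UNIV. distr (PiM UNIV M) (M i) (\<lambda>\<omega>. \<omega> i))"
      by (simp add: restrict_UNIV distr_id)
  qed auto
qed

abbreviation cseq :: "(nat \<Rightarrow> complex) measure" where
  "cseq \<equiv> PiM UNIV (\<lambda>_. borel)"

definition gseq :: "(nat \<Rightarrow> complex) measure" where
  "gseq = PiM UNIV (\<lambda>_. cgauss 1)"

lemma sets_gseq[simp, measurable_cong]: "sets gseq = sets cseq"
  unfolding gseq_def by (rule sets_PiM_cong) auto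

lemma space_gseq[simp]: "space gseq = UNIV"
  by (simp add: gseq_def space_PiM)

interpretation gseq: prob_space gseq
  unfolding gseq_def by (rule prob_space_PiM) (rule prob_space_cgauss_1)

lemma distr_gseq_component: "distr gseq borel (\<lambda>\<omega>. \<omega> i) = cgauss 1"
proof -
  have "distr gseq (cgauss 1) (\<lambda>\<omega>. \<omega> i) = cgauss 1"
    unfolding gseq_def by (rule distr_PiM_component) (auto simp: prob_space_cgauss_1)
  then show ?thesis by (metis distr_cong sets_cgauss)
qed

lemma indep_vars_gseq: "gseq.indep_vars (\<lambda>_. borel) (\<lambda>i \<omega>. \<omega> i) UNIV"
proof -
  have "gseq.indep_vars (\<lambda>_. cgauss 1) (\<lambda>i \<omega>. \<omega> i) UNIV"
    unfolding gseq_def by (rule indep_vars_PiM_coordinates) (rule prob_space_cgauss_1)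
  from gseq.indep_vars_compose2[OF this, of "\<lambda>_ x. x" "\<lambda>_. borel"] show ?thesis
    by simp
qed

lemma gseq_reindex:
  assumes "inj f"
  shows "distr gseq cseq (\<lambda>\<omega> n. \<omega> (f n)) = gseq"
proof -
  have "distr gseq gseq (\<lambda>\<omega>. \<lambda>n\<in>UNIV. \<omega> (f n)) = gseq"
    unfolding gseq_def by (rule distr_PiM_reindex) (auto simp: assms prob_space_cgauss_1)
  then show ?thesis by (simp add: restrict_UNIV cong: distr_cong)
qed

lemma measurable_cseqI:
  assumes "\<And>i. (\<lambda>x. f x i) \<in> borel_measurable M"
  shows "f \<in> M \<rightarrow>\<^sub>M cseq"
  by (rule measurable_PiM_single') (use assms in \<open>auto simp: space_PiM\<close>)

lemma char_gseq:
  "(LINT \<omega>|gseq. iexp (Re (\<Sum>j<d. c j * \<omega> j))) = of_real (exp (- (\<Sum>j<d. (cmod (c j))\<^sup>2) / 2))"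
proof -
  have "(LINT \<omega>|gseq. iexp (Re (\<Sum>j<d. c j * \<omega> j))) = (LINT \<omega>|gseq. (\<Prod>j<d. iexp (Re (c j * \<omega> j))))"
    by (intro Bochner_Integration.integral_cong) (auto simp: exp_sum[symmetric] sum_distrib_left)
  also have "\<dots> = (\<Prod>j<d. LINT \<omega>|gseq. iexp (Re (c j * \<omega> j)))"
  proof (rule gseq.indep_vars_lebesgue_integral)
    have "gseq.indep_vars (\<lambda>_. borel) (\<lambda>i \<omega>. \<omega> i) {..<d}"
      by (rule gseq.indep_vars_subset[OF indep_vars_gseq]) auto
    then show "gseq.indep_vars (\<lambda>_. borel) (\<lambda>i \<omega>. iexp (Re (c i * \<omega> i))) {..<d}"
      by (rule gseq.indep_vars_compose2) measurable
    show "integrable gseq (\<lambda>\<omega>. iexp (Re (c i * \<omega> i)))" for i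
      by (rule gseq.integrable_const_bound[of _ 1]) auto
  qed simp
  also have "\<dots> = (\<Prod>j<d. of_real (exp (- (cmod (c j))\<^sup>2 / 2)))"
  proof (rule prod.cong[OF refl])
    fix j
    have "(LINT \<omega>|gseq. iexp (Re (c j * \<omega> j))) = (LINT z|distr gseq borel (\<lambda>\<omega>. \<omega> j). iexp (Re (c j * z)))"
      by (subst integral_distr) auto
    then show "(LINT \<omega>|gseq. iexp (Re (c j * \<omega> j))) = of_real (exp (- (cmod (c j))\<^sup>2 / 2))"
      unfolding distr_gseq_component char_cgauss_1 .
  qed
  also have "\<dots> = of_real (exp (- (\<Sum>j<d. (cmod (c j))\<^sup>2) / 2))"
    by (simp add: exp_sum[symmetric] sum_negf sum_divide_distrib flip: of_real_prod)
  finally show ?thesis .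
qed

lemma distr_gseq_linear:
  assumes "(\<Sum>j<d. (cmod (c j))\<^sup>2) > 0"
  shows "distr gseq borel (\<lambda>\<omega>. \<Sum>j<d. c j * \<omega> j) = cgauss (sqrt (\<Sum>j<d. (cmod (c j))\<^sup>2))"
proof (rule char_unique_complex)
  show "prob_space (distr gseq borel (\<lambda>\<omega>. \<Sum>j<d. c j * \<omega> j))"
    by (rule gseq.prob_space_distr) measurable
  show "prob_space (cgauss (sqrt (\<Sum>j<d. (cmod (c j))\<^sup>2)))"
    by (rule prob_space_cgauss) (use assms in simp)
  fix b
  have "(LINT x|distr gseq borel (\<lambda>\<omega>. \<Sum>j<d. c j * \<omega> j). iexp (Re (b * x)))
    = (LINT \<omega>|gseq. iexp (Re (\<Sum>j<d. (b * c j) * \<omega> j)))"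
    by (subst integral_distr) (auto simp only: sum_distrib_left mult.assoc, measurable)
  also have "\<dots> = of_real (exp (- (sqrt (\<Sum>j<d. (cmod (c j))\<^sup>2) * cmod b)\<^sup>2 / 2))"
    unfolding char_gseq using assms
    by (simp add: norm_mult power_mult_distrib sum_distrib_left mult.commute)
  finally show "(LINT x|distr gseq borel (\<lambda>\<omega>. \<Sum>j<d. c j * \<omega> j). iexp (Re (b * x))) =
      (LINT x|cgauss (sqrt (\<Sum>j<d. (cmod (c j))\<^sup>2)). iexp (Re (b * x)))"
    using assms by (subst char_cgauss) auto
qed auto

definition cgauss_moment4 :: real where
  "cgauss_moment4 = (LINT z|cgauss 1. cmod z ^ 4)"

lemma cgauss_moment4_nonneg: "cgauss_moment4 \<ge> 0"
  unfolding cgauss_moment4_def by simp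

text \<open>Markov's inequality for fourth powers makes the bound quadratic in the variance, so
  variances of order 1/k have summable bounds. Zero variance is split off because the rescaling to
  \<open>cgauss 1\<close> needs a positive scale.\<close>

lemma gseq_linear_tail:
  assumes r: "r > 0"
  shows "measure gseq {\<omega>. r \<le> cmod (\<Sum>j<d. c j * \<omega> j)} \<le> cgauss_moment4 * (\<Sum>j<d. (cmod (c j))\<^sup>2)\<^sup>2 / r ^ 4"
proof (cases "(\<Sum>j<d. (cmod (c j))\<^sup>2) > 0")
  case False
  then have "(\<Sum>j<d. (cmod (c j))\<^sup>2) = 0" by (meson sum_nonneg zero_le_power2 antisym not_less)
  then have "c j = 0" if "j < d" for j using that by (subst (asm) sum_nonneg_eq_0_iff) auto
  then have "{\<omega>. r \<le> cmod (\<Sum>j<d. c j * \<omega> j)} = {}" using r by auto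
  then show ?thesis using r cgauss_moment4_nonneg by simp
next
  case True
  define s where "s = sqrt (\<Sum>j<d. (cmod (c j))\<^sup>2)"
  have s: "s > 0" using True by (simp add: s_def)
  interpret C: prob_space "cgauss 1" by (rule prob_space_cgauss_1)
  have "measure gseq {\<omega>. r \<le> cmod (\<Sum>j<d. c j * \<omega> j)} = measure (cgauss s) {z. r \<le> cmod z}"
    unfolding s_def distr_gseq_linear[OF True, symmetric]
    by (subst measure_distr) (auto simp: vimage_def)
  also have "\<dots> = measure (cgauss 1) {z. r \<le> s * cmod z}"
    unfolding cgauss_scale[OF s] using s by (subst measure_distr) (auto simp: vimage_def)
  also have "{z. r \<le> s * cmod z} = {z. (r / s) ^ 4 \<le> cmod z ^ 4}"
  proof -
    have "r \<le> s * cmod z \<longleftrightarrow> (r / s) ^ 4 \<le> cmod z ^ 4" for z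
      using r s by (subst power_mono_iff) (auto simp: field_simps)
    then show ?thesis by simp
  qed
  also have "measure (cgauss 1) {z. (r / s) ^ 4 \<le> cmod z ^ 4} \<le> cgauss_moment4 / (r / s) ^ 4"
    using integral_Markov_inequality_measure[where M="cgauss 1" and A="{}" and u="\<lambda>z. cmod z ^ 4" and c="(r/s)^4"]
      integrable_cgauss_4 r s unfolding cgauss_moment4_def by simp
  also have "\<dots> = cgauss_moment4 * (s\<^sup>2)\<^sup>2 / r ^ 4"
    using s r by (simp add: field_simps)
  also have "s\<^sup>2 = (\<Sum>j<d. (cmod (c j))\<^sup>2)" unfolding s_def using True by simp
  finally show ?thesis .
qed

lemma sum_sq_norm_combination:
  fixes a :: "nat \<Rightarrow> nat \<Rightarrow> complex"
  shows "of_real (\<Sum>j<K. (cmod (\<Sum>i<D. c i * a i j))\<^sup>2)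
    = (\<Sum>i<D. \<Sum>k<D. c i * cnj (c k) * (\<Sum>j<K. a i j * cnj (a k j)))"
proof -
  have "of_real (\<Sum>j<K. (cmod (\<Sum>i<D. c i * a i j))\<^sup>2)
    = (\<Sum>j<K. \<Sum>i<D. \<Sum>k<D. c i * a i j * cnj (c k * a k j))"
    unfolding of_real_sum complex_norm_square cnj_sum sum_product by simp
  also have "\<dots> = (\<Sum>i<D. \<Sum>k<D. \<Sum>j<K. c i * a i j * cnj (c k * a k j))"
    by (subst sum.swap, rule sum.cong[OF refl], subst sum.swap) simp
  finally show ?thesis by (simp add: sum_distrib_left algebra_simps)
qed

text \<open>The characteristic function of a finite linear form depends on the rows only through a
  Hermitian form in their Gram matrix. The limit \<open>d (max i k)\<close> covers the supports of
  both rows, so the truncated sums are full inner products.\<close>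

lemma gseq_linear_law_eq:
  fixes a b :: "nat \<Rightarrow> nat \<Rightarrow> complex" and d e :: "nat \<Rightarrow> nat"
  assumes d: "mono d" and e: "mono e"
    and a: "\<And>i j. d i \<le> j \<Longrightarrow> a i j = 0" and b: "\<And>i j. e i \<le> j \<Longrightarrow> b i j = 0"
    and gram: "\<And>i k. (\<Sum>j<d (max i k). a i j * cnj (a k j)) = (\<Sum>j<e (max i k). b i j * cnj (b k j))"
  shows "distr gseq cseq (\<lambda>\<omega> n. \<Sum>j<d n. a n j * \<omega> j) = distr gseq cseq (\<lambda>\<omega> n. \<Sum>j<e n. b n j * \<omega> j)"
proof (rule char_unique_complex_sequence)
  have [measurable]: "(\<lambda>\<omega> n. \<Sum>j<d n. a n j * \<omega> j) \<in> cseq \<rightarrow>\<^sub>M cseq" for d a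
    by (rule measurable_cseqI) measurable
  show "prob_space (distr gseq cseq (\<lambda>\<omega> n. \<Sum>j<d n. a n j * \<omega> j))"
    "prob_space (distr gseq cseq (\<lambda>\<omega> n. \<Sum>j<e n. b n j * \<omega> j))"
    by (auto intro!: gseq.prob_space_distr)
  fix D :: nat and c :: "nat \<Rightarrow> complex"
  have *: "(LINT x|distr gseq cseq (\<lambda>\<omega> n. \<Sum>j<d n. a n j * \<omega> j). iexp (Re (\<Sum>i<D. c i * x i)))
    = of_real (exp (- Re (\<Sum>i<D. \<Sum>k<D. c i * cnj (c k) * (\<Sum>j<d (max i k). a i j * cnj (a k j))) / 2))"
    if d: "mono d" and a: "\<And>i j. d i \<le> j \<Longrightarrow> a i j = 0" for a :: "nat \<Rightarrow> nat \<Rightarrow> complex" and d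
  proof -
    have ext: "(\<Sum>j<d n. a n j * f j) = (\<Sum>j<d D. a n j * f j)" if "n < D" for n f
      using monoD[OF d, of n D] that a by (intro sum.mono_neutral_left) auto
    have ext2: "(\<Sum>j<d (max i k). a i j * cnj (a k j)) = (\<Sum>j<d D. a i j * cnj (a k j))" if "i < D" "k < D" for i k
    proof (intro sum.mono_neutral_left)
      have "d (max i k) \<le> d D" using that by (intro monoD[OF d]) auto
      then show "{..<d (max i k)} \<subseteq> {..<d D}" by auto
      have "d i \<le> d (max i k)" by (intro monoD[OF d]) auto
      then show "\<forall>j\<in>{..<d D} - {..<d (max i k)}. a i j * cnj (a k j) = 0"
        using a[of i] by auto
    qed auto
    have lin: "(\<Sum>i<D. c i * (\<Sum>j<d i. a i j * \<omega> j)) = (\<Sum>j<d D. (\<Sum>i<D. c i * a i j) * \<omega> j)" for \<omega>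
    proof -
      have "(\<Sum>i<D. c i * (\<Sum>j<d i. a i j * \<omega> j)) = (\<Sum>i<D. c i * (\<Sum>j<d D. a i j * \<omega> j))"
        by (intro sum.cong) (auto simp: ext)
      also have "\<dots> = (\<Sum>i<D. \<Sum>j<d D. c i * a i j * \<omega> j)"
        by (simp add: sum_distrib_left mult.assoc)
      also have "\<dots> = (\<Sum>j<d D. (\<Sum>i<D. c i * a i j) * \<omega> j)"
        by (subst sum.swap) (simp add: sum_distrib_right)
      finally show ?thesis .
    qed
    have "(LINT x|distr gseq cseq (\<lambda>\<omega> n. \<Sum>j<d n. a n j * \<omega> j). iexp (Re (\<Sum>i<D. c i * x i)))
      = (LINT \<omega>|gseq. iexp (Re (\<Sum>i<D. c i * (\<Sum>j<d i. a i j * \<omega> j))))"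
      by (rule integral_distr) measurable
    also have "\<dots> = of_real (exp (- (\<Sum>j<d D. (cmod (\<Sum>i<D. c i * a i j))\<^sup>2) / 2))"
      unfolding lin by (rule char_gseq)
    also have "(\<Sum>j<d D. (cmod (\<Sum>i<D. c i * a i j))\<^sup>2)
      = Re (\<Sum>i<D. \<Sum>k<D. c i * cnj (c k) * (\<Sum>j<d D. a i j * cnj (a k j)))"
      unfolding sum_sq_norm_combination[symmetric] by simp
    also have "(\<Sum>i<D. \<Sum>k<D. c i * cnj (c k) * (\<Sum>j<d D. a i j * cnj (a k j)))
      = (\<Sum>i<D. \<Sum>k<D. c i * cnj (c k) * (\<Sum>j<d (max i k). a i j * cnj (a k j)))"
      by (intro sum.cong refl) (simp add: ext2)
    finally show ?thesis .
  qed
  show "(LINT x|distr gseq cseq (\<lambda>\<omega> n. \<Sum>j<d n. a n j * \<omega> j). iexp (Re (\<Sum>i<D. c i * x i)))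
    = (LINT x|distr gseq cseq (\<lambda>\<omega> n. \<Sum>j<e n. b n j * \<omega> j). iexp (Re (\<Sum>i<D. c i * x i)))"
    using *[where a=a and d=d, OF d a] *[where a=b and d=e, OF e b] by (simp only: gram)
qed auto

text \<open>The coordinates below \<open>k\<close> are independent of the others, and dropping
  \<open>k\<close> coordinates preserves the law of an i.i.d. sequence.\<close>

lemma gseq_split_integral:
  fixes F G :: "(nat \<Rightarrow> complex) \<Rightarrow> real"
  assumes [measurable]: "F \<in> borel_measurable cseq" "G \<in> borel_measurable cseq"
    and Fb: "\<And>x. \<bar>F x\<bar> \<le> 1" and Gb: "\<And>x. \<bar>G x\<bar> \<le> 1"
    and dep: "\<And>x y. (\<And>j. j < k \<Longrightarrow> x j = y j) \<Longrightarrow> G x = G y"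
  shows "(LINT \<omega>|gseq. G \<omega> * F (\<lambda>j. \<omega> (j + k))) = (LINT \<omega>|gseq. G \<omega>) * (LINT \<omega>|gseq. F \<omega>)"
proof -
  define G' where "G' x = G (\<lambda>j. if j < k then x j else 0)" for x :: "nat \<Rightarrow> complex"
  define F' where "F' x = F (\<lambda>j. x (j + k))" for x :: "nat \<Rightarrow> complex"
  have "(\<lambda>x j. if j < k then x j else 0) \<in> PiM {..<k} (\<lambda>_. borel) \<rightarrow>\<^sub>M cseq"
  proof (rule measurable_cseqI)
    show "(\<lambda>x. if i < k then x i else 0) \<in> borel_measurable (PiM {..<k} (\<lambda>_. borel))" for i
      by (cases "i < k") auto
  qed
  then have [measurable]: "G' \<in> borel_measurable (PiM {..<k} (\<lambda>_. borel))"
    unfolding G'_def by measurable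
  have "(\<lambda>x j. x (j + k)) \<in> PiM {k..} (\<lambda>_. borel) \<rightarrow>\<^sub>M cseq"
    by (rule measurable_cseqI) auto
  then have [measurable]: "F' \<in> borel_measurable (PiM {k..} (\<lambda>_. borel))"
    unfolding F'_def by measurable
  have "gseq.indep_var (PiM {..<k} (\<lambda>_. borel)) (\<lambda>\<omega>. restrict (\<lambda>i. \<omega> i) {..<k})
      (PiM {k..} (\<lambda>_. borel)) (\<lambda>\<omega>. restrict (\<lambda>i. \<omega> i) {k..})"
    by (rule gseq.indep_var_restrict[OF indep_vars_gseq]) auto
  then have "gseq.indep_var borel (G' \<circ> (\<lambda>\<omega>. restrict (\<lambda>i. \<omega> i) {..<k})) borel (F' \<circ> (\<lambda>\<omega>. restrict (\<lambda>i. \<omega> i) {k..}))"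
    by (rule gseq.indep_var_compose) measurable
  moreover have "G' \<circ> (\<lambda>\<omega>. restrict (\<lambda>i. \<omega> i) {..<k}) = G"
    by (auto simp: G'_def fun_eq_iff intro!: dep)
  moreover have "F' \<circ> (\<lambda>\<omega>. restrict (\<lambda>i. \<omega> i) {k..}) = (\<lambda>\<omega>. F (\<lambda>j. \<omega> (j + k)))"
    by (auto simp: F'_def fun_eq_iff)
  ultimately have ind: "gseq.indep_var borel G borel (\<lambda>\<omega>. F (\<lambda>j. \<omega> (j + k)))" by simp
  have sh: "(\<lambda>\<omega> j. \<omega> (j + k)) \<in> gseq \<rightarrow>\<^sub>M cseq"
    by (rule measurable_cseqI) auto
  have m: "(\<lambda>\<omega>. F (\<lambda>j. \<omega> (j + k))) \<in> borel_measurable gseq"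
    by (rule measurable_compose[OF sh]) simp
  have "(LINT \<omega>|gseq. G \<omega> * F (\<lambda>j. \<omega> (j + k))) = (LINT \<omega>|gseq. G \<omega>) * (LINT \<omega>|gseq. F (\<lambda>j. \<omega> (j + k)))"
    by (rule gseq.indep_var_lebesgue_integral[OF ind])
       (auto intro!: gseq.integrable_const_bound[of _ 1] Fb Gb m)
  also have "(LINT \<omega>|gseq. F (\<lambda>j. \<omega> (j + k))) = (LINT \<omega>|distr gseq cseq (\<lambda>\<omega> j. \<omega> (j + k)). F \<omega>)"
    by (rule integral_distr[OF sh, symmetric]) simp
  also have "distr gseq cseq (\<lambda>\<omega> j. \<omega> (j + k)) = gseq"
    by (rule gseq_reindex) (auto simp: inj_def)
  finally show ?thesis .
qed

lemma gseq_integrable_component: "integrable gseq (\<lambda>\<omega>. cmod (\<omega> j))"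
  and gseq_expectation_component: "(LINT \<omega>|gseq. cmod (\<omega> j)) = (LINT z|cgauss 1. cmod z)"
proof -
  interpret C: prob_space "cgauss 1" by (rule prob_space_cgauss_1)
  have le: "cmod z \<le> 1 + cmod z ^ 4" for z
    using power_increasing[of 1 4 "cmod z"] by (cases "cmod z \<ge> 1") (auto intro: add_increasing2)
  have i: "integrable (cgauss 1) cmod"
  proof (rule Bochner_Integration.integrable_bound)
    show "integrable (cgauss 1) (\<lambda>z. 1 + cmod z ^ 4)"
      by (intro Bochner_Integration.integrable_add integrable_cgauss_4) simp
    show "AE z in cgauss 1. norm (cmod z) \<le> norm (1 + cmod z ^ 4)"
      by (intro AE_I2) (use le in \<open>simp only: real_norm_def abs_norm_cancel, smt (verit) abs_ge_self\<close>)
  qed simp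
  then have "integrable (distr gseq borel (\<lambda>\<omega>. \<omega> j)) cmod" unfolding distr_gseq_component .
  then show "integrable gseq (\<lambda>\<omega>. cmod (\<omega> j))" by (subst (asm) integrable_distr_eq) auto
  show "(LINT \<omega>|gseq. cmod (\<omega> j)) = (LINT z|cgauss 1. cmod z)"
    unfolding distr_gseq_component[of j, symmetric] by (subst integral_distr) auto
qed

subsection \<open>Approximation by Lipschitz cylinder functions\<close>

text \<open>The right-hand side sees only the first \<open>d\<close> coordinates, so the Lipschitz
  bound also forces \<open>F\<close> to depend on them alone. The constant \<open>L\<close> later
  prices the exchange of some of the Gaussians.\<close>

definition lip_cyl :: "((nat \<Rightarrow> complex) \<Rightarrow> real) \<Rightarrow> real \<Rightarrow> nat \<Rightarrow> bool" where
  "lip_cyl F L d \<longleftrightarrow> F \<in> borel_measurable cseq \<and> L \<ge> 0 \<and> (\<forall>x. 0 \<le> F x \<and> F x \<le> 1)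
     \<and> (\<forall>x y. \<bar>F x - F y\<bar> \<le> L * (\<Sum>i<d. cmod (x i - y i)))"

definition approximable :: "(nat \<Rightarrow> complex) measure \<Rightarrow> (nat \<Rightarrow> complex) set \<Rightarrow> bool" where
  "approximable \<mu> A \<longleftrightarrow> A \<in> sets cseq \<and>
     (\<forall>\<epsilon>>0. \<exists>F L d. lip_cyl F L d \<and> (LINT x|\<mu>. \<bar>indicator A x - F x\<bar>) < \<epsilon>)"

context
  fixes \<mu> :: "(nat \<Rightarrow> complex) measure"
  assumes prob: "prob_space \<mu>" and sets_\<mu>[measurable_cong]: "sets \<mu> = sets cseq"
begin

interpretation prob_space \<mu> by (rule prob)

lemma integrable_abs_diff:
  assumes "A \<in> sets cseq" "lip_cyl F L d"
  shows "integrable \<mu> (\<lambda>x. \<bar>indicator A x - F x\<bar>)"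
proof (rule integrable_const_bound[of _ 1])
  have [measurable]: "A \<in> sets cseq" "F \<in> borel_measurable cseq" using assms by (auto simp: lip_cyl_def)
  show "(\<lambda>x. \<bar>indicator A x - F x\<bar>) \<in> borel_measurable \<mu>" by measurable
  show "AE x in \<mu>. norm \<bar>indicator A x - F x\<bar> \<le> 1"
    using assms(2) by (intro AE_I2) (auto simp: lip_cyl_def indicator_def)
qed

lemma approximable_empty: "approximable \<mu> {}"
  unfolding approximable_def
proof safe
  fix \<epsilon> :: real assume "\<epsilon> > 0"
  then show "\<exists>F L d. lip_cyl F L d \<and> (LINT x|\<mu>. \<bar>indicator {} x - F x\<bar>) < \<epsilon>"
    by (intro exI[of _ "\<lambda>_. 0"] exI[of _ 0]) (auto simp: lip_cyl_def)
qed

lemma approximable_Compl: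
  assumes "approximable \<mu> A"
  shows "approximable \<mu> (- A)"
  unfolding approximable_def
proof safe
  show "- A \<in> sets cseq"
    using assms sets.compl_sets[of A cseq] by (auto simp: approximable_def space_PiM Compl_eq_Diff_UNIV)
  fix \<epsilon> :: real assume "\<epsilon> > 0"
  then obtain F L d where F: "lip_cyl F L d" "(LINT x|\<mu>. \<bar>indicator A x - F x\<bar>) < \<epsilon>"
    using assms unfolding approximable_def by blast
  have "\<bar>indicator (- A) x - (1 - F x)\<bar> = \<bar>indicator A x - F x\<bar>" for x
    by (auto simp: indicator_def)
  moreover have "lip_cyl (\<lambda>x. 1 - F x) L d" using F(1) by (auto simp: lip_cyl_def abs_minus_commute)
  ultimately show "\<exists>F L d. lip_cyl F L d \<and> (LINT x|\<mu>. \<bar>indicator (- A) x - F x\<bar>) < \<epsilon>"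
    using F(2) by (intro exI[of _ "\<lambda>x. 1 - F x"] exI[of _ L] exI[of _ d]) auto
qed

lemma lip_cyl_max:
  assumes "lip_cyl F L d" "lip_cyl G L' d'"
  shows "lip_cyl (\<lambda>x. max (F x) (G x)) (L + L') (max d d')"
  unfolding lip_cyl_def
proof (intro conjI allI)
  have [measurable]: "F \<in> borel_measurable cseq" "G \<in> borel_measurable cseq" using assms by (auto simp: lip_cyl_def)
  show "(\<lambda>x. max (F x) (G x)) \<in> borel_measurable cseq" by measurable
  show "L + L' \<ge> 0" using assms by (auto simp: lip_cyl_def)
  fix x y :: "nat \<Rightarrow> complex"
  show "0 \<le> max (F x) (G x)" "max (F x) (G x) \<le> 1" using assms by (auto simp: lip_cyl_def max_def)
  let ?S = "\<Sum>i<max d d'. cmod (x i - y i)"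
  have "\<bar>F x - F y\<bar> \<le> L * (\<Sum>i<d. cmod (x i - y i))" "\<bar>G x - G y\<bar> \<le> L' * (\<Sum>i<d'. cmod (x i - y i))"
    using assms by (auto simp: lip_cyl_def)
  moreover have "L * (\<Sum>i<d. cmod (x i - y i)) \<le> L * ?S" "L' * (\<Sum>i<d'. cmod (x i - y i)) \<le> L' * ?S"
    using assms by (auto simp: lip_cyl_def intro!: mult_left_mono sum_mono2)
  moreover have "0 \<le> L * ?S" "0 \<le> L' * ?S"
    using assms by (auto simp: lip_cyl_def intro!: mult_nonneg_nonneg sum_nonneg)
  ultimately show "\<bar>max (F x) (G x) - max (F y) (G y)\<bar> \<le> (L + L') * ?S"
    by (simp add: distrib_right) linarith
qed

lemma approximable_Un:
  assumes A: "approximable \<mu> A" and B: "approximable \<mu> B"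
  shows "approximable \<mu> (A \<union> B)"
  unfolding approximable_def
proof safe
  show AB: "A \<union> B \<in> sets cseq" using A B by (auto simp: approximable_def)
  fix \<epsilon> :: real assume "\<epsilon> > 0"
  then have "\<epsilon> / 2 > 0" by simp
  then obtain F L d G L' d' where F: "lip_cyl F L d" "(LINT x|\<mu>. \<bar>indicator A x - F x\<bar>) < \<epsilon> / 2"
    and G: "lip_cyl G L' d'" "(LINT x|\<mu>. \<bar>indicator B x - G x\<bar>) < \<epsilon> / 2"
    using A B unfolding approximable_def by blast
  have iA: "integrable \<mu> (\<lambda>x. \<bar>indicator A x - F x\<bar>)" and iB: "integrable \<mu> (\<lambda>x. \<bar>indicator B x - G x\<bar>)"
    using A B F G by (auto simp: approximable_def intro: integrable_abs_diff)
  have "(LINT x|\<mu>. \<bar>indicator (A \<union> B) x - max (F x) (G x)\<bar>)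
    \<le> (LINT x|\<mu>. \<bar>indicator A x - F x\<bar> + \<bar>indicator B x - G x\<bar>)"
  proof (rule integral_mono)
    show "integrable \<mu> (\<lambda>x. \<bar>indicator (A \<union> B) x - max (F x) (G x)\<bar>)"
      by (rule integrable_abs_diff[OF AB lip_cyl_max[OF F(1) G(1)]])
    show "\<bar>indicator (A \<union> B) x - max (F x) (G x)\<bar> \<le> \<bar>indicator A x - F x\<bar> + \<bar>indicator B x - G x\<bar>" for x
    proof -
      have "0 \<le> F x" "F x \<le> 1" "0 \<le> G x" "G x \<le> 1" using F(1) G(1) by (auto simp: lip_cyl_def)
      then show ?thesis by (cases "x \<in> A"; cases "x \<in> B"; cases "F x \<le> G x") (auto simp: max_def)
    qed
  qed (intro Bochner_Integration.integrable_add iA iB)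
  also have "\<dots> < \<epsilon>" using F(2) G(2) iA iB by simp
  finally show "\<exists>F L d. lip_cyl F L d \<and> (LINT x|\<mu>. \<bar>indicator (A \<union> B) x - F x\<bar>) < \<epsilon>"
    using lip_cyl_max[OF F(1) G(1)] by blast
qed

text \<open>Continuity from below costs \<epsilon>/2 for passing to a finite union, whose
  approximation costs another \<epsilon>/2.\<close>

lemma approximable_UN:
  fixes A :: "nat \<Rightarrow> (nat \<Rightarrow> complex) set"
  assumes A: "\<And>i. approximable \<mu> (A i)"
  shows "approximable \<mu> (\<Union>i. A i)"
  unfolding approximable_def
proof safe
  have fin: "approximable \<mu> (\<Union>i<M. A i)" for M
    by (induction M) (auto simp: lessThan_Suc approximable_empty intro: approximable_Un A)
  have [measurable]: "A i \<in> sets cseq" for i using A by (auto simp: approximable_def)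
  show U: "(\<Union>i. A i) \<in> sets cseq" by measurable
  fix \<epsilon> :: real assume e: "\<epsilon> > 0"
  have "(\<lambda>M. measure \<mu> (\<Union>i<M. A i)) \<longlonglongrightarrow> measure \<mu> (\<Union>M. \<Union>i<M. A i)"
    by (rule finite_Lim_measure_incseq) (auto simp: sets_\<mu> incseq_def intro: less_le_trans)
  also have "(\<Union>M. \<Union>i<M. A i) = (\<Union>i. A i)" by (auto intro: lessI)
  finally have lim: "(\<lambda>M. measure \<mu> (\<Union>i<M. A i)) \<longlonglongrightarrow> measure \<mu> (\<Union>i. A i)" .
  have "eventually (\<lambda>M. \<bar>measure \<mu> (\<Union>i<M. A i) - measure \<mu> (\<Union>i. A i)\<bar> < \<epsilon> / 2) sequentially"
    using tendstoD[OF lim, of "\<epsilon> / 2"] e unfolding dist_real_def by simp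
  then obtain M where M: "\<bar>measure \<mu> (\<Union>i<M. A i) - measure \<mu> (\<Union>i. A i)\<bar> < \<epsilon> / 2"
    by (auto simp: eventually_sequentially)
  define B where "B = (\<Union>i<M. A i)"
  have [measurable]: "B \<in> sets cseq" by (auto simp: B_def)
  obtain F L d where F: "lip_cyl F L d" "(LINT x|\<mu>. \<bar>indicator B x - F x\<bar>) < \<epsilon> / 2"
    using fin[of M] e unfolding approximable_def B_def[symmetric] by (meson half_gt_zero)
  have iB: "integrable \<mu> (\<lambda>x. \<bar>indicator B x - F x\<bar>)" by (rule integrable_abs_diff[OF _ F(1)]) simp
  have i1: "integrable \<mu> (\<lambda>x. indicator (\<Union>i. A i) x - indicator B x :: real)"
    by (intro Bochner_Integration.integrable_diff integrable_real_indicator)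
       (auto simp: sets_\<mu> emeasure_eq_measure)
  have "(LINT x|\<mu>. \<bar>indicator (\<Union>i. A i) x - F x\<bar>)
    \<le> (LINT x|\<mu>. (indicator (\<Union>i. A i) x - indicator B x) + \<bar>indicator B x - F x\<bar>)"
  proof (rule integral_mono)
    show "integrable \<mu> (\<lambda>x. \<bar>indicator (\<Union>i. A i) x - F x\<bar>)"
      by (rule integrable_abs_diff[OF U F(1)])
    have "B \<subseteq> (\<Union>i. A i)" by (auto simp: B_def)
    then show "\<bar>indicator (\<Union>i. A i) x - F x\<bar> \<le> (indicator (\<Union>i. A i) x - indicator B x) + \<bar>indicator B x - F x\<bar>" for x
      by (auto simp: indicator_def)
  qed (intro Bochner_Integration.integrable_add i1 iB)
  also have "\<dots> = (LINT x|\<mu>. indicator (\<Union>i. A i) x - indicator B x) + (LINT x|\<mu>. \<bar>indicator B x - F x\<bar>)"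
    by (rule Bochner_Integration.integral_add[OF i1 iB])
  also have "(LINT x|\<mu>. indicator (\<Union>i. A i) x - indicator B x) = measure \<mu> (\<Union>i. A i) - measure \<mu> B"
    by (subst Bochner_Integration.integral_diff)
       (auto simp: sets_\<mu> emeasure_eq_measure intro!: integrable_real_indicator)
  finally have "(LINT x|\<mu>. \<bar>indicator (\<Union>i. A i) x - F x\<bar>) < \<epsilon>"
    using F(2) M unfolding B_def[symmetric] by linarith
  then show "\<exists>F L d. lip_cyl F L d \<and> (LINT x|\<mu>. \<bar>indicator (\<Union>i. A i) x - F x\<bar>) < \<epsilon>"
    using F(1) by blast
qed

text \<open>The functions min 1 (k * distance to the complement) are k-Lipschitz and converge
  pointwise to the indicator of the open set.\<close>

lemma approximable_open:
  assumes "open U"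
  shows "approximable \<mu> {x. x i \<in> U}"
\<comment> \<open>\<open>infdist\<close> to the empty set is 0, so for \<open>U = UNIV\<close> the
  approximating functions would all vanish.\<close>
proof (cases "U = UNIV")
  case True
  then show ?thesis using approximable_Compl[OF approximable_empty] by simp
next
  case False
  have [measurable]: "U \<in> sets borel" using assms by simp
  have mA[measurable]: "{x. x i \<in> U} \<in> sets cseq"
    using measurable_sets[of "\<lambda>x. x i" cseq borel U] by (simp add: space_PiM vimage_def)
  define F where "F k x = min 1 (real k * infdist (x i) (- U))" for k and x :: "nat \<Rightarrow> complex"
  have "(\<lambda>z. infdist z (- U)) \<in> borel_measurable borel"
    by (rule borel_measurable_continuous_onI) (intro continuous_intros)
  then have [measurable]: "(\<lambda>x. infdist (x i) (- U)) \<in> borel_measurable cseq"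
    by (rule measurable_compose[rotated]) simp
  have [measurable]: "F k \<in> borel_measurable cseq" for k unfolding F_def by measurable
  have lip: "lip_cyl (F k) (real k) (Suc i)" for k
    unfolding lip_cyl_def
  proof (intro conjI allI)
    fix x y :: "nat \<Rightarrow> complex"
    show "0 \<le> F k x" "F k x \<le> 1" by (auto simp: F_def infdist_nonneg)
    have "\<bar>F k x - F k y\<bar> \<le> \<bar>real k * infdist (x i) (- U) - real k * infdist (y i) (- U)\<bar>"
      unfolding F_def by linarith
    also have "\<dots> = real k * \<bar>infdist (x i) (- U) - infdist (y i) (- U)\<bar>"
      by (simp add: abs_mult flip: right_diff_distrib)
    also have "\<dots> \<le> real k * cmod (x i - y i)"
      by (intro mult_left_mono) (auto simp: infdist_triangle_abs simp flip: dist_norm)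
    also have "\<dots> \<le> real k * (\<Sum>i<Suc i. cmod (x i - y i))"
      by (intro mult_left_mono) (auto intro!: sum_nonneg)
    finally show "\<bar>F k x - F k y\<bar> \<le> real k * (\<Sum>i<Suc i. cmod (x i - y i))" .
  qed auto
  have lim: "(\<lambda>k. F k x) \<longlonglongrightarrow> indicator {x. x i \<in> U} x" for x
  proof (cases "x i \<in> U")
    case True
    have "infdist (x i) (- U) > 0"
      using True assms False by (intro infdist_pos_not_in_closed) auto
    then obtain K where K: "real K * infdist (x i) (- U) > 1"
      using reals_Archimedean3[of "infdist (x i) (- U)"] by blast
    have "F k x = 1" if "k \<ge> K" for k
    proof -
      have "real K * infdist (x i) (- U) \<le> real k * infdist (x i) (- U)"
        using that by (intro mult_right_mono infdist_nonneg) auto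
      then show ?thesis using K by (simp add: F_def)
    qed
    then have "eventually (\<lambda>k. F k x = indicator {x. x i \<in> U} x) sequentially"
      using True by (auto simp: eventually_sequentially)
    then show ?thesis by (rule tendsto_eventually)
  next
    case False
    then show ?thesis by (simp add: F_def)
  qed
  have "(\<lambda>k. LINT x|\<mu>. \<bar>indicator {x. x i \<in> U} x - F k x\<bar>) \<longlonglongrightarrow> (LINT x|\<mu>. 0)"
  proof (rule integral_dominated_convergence[where w="\<lambda>_. 1"])
    show "AE x in \<mu>. (\<lambda>k. \<bar>indicator {x. x i \<in> U} x - F k x\<bar>) \<longlonglongrightarrow> 0"
    proof (rule AE_I2)
      fix x
      have "(\<lambda>k. \<bar>indicator {x. x i \<in> U} x - F k x\<bar>) \<longlonglongrightarrow> \<bar>indicator {x. x i \<in> U} x - indicator {x. x i \<in> U} x\<bar>"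
        by (intro tendsto_intros lim)
      then show "(\<lambda>k. \<bar>indicator {x. x i \<in> U} x - F k x\<bar>) \<longlonglongrightarrow> 0" by simp
    qed
    show "AE x in \<mu>. norm \<bar>indicator {x. x i \<in> U} x - F k x\<bar> \<le> 1" for k
      using lip[of k] by (intro AE_I2) (auto simp: lip_cyl_def indicator_def)
  qed auto
  then have lim0: "(\<lambda>k. LINT x|\<mu>. \<bar>indicator {x. x i \<in> U} x - F k x\<bar>) \<longlonglongrightarrow> 0" by simp
  show ?thesis unfolding approximable_def
  proof safe
    fix \<epsilon> :: real assume "\<epsilon> > 0"
    from order_tendstoD(2)[OF lim0 this]
    obtain k where "(LINT x|\<mu>. \<bar>indicator {x. x i \<in> U} x - F k x\<bar>) < \<epsilon>"
      by (auto simp: eventually_sequentially)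
    then show "\<exists>F L d. lip_cyl F L d \<and> (LINT x|\<mu>. \<bar>indicator {x. x i \<in> U} x - F x\<bar>) < \<epsilon>"
      using lip by blast
  qed (rule mA)
qed

text \<open>Two inductions over generated \<sigma>-algebras: from open sets to Borel conditions on
  one coordinate, and from these to the product \<sigma>-algebra.\<close>

lemma approximable_sets:
  assumes "A \<in> sets cseq"
  shows "approximable \<mu> A"
proof -
  have *: "approximable \<mu> {x. x i \<in> B}" if "B \<in> sets borel" for i and B :: "complex set"
  proof -
    have "B \<in> sigma_sets UNIV (Collect open)" using that by (simp add: borel_def)
    then show ?thesis
    proof (induction rule: sigma_sets.induct)
      case (Basic a)
      then show ?case by (auto intro: approximable_open)
    next
      case Empty
      show ?case by (simp add: approximable_empty)
    next
      case (Compl a)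
      have "{x. x i \<in> UNIV - a} = - {x. x i \<in> a}" by auto
      then show ?case using Compl approximable_Compl by simp
    next
      case (Union a)
      have "{x. x i \<in> \<Union> (range a)} = (\<Union>n. {x. x i \<in> a n})" by auto
      then show ?case using Union approximable_UN by simp
    qed
  qed
  have "A \<in> sigma_sets UNIV {{f. f i \<in> A} |i A. A \<in> sets borel}"
    using assms unfolding sets_PiM_single by (simp add: PiE_UNIV_domain)
  then show ?thesis
  proof (induction rule: sigma_sets.induct)
    case (Basic a)
    then show ?case by (auto intro: *)
  next
    case Empty
    show ?case by (rule approximable_empty)
  next
    case (Compl a)
    then show ?case using approximable_Compl by (simp add: Compl_eq_Diff_UNIV[symmetric])
  next
    case (Union a)
    then show ?case using approximable_UN by simp
  qed
qed

end

subsection \<open>Weak mixing of the Gaussian shift\<close>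

definition cesaro_null :: "(nat \<Rightarrow> real) \<Rightarrow> bool" where
  "cesaro_null u \<longleftrightarrow> (\<lambda>N. (\<Sum>n<N. u n) / real N) \<longlonglongrightarrow> 0"

lemma cesaro_null_add: "cesaro_null u \<Longrightarrow> cesaro_null v \<Longrightarrow> cesaro_null (\<lambda>n. u n + v n)"
  unfolding cesaro_null_def sum.distrib add_divide_distrib using tendsto_add by force

lemma cesaro_null_0: "cesaro_null (\<lambda>n. 0)"
  by (simp add: cesaro_null_def)

lemma cesaro_null_sum: "(\<And>i. i \<in> I \<Longrightarrow> cesaro_null (u i)) \<Longrightarrow> cesaro_null (\<lambda>n. \<Sum>i\<in>I. u i n)"
  by (induction I rule: infinite_finite_induct) (auto intro: cesaro_null_add cesaro_null_0)

lemma cesaro_null_cmult: "cesaro_null u \<Longrightarrow> cesaro_null (\<lambda>n. c * u n)"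
  unfolding cesaro_null_def sum_distrib_left[symmetric] times_divide_eq_right[symmetric]
  using tendsto_mult_right_zero by force

lemma cesaro_null_shift:
  assumes "cesaro_null u" "\<And>n. 0 \<le> u n" "\<And>n. u n \<le> K"
  shows "cesaro_null (\<lambda>n. u (n + i))"
proof -
  have le: "(\<Sum>n<N. u (n + i)) / real N \<le> (\<Sum>n<N. u n) / real N + (real i * K) / real N" for N
  proof -
    have "(\<Sum>n<N. u (n + i)) = (\<Sum>n\<in>{i..<N+i}. u n)"
      using sum.shift_bounds_nat_ivl[of u 0 i N] by (simp add: atLeast0LessThan)
    also have "\<dots> \<le> (\<Sum>n\<in>{0..<N+i}. u n)" by (intro sum_mono2) (auto simp: assms)
    also have "\<dots> = (\<Sum>n\<in>{0..<N}. u n) + (\<Sum>n\<in>{N..<N+i}. u n)"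
      by (simp add: sum.atLeastLessThan_concat)
    also have "(\<Sum>n\<in>{N..<N+i}. u n) \<le> real (card {N..<N+i}) * K"
      by (intro sum_bounded_above) (auto simp: assms)
    finally have "(\<Sum>n<N. u (n + i)) \<le> (\<Sum>n<N. u n) + real i * K" by (simp add: atLeast0LessThan)
    then show ?thesis by (simp add: divide_right_mono flip: add_divide_distrib)
  qed
  have "(\<lambda>N. (\<Sum>n<N. u n) / real N + (real i * K) / real N) \<longlonglongrightarrow> 0 + 0"
    using assms(1) unfolding cesaro_null_def by (intro tendsto_add lim_const_over_n)
  then have "(\<lambda>N. (\<Sum>n<N. u n) / real N + (real i * K) / real N) \<longlonglongrightarrow> 0" by simp
  then show ?thesis unfolding cesaro_null_def
    by (rule tendsto_sandwich[OF _ _ tendsto_const, rotated 2])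
       (auto intro!: always_eventually le divide_nonneg_nonneg sum_nonneg assms)
qed

lemma cesaro_null_approx:
  assumes "\<And>\<epsilon>. \<epsilon> > 0 \<Longrightarrow> \<exists>u. cesaro_null u \<and> (\<forall>n. v n \<le> u n + \<epsilon>)" and v: "\<And>n. 0 \<le> v n"
  shows "cesaro_null v"
  unfolding cesaro_null_def
proof (rule LIMSEQ_I)
  fix r :: real assume "r > 0"
  then obtain u where u: "cesaro_null u" "\<And>n. v n \<le> u n + r / 2" using assms(1)[of "r / 2"] by auto
  obtain N0 where N0: "\<And>N. N \<ge> N0 \<Longrightarrow> \<bar>(\<Sum>n<N. u n) / real N\<bar> < r / 2"
    using LIMSEQ_D[OF u(1)[unfolded cesaro_null_def], of "r / 2"] \<open>r > 0\<close>
    unfolding diff_0_right real_norm_def by auto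
  show "\<exists>N0. \<forall>N\<ge>N0. norm ((\<Sum>n<N. v n) / real N - 0) < r"
  proof (intro exI[of _ "max N0 1"] allI impI)
    fix N assume N: "N \<ge> max N0 1"
    have "(\<Sum>n<N. v n) \<le> (\<Sum>n<N. u n + r / 2)" by (intro sum_mono u)
    then have "(\<Sum>n<N. v n) / real N \<le> ((\<Sum>n<N. u n) + real N * (r / 2)) / real N"
      by (intro divide_right_mono) (auto simp: sum.distrib)
    also have "\<dots> = (\<Sum>n<N. u n) / real N + r / 2" using N by (simp add: add_divide_distrib)
    also have "\<dots> < r" using abs_ge_self[of "(\<Sum>n<N. u n) / real N"] N0[of N] N by linarith
    finally show "norm ((\<Sum>n<N. v n) / real N - 0) < r"
      using v by (simp add: sum_nonneg)
  qed
qed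

lemma lip_cyl_cong:
  assumes "lip_cyl F L d" "\<And>i. i < d \<Longrightarrow> x i = y i"
  shows "F x = F y"
proof -
  have "\<bar>F x - F y\<bar> \<le> L * (\<Sum>i<d. cmod (x i - y i))" using assms(1) by (auto simp: lip_cyl_def)
  also have "(\<Sum>i<d. cmod (x i - y i)) = 0" using assms(2) by simp
  finally show ?thesis by simp
qed

text \<open>Abstract data of the process: row \<open>n\<close> of \<open>a\<close> holds the
  coefficients of \<lambda>^n in an orthonormal basis, and \<open>b\<close> is the matrix of
  multiplication by \<lambda>. \<open>stationary\<close> is shift invariance of the Gram matrix,
  \<open>cesaro\<close> is the source of weak mixing, \<open>hessenberg\<close> and
  \<open>b_le\<close> make the Banach space invariant under the shift, and \<open>diag\<close> gives
  it infinite dimension.\<close>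

locale gaussian_shift =
  fixes a b :: "nat \<Rightarrow> nat \<Rightarrow> complex"
  assumes tri: "\<And>n j. n < j \<Longrightarrow> a n j = 0"
    and stationary: "\<And>n m. (\<Sum>j<Suc (Suc (max n m)). a (Suc n) j * cnj (a (Suc m) j)) = (\<Sum>j<Suc (max n m). a n j * cnj (a m j))"
    and unit: "\<And>n. (\<Sum>j<Suc n. (cmod (a n j))\<^sup>2) = 1"
    and diag: "\<And>n. a n n \<noteq> 0"
    and cesaro: "\<And>j. cesaro_null (\<lambda>n. cmod (a n j))"
    and hessenberg: "\<And>n j. a (Suc n) j = (\<Sum>i<Suc n. a n i * b i j)"
    and b_le: "\<And>i j. cmod (b i j) \<le> 1"
begin

lemma a_le: "cmod (a n j) \<le> 1"
proof (cases "j \<le> n")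
  case True
  have "(cmod (a n j))\<^sup>2 \<le> (\<Sum>j<Suc n. (cmod (a n j))\<^sup>2)"
    by (rule member_le_sum) (use True in auto)
  then show ?thesis unfolding unit by (simp add: power_le_one_iff abs_square_le_1)
qed (simp add: tri)

section \<open>The stationary process and the decoupling of distant times\<close>

definition X :: "(nat \<Rightarrow> complex) \<Rightarrow> nat \<Rightarrow> complex" where
  "X \<omega> n = (\<Sum>j<Suc n. a n j * \<omega> j)"

definition \<mu> :: "(nat \<Rightarrow> complex) measure" where
  "\<mu> = distr gseq cseq X"

lemma X_extend: "n < d \<Longrightarrow> X \<omega> n = (\<Sum>j<d. a n j * \<omega> j)"
  unfolding X_def by (rule sum.mono_neutral_left) (auto simp: tri)

lemma measurable_X: "X \<in> gseq \<rightarrow>\<^sub>M cseq"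
  unfolding X_def[abs_def] by (rule measurable_cseqI) simp

lemma measurable_X_coord[measurable]: "(\<lambda>\<omega>. X \<omega> n) \<in> borel_measurable gseq"
  unfolding X_def by measurable

lemma prob_\<mu>: "prob_space \<mu>"
  unfolding \<mu>_def by (rule gseq.prob_space_distr[OF measurable_X])

lemma sets_\<mu>[simp, measurable_cong]: "sets \<mu> = sets cseq"
  by (simp add: \<mu>_def)

lemma space_\<mu>[simp]: "space \<mu> = UNIV"
  by (simp add: \<mu>_def space_PiM)

lemma measurable_shift: "(\<lambda>x i. x (i + n)) \<in> cseq \<rightarrow>\<^sub>M cseq"
  by (rule measurable_cseqI) simp

lemma \<mu>_shift_Suc: "distr \<mu> cseq (\<lambda>x i. x (Suc i)) = \<mu>"
proof -
  have sh: "(\<lambda>x i. x (Suc i)) \<in> cseq \<rightarrow>\<^sub>M cseq" using measurable_shift[of 1] by simp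
  have "distr \<mu> cseq (\<lambda>x i. x (Suc i)) = distr gseq cseq (\<lambda>\<omega> n. X \<omega> (Suc n))"
    unfolding \<mu>_def by (subst distr_distr[OF sh measurable_X]) (simp add: comp_def)
  also have "\<dots> = distr gseq cseq (\<lambda>\<omega> n. \<Sum>j<Suc (Suc n). a (Suc n) j * \<omega> j)"
    unfolding X_def ..
  also have "\<dots> = distr gseq cseq (\<lambda>\<omega> n. \<Sum>j<Suc n. a n j * \<omega> j)"
    by (rule gseq_linear_law_eq) (auto simp: mono_def tri stationary simp del: sum.lessThan_Suc)
  finally show ?thesis unfolding \<mu>_def X_def[abs_def] .
qed

lemma \<mu>_shift: "distr \<mu> cseq (\<lambda>x i. x (i + n)) = \<mu>"
proof (induction n)
  case 0
  have "distr \<mu> cseq (\<lambda>x. x) = distr \<mu> \<mu> (\<lambda>x. x)" by (rule distr_cong) auto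
  then show ?case by simp
next
  case (Suc n)
  have sh: "(\<lambda>x i. x (Suc i)) \<in> cseq \<rightarrow>\<^sub>M cseq" using measurable_shift[of 1] by simp
  have "distr \<mu> cseq (\<lambda>x i. x (i + Suc n)) = distr (distr \<mu> cseq (\<lambda>x i. x (i + n))) cseq (\<lambda>x i. x (Suc i))"
    by (subst distr_distr[OF sh]) (auto simp: comp_def measurable_cong_sets[OF sets_\<mu> refl] measurable_shift)
  then show ?case unfolding Suc.IH \<mu>_shift_Suc .
qed

text \<open>Only the Gaussians with index below \<open>k\<close> tie \<open>G\<close> to the process
  from time \<open>n\<close> on, and they enter with the coefficients \<open>a (n + i) j\<close>.
  Exchanging them for fresh copies makes the second factor independent of \<open>G\<close>; the
  Lipschitz bound controls the cost by the sum of these coefficients.\<close>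

lemma coupling:
  assumes G[measurable]: "G \<in> borel_measurable cseq" and Gb: "\<And>x. \<bar>G x\<bar> \<le> 1"
    and dep: "\<And>x y. (\<And>j. j < k \<Longrightarrow> x j = y j) \<Longrightarrow> G x = G y"
    and F: "lip_cyl F L d"
  shows "\<bar>(LINT \<omega>|gseq. G \<omega> * F (\<lambda>i. X \<omega> (i + n))) - (LINT \<omega>|gseq. G \<omega>) * (LINT x|\<mu>. F x)\<bar>
    \<le> L * (2 * (LINT z|cgauss 1. cmod z)) * (\<Sum>i<d. \<Sum>j<k. cmod (a (n + i) j))"
proof -
  have Fm[measurable]: "F \<in> borel_measurable cseq" and L: "L \<ge> 0" and F01: "\<And>x. 0 \<le> F x" "\<And>x. F x \<le> 1"
    and Flip: "\<And>x y. \<bar>F x - F y\<bar> \<le> L * (\<Sum>i<d. cmod (x i - y i))" using F by (auto simp: lip_cyl_def)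
  have FB: "\<bar>F x\<bar> \<le> 1" for x using F01[of x] by auto
  \<comment> \<open>Indices below \<open>k\<close> stay and all others move up by \<open>k\<close>,
    which frees the block from k to 2k - 1. Reading the noise through \<open>f\<close> or through
    \<open>j + k\<close> then differs only for j < k, where an old variable faces its replacement
    from the free block.\<close>
  define f where "f j = (if j < k then j else j + k)" for j :: nat
  define e where "e = (LINT z|cgauss 1. cmod z)"
  have mX: "(\<lambda>\<omega> i. X \<omega> (i + n)) \<in> cseq \<rightarrow>\<^sub>M cseq"
    by (rule measurable_cseqI) (simp add: X_def)
  have mF: "(\<lambda>\<omega>. F (\<lambda>i. X \<omega> (i + n))) \<in> borel_measurable cseq"
    by (rule measurable_compose[OF mX Fm])
  have mre: "(\<lambda>\<omega> i. \<omega> (g i)) \<in> cseq \<rightarrow>\<^sub>M cseq" for g :: "nat \<Rightarrow> nat"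
    by (rule measurable_cseqI) simp
  have mreg: "(\<lambda>\<omega> i. \<omega> (g i)) \<in> gseq \<rightarrow>\<^sub>M cseq" for g :: "nat \<Rightarrow> nat"
    by (rule measurable_cseqI) simp
  have F1: "(LINT \<omega>|gseq. G \<omega> * F (\<lambda>i. X \<omega> (i + n))) = (LINT \<omega>|gseq. G \<omega> * F (\<lambda>i. X (\<lambda>j. \<omega> (f j)) (i + n)))"
  proof -
    have inj: "inj f" by (auto simp: inj_def f_def split: if_splits)
    have "(LINT \<omega>|gseq. G \<omega> * F (\<lambda>i. X \<omega> (i + n))) = (LINT \<omega>|distr gseq cseq (\<lambda>\<omega> j. \<omega> (f j)). G \<omega> * F (\<lambda>i. X \<omega> (i + n)))"
      by (simp add: gseq_reindex[OF inj])
    also have "\<dots> = (LINT \<omega>|gseq. G (\<lambda>j. \<omega> (f j)) * F (\<lambda>i. X (\<lambda>j. \<omega> (f j)) (i + n)))"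
      by (rule integral_distr[OF mreg borel_measurable_times[OF G mF]])
    moreover have "G (\<lambda>j. \<omega> (f j)) = G \<omega>" for \<omega> by (rule dep) (auto simp: f_def)
    ultimately show ?thesis by simp
  qed
  have F2: "(LINT \<omega>|gseq. G \<omega> * F (\<lambda>i. X (\<lambda>j. \<omega> (j + k)) (i + n))) = (LINT \<omega>|gseq. G \<omega>) * (LINT x|\<mu>. F x)"
  proof -
    have "(LINT \<omega>|gseq. G \<omega> * F (\<lambda>i. X (\<lambda>j. \<omega> (j + k)) (i + n)))
      = (LINT \<omega>|gseq. G \<omega>) * (LINT \<omega>|gseq. F (\<lambda>i. X \<omega> (i + n)))"
      by (rule gseq_split_integral[OF mF G FB Gb]) (rule dep)
    also have "(LINT \<omega>|gseq. F (\<lambda>i. X \<omega> (i + n))) = (LINT x|\<mu>. F (\<lambda>i. x (i + n)))"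
      unfolding \<mu>_def
      by (rule integral_distr[OF measurable_X, symmetric]) (rule measurable_compose[OF measurable_shift Fm])
    also have "\<dots> = (LINT x|distr \<mu> cseq (\<lambda>x i. x (i + n)). F x)"
      by (rule integral_distr[symmetric]) (auto simp: measurable_cong_sets[OF sets_\<mu> refl] measurable_shift)
    finally show ?thesis unfolding \<mu>_shift .
  qed
  have diff: "cmod (X (\<lambda>j. \<omega> (f j)) m - X (\<lambda>j. \<omega> (j + k)) m) \<le> (\<Sum>j<k. cmod (a m j) * (cmod (\<omega> j) + cmod (\<omega> (j + k))))" for \<omega> m
  proof -
    have "X (\<lambda>j. \<omega> (f j)) m - X (\<lambda>j. \<omega> (j + k)) m = (\<Sum>j<max k (Suc m). a m j * (\<omega> (f j) - \<omega> (j + k)))"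
      by (subst (1 2) X_extend[of m "max k (Suc m)"]) (auto simp: algebra_simps sum_subtractf)
    also have "\<dots> = (\<Sum>j<k. a m j * (\<omega> (f j) - \<omega> (j + k)))"
      by (rule sum.mono_neutral_right) (auto simp: f_def)
    also have "cmod \<dots> \<le> (\<Sum>j<k. cmod (a m j * (\<omega> (f j) - \<omega> (j + k))))" by (rule norm_sum)
    also have "\<dots> \<le> (\<Sum>j<k. cmod (a m j) * (cmod (\<omega> j) + cmod (\<omega> (j + k))))"
      by (intro sum_mono) (auto simp: norm_mult f_def intro!: mult_left_mono norm_triangle_ineq4)
    finally show ?thesis .
  qed
  let ?Z = "\<lambda>\<omega>. L * (\<Sum>i<d. \<Sum>j<k. cmod (a (n + i) j) * (cmod (\<omega> j) + cmod (\<omega> (j + k))))"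
  have Gg: "G \<in> borel_measurable gseq" by simp
  have mFf: "(\<lambda>\<omega>. F (\<lambda>i. X (\<lambda>j. \<omega> (g j)) (i + n))) \<in> borel_measurable gseq" for g
    by (rule measurable_compose[OF mreg mF])
  have int: "integrable gseq (\<lambda>\<omega>. G \<omega> * F (\<lambda>i. X (\<lambda>j. \<omega> (g j)) (i + n)))" for g
    by (rule gseq.integrable_const_bound[where B=1, OF _ borel_measurable_times[OF Gg mFf]])
       (simp add: abs_mult mult_le_one Gb FB)
  have iZ: "integrable gseq ?Z"
    by (intro integrable_mult_right Bochner_Integration.integrable_sum Bochner_Integration.integrable_add gseq_integrable_component)
  have "\<bar>(LINT \<omega>|gseq. G \<omega> * F (\<lambda>i. X (\<lambda>j. \<omega> (f j)) (i + n))) - (LINT \<omega>|gseq. G \<omega> * F (\<lambda>i. X (\<lambda>j. \<omega> (j + k)) (i + n)))\<bar>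
    = \<bar>LINT \<omega>|gseq. G \<omega> * F (\<lambda>i. X (\<lambda>j. \<omega> (f j)) (i + n)) - G \<omega> * F (\<lambda>i. X (\<lambda>j. \<omega> (j + k)) (i + n))\<bar>"
    using int by simp
  also have "\<dots> \<le> (LINT \<omega>|gseq. \<bar>G \<omega> * F (\<lambda>i. X (\<lambda>j. \<omega> (f j)) (i + n)) - G \<omega> * F (\<lambda>i. X (\<lambda>j. \<omega> (j + k)) (i + n))\<bar>)"
    by (rule integral_abs_bound)
  also have "\<dots> \<le> (LINT \<omega>|gseq. ?Z \<omega>)"
  proof (rule integral_mono[OF _ iZ])
    show "integrable gseq (\<lambda>\<omega>. \<bar>G \<omega> * F (\<lambda>i. X (\<lambda>j. \<omega> (f j)) (i + n)) - G \<omega> * F (\<lambda>i. X (\<lambda>j. \<omega> (j + k)) (i + n))\<bar>)"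
      by (intro integrable_abs Bochner_Integration.integrable_diff int)
    fix \<omega>
    let ?x = "\<lambda>i. X (\<lambda>j. \<omega> (f j)) (i + n)" and ?y = "\<lambda>i. X (\<lambda>j. \<omega> (j + k)) (i + n)"
    have "\<bar>G \<omega> * F ?x - G \<omega> * F ?y\<bar> = \<bar>G \<omega>\<bar> * \<bar>F ?x - F ?y\<bar>" by (simp add: abs_mult flip: right_diff_distrib)
    also have "\<dots> \<le> 1 * \<bar>F ?x - F ?y\<bar>" by (intro mult_right_mono Gb) auto
    also have "\<dots> \<le> L * (\<Sum>i<d. cmod (?x i - ?y i))" using Flip[of ?x ?y] by simp
    also have "\<dots> \<le> ?Z \<omega>"
      by (intro mult_left_mono sum_mono L) (use diff[where m="i + n" for i] in \<open>simp add: add.commute\<close>)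
    finally show "\<bar>G \<omega> * F ?x - G \<omega> * F ?y\<bar> \<le> ?Z \<omega>" .
  qed
  also have "\<dots> = L * (\<Sum>i<d. \<Sum>j<k. cmod (a (n + i) j) * (e + e))"
    by (simp add: Bochner_Integration.integral_sum gseq_integrable_component gseq_expectation_component
       Bochner_Integration.integrable_sum e_def)
  also have "\<dots> = L * (2 * e) * (\<Sum>i<d. \<Sum>j<k. cmod (a (n + i) j))"
    by (simp add: sum_distrib_left sum_distrib_right mult_ac)
  finally show ?thesis unfolding F1 F2 e_def .
qed

text \<open>Replacing both sets by Lipschitz cylinder functions costs \<epsilon> in total, half in
  the joint term and half in the product. What remains is the bound of \<open>coupling\<close>, a
  finite sum of Cesaro-null sequences.\<close>

lemma weak_mixing:
  assumes A[measurable]: "A \<in> sets cseq" and B[measurable]: "B \<in> sets cseq"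
  shows "cesaro_null (\<lambda>n. \<bar>measure \<mu> {x. (\<lambda>i. x (i + n)) \<in> A \<and> x \<in> B} - measure \<mu> A * measure \<mu> B\<bar>)"
proof (rule cesaro_null_approx)
  fix \<epsilon> :: real assume e: "\<epsilon> > 0"
  interpret \<mu>: prob_space \<mu> by (rule prob_\<mu>)
  have e4: "\<epsilon> / 4 > 0" using e by simp
  obtain F L d where F: "lip_cyl F L d" and FA: "(LINT x|\<mu>. \<bar>indicator A x - F x\<bar>) < \<epsilon> / 4"
    using approximable_sets[OF prob_\<mu> sets_\<mu> A] e4 unfolding approximable_def by blast
  obtain H L' k where H: "lip_cyl H L' k" and HB: "(LINT x|\<mu>. \<bar>indicator B x - H x\<bar>) < \<epsilon> / 4"
    using approximable_sets[OF prob_\<mu> sets_\<mu> B] e4 unfolding approximable_def by blast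
  have [measurable]: "F \<in> borel_measurable cseq" "H \<in> borel_measurable cseq" using F H by (auto simp: lip_cyl_def)
  have F01: "0 \<le> F x" "F x \<le> 1" and H01: "0 \<le> H x" "H x \<le> 1" for x using F H by (auto simp: lip_cyl_def)
  have FB: "\<bar>F x\<bar> \<le> 1" and HBd: "\<bar>H x\<bar> \<le> 1" for x using F01[of x] H01[of x] by auto
  let ?s = "\<lambda>n (x :: nat \<Rightarrow> complex) i. x (i + n)"
  have ms: "?s n \<in> \<mu> \<rightarrow>\<^sub>M cseq" for n using measurable_shift by (simp add: measurable_cong_sets[OF sets_\<mu> refl])
  have mFs: "(\<lambda>x. F (?s n x)) \<in> borel_measurable \<mu>" for n by (rule measurable_compose[OF ms]) simp
  have mAs: "(\<lambda>x. indicator A (?s n x) :: real) \<in> borel_measurable \<mu>" for n by (rule measurable_compose[OF ms]) simp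
  have iA: "integrable \<mu> (\<lambda>x. \<bar>indicator A x - F x\<bar>)" by (rule integrable_abs_diff[OF prob_\<mu> sets_\<mu> A F])
  have iB: "integrable \<mu> (\<lambda>x. \<bar>indicator B x - H x\<bar>)" by (rule integrable_abs_diff[OF prob_\<mu> sets_\<mu> B H])
  have shift_int: "(LINT x|\<mu>. g (?s n x)) = (LINT x|\<mu>. g x)" if "g \<in> borel_measurable cseq" for g :: "_ \<Rightarrow> real" and n
  proof -
    have "(LINT x|distr \<mu> cseq (?s n). g x) = (LINT x|\<mu>. g (?s n x))" by (rule integral_distr[OF ms that])
    then show ?thesis by (simp add: \<mu>_shift)
  qed
  have iAs: "integrable \<mu> (\<lambda>x. \<bar>indicator A (?s n x) - F (?s n x)\<bar>)" for n
    using F01 by (intro \<mu>.integrable_const_bound[of _ 1] borel_measurable_abs borel_measurable_diff mFs mAs AE_I2)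
       (auto simp: indicator_def)
  have meas: "measure \<mu> {x. ?s n x \<in> A \<and> x \<in> B} = (LINT x|\<mu>. indicator A (?s n x) * indicator B x)" for n
  proof -
    have "{x. ?s n x \<in> A \<and> x \<in> B} \<in> sets \<mu>"
      using measurable_sets[OF ms A, of n] by (simp add: vimage_def Collect_conj_eq)
    then have "measure \<mu> {x. ?s n x \<in> A \<and> x \<in> B} = (LINT x|\<mu>. indicator {x. ?s n x \<in> A \<and> x \<in> B} x)" by simp
    also have "\<dots> = (LINT x|\<mu>. indicator A (?s n x) * indicator B x)"
      by (intro Bochner_Integration.integral_cong) (auto simp: indicator_def)
    finally show ?thesis .
  qed
  have mH: "H \<in> borel_measurable \<mu>" and mB: "(indicator B :: _ \<Rightarrow> real) \<in> borel_measurable \<mu>" by simp_all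
  have intFH: "integrable \<mu> (\<lambda>x. F (?s n x) * H x)" for n
    by (rule \<mu>.integrable_const_bound[where B=1, OF _ borel_measurable_times[OF mFs mH]])
       (simp add: abs_mult mult_le_one HBd FB)
  have intAB: "integrable \<mu> (\<lambda>x. indicator A (?s n x) * indicator B x :: real)" for n
    by (rule \<mu>.integrable_const_bound[where B=1, OF _ borel_measurable_times[OF mAs mB]])
       (auto simp: indicator_def)
  have d1: "\<bar>measure \<mu> {x. ?s n x \<in> A \<and> x \<in> B} - (LINT x|\<mu>. F (?s n x) * H x)\<bar> \<le> \<epsilon> / 2" for n
  proof -
    have "\<bar>measure \<mu> {x. ?s n x \<in> A \<and> x \<in> B} - (LINT x|\<mu>. F (?s n x) * H x)\<bar>
       = \<bar>LINT x|\<mu>. indicator A (?s n x) * indicator B x - F (?s n x) * H x\<bar>"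
      unfolding meas using intFH intAB by simp
    also have "\<dots> \<le> (LINT x|\<mu>. \<bar>indicator A (?s n x) * indicator B x - F (?s n x) * H x\<bar>)" by (rule integral_abs_bound)
    also have "\<dots> \<le> (LINT x|\<mu>. \<bar>indicator A (?s n x) - F (?s n x)\<bar> + \<bar>indicator B x - H x\<bar>)"
    proof (rule integral_mono)
      fix x
      have "indicator A (?s n x) * indicator B x - F (?s n x) * H x
        = (indicator A (?s n x) - F (?s n x)) * indicator B x + F (?s n x) * (indicator B x - H x)"
        by (simp add: algebra_simps)
      also have "\<bar>\<dots>\<bar> \<le> \<bar>indicator A (?s n x) - F (?s n x)\<bar> * \<bar>indicator B x\<bar> + \<bar>F (?s n x)\<bar> * \<bar>indicator B x - H x\<bar>"
        by (rule order_trans[OF abs_triangle_ineq]) (simp add: abs_mult)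
      also have "\<dots> \<le> \<bar>indicator A (?s n x) - F (?s n x)\<bar> * 1 + 1 * \<bar>indicator B x - H x\<bar>"
        by (intro add_mono mult_mono FB) auto
      finally show "\<bar>indicator A (?s n x) * indicator B x - F (?s n x) * H x\<bar> \<le> \<bar>indicator A (?s n x) - F (?s n x)\<bar> + \<bar>indicator B x - H x\<bar>"
        by simp
    qed (intro integrable_abs Bochner_Integration.integrable_diff Bochner_Integration.integrable_add intAB intFH iAs iB)+
    also have "\<dots> = (LINT x|\<mu>. \<bar>indicator A (?s n x) - F (?s n x)\<bar>) + (LINT x|\<mu>. \<bar>indicator B x - H x\<bar>)"
      by (rule Bochner_Integration.integral_add[OF iAs iB])
    also have "(LINT x|\<mu>. \<bar>indicator A (?s n x) - F (?s n x)\<bar>) = (LINT x|\<mu>. \<bar>indicator A x - F x\<bar>)"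
      by (rule shift_int) measurable
    finally show ?thesis using FA HB by linarith
  qed
  have iF: "integrable \<mu> F" and iH: "integrable \<mu> H"
    using FB HBd by (auto intro!: \<mu>.integrable_const_bound[of _ 1])
  have near: "\<bar>measure \<mu> C - (LINT x|\<mu>. K x)\<bar> \<le> (LINT x|\<mu>. \<bar>indicator C x - K x\<bar>)"
    if "C \<in> sets cseq" "integrable \<mu> K" for C K
  proof -
    have "measure \<mu> C - (LINT x|\<mu>. K x) = (LINT x|\<mu>. indicator C x - K x)"
      using that by (subst Bochner_Integration.integral_diff) (auto simp: \<mu>.emeasure_eq_measure)
    then show ?thesis by (simp add: integral_abs_bound)
  qed
  have d2: "\<bar>(LINT x|\<mu>. F x) * (LINT x|\<mu>. H x) - measure \<mu> A * measure \<mu> B\<bar> \<le> \<epsilon> / 2"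
  proof -
    have a1: "\<bar>measure \<mu> A - (LINT x|\<mu>. F x)\<bar> \<le> \<epsilon> / 4" using near[OF A iF] FA by linarith
    have b1: "\<bar>measure \<mu> B - (LINT x|\<mu>. H x)\<bar> \<le> \<epsilon> / 4" using near[OF B iH] HB by linarith
    have h: "\<bar>LINT x|\<mu>. H x\<bar> \<le> 1"
    proof -
      have "\<bar>LINT x|\<mu>. H x\<bar> \<le> (LINT x|\<mu>. \<bar>H x\<bar>)" by (rule integral_abs_bound)
      also have "\<dots> \<le> (LINT x|\<mu>. 1)" using iH HBd by (intro integral_mono integrable_abs) auto
      finally show ?thesis using \<mu>.prob_space by simp
    qed
    have "(LINT x|\<mu>. F x) * (LINT x|\<mu>. H x) - measure \<mu> A * measure \<mu> B
      = ((LINT x|\<mu>. F x) - measure \<mu> A) * (LINT x|\<mu>. H x) + measure \<mu> A * ((LINT x|\<mu>. H x) - measure \<mu> B)"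
      by (simp add: algebra_simps)
    also have "\<bar>\<dots>\<bar> \<le> \<bar>(LINT x|\<mu>. F x) - measure \<mu> A\<bar> * \<bar>LINT x|\<mu>. H x\<bar> + \<bar>measure \<mu> A\<bar> * \<bar>(LINT x|\<mu>. H x) - measure \<mu> B\<bar>"
      by (rule order_trans[OF abs_triangle_ineq]) (simp add: abs_mult)
    also have "\<dots> \<le> \<epsilon> / 4 * 1 + 1 * (\<epsilon> / 4)"
      using a1 b1 h e by (intro add_mono mult_mono) (auto simp: abs_minus_commute)
    finally show ?thesis by simp
  qed
  define c where "c n = L * (2 * (LINT z|cgauss 1. cmod z)) * (\<Sum>i<d. \<Sum>j<k. cmod (a (n + i) j))" for n
  have d3: "\<bar>(LINT x|\<mu>. F (?s n x) * H x) - (LINT x|\<mu>. F x) * (LINT x|\<mu>. H x)\<bar> \<le> c n" for n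
  proof -
    have mHX: "(\<lambda>\<omega>. H (X \<omega>)) \<in> borel_measurable cseq"
      using measurable_compose[OF measurable_X, of H borel] by (simp add: measurable_cong_sets[OF sets_gseq refl])
    \<comment> \<open>Triangularity: the first \<open>k\<close> values of the process involve only
      the first \<open>k\<close> Gaussians.\<close>
    have dep: "H (X \<omega>) = H (X \<omega>')" if "\<And>j. j < k \<Longrightarrow> \<omega> j = \<omega>' j" for \<omega> \<omega>'
      by (rule lip_cyl_cong[OF H]) (use that in \<open>auto simp: X_def\<close>)
    have 1: "(LINT x|\<mu>. F (?s n x) * H x) = (LINT \<omega>|gseq. H (X \<omega>) * F (\<lambda>i. X \<omega> (i + n)))"
      unfolding \<mu>_def using mFs[of n]
      by (subst integral_distr[OF measurable_X])
         (auto simp: mult.commute measurable_cong_sets[OF sets_\<mu> refl] intro!: borel_measurable_times)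
    have 2: "(LINT x|\<mu>. H x) = (LINT \<omega>|gseq. H (X \<omega>))"
      unfolding \<mu>_def by (rule integral_distr[OF measurable_X]) simp
    show ?thesis using coupling[where k=k and n=n, OF mHX HBd dep F] unfolding 1 2 c_def by (simp add: mult.commute)
  qed
  have "cesaro_null c" unfolding c_def
    by (intro cesaro_null_cmult cesaro_null_sum cesaro_null_shift[of _ 1] cesaro) (auto simp: a_le)
  moreover have "\<bar>measure \<mu> {x. ?s n x \<in> A \<and> x \<in> B} - measure \<mu> A * measure \<mu> B\<bar> \<le> c n + \<epsilon>" for n
    using d1[of n] d2 d3[of n] by linarith
  ultimately show "\<exists>u. cesaro_null u \<and> (\<forall>n. \<bar>measure \<mu> {x. ?s n x \<in> A \<and> x \<in> B} - measure \<mu> A * measure \<mu> B\<bar> \<le> u n + \<epsilon>)"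
    by blast
qed auto

end

subsection \<open>Bounded sequences\<close>

lemma Bcontfun_nat_apply:
  fixes f :: "nat \<Rightarrow> complex"
  assumes "\<And>n. cmod (f n) \<le> K"
  shows "apply_bcontfun (Bcontfun f) n = f n"
  by (subst Bcontfun_inverse) (auto intro!: bcontfun_normI[where b=K] assms simp: continuous_on_open_vimage open_discrete)

lemma cscale_apply[simp]: "apply_bcontfun (cscale c f) n = c * apply_bcontfun f n"
  unfolding cscale_def
  by (rule Bcontfun_nat_apply[where K="cmod c * norm f"])
     (auto simp: norm_mult intro!: mult_left_mono norm_bounded)

lemma apply_sum: "apply_bcontfun (\<Sum>i\<in>I. f i :: linf) n = (\<Sum>i\<in>I. apply_bcontfun (f i) n)"
  by (induction I rule: infinite_finite_induct) auto

lemma norm_cscale_le: "norm (cscale c f) \<le> cmod c * norm f"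
  by (rule norm_bound) (auto simp: norm_mult intro!: mult_left_mono norm_bounded)

lemma cscale_add_left: "cscale (c + d) f = cscale c f + cscale d f"
  by (rule bcontfun_eqI) (simp add: algebra_simps)

lemma cscale_diff_left: "cscale (c - d) f = cscale c f - cscale d f"
  by (rule bcontfun_eqI) (simp add: algebra_simps)

lemma cscale_cscale: "cscale c (cscale d f) = cscale (c * d) f"
  by (rule bcontfun_eqI) (simp add: algebra_simps)

lemma cscale_0_left[simp]: "cscale 0 f = 0"
  by (rule bcontfun_eqI) simp

lemma bounded_linear_cscale: "bounded_linear (cscale c)"
  by (rule bounded_linear_intro[where K="cmod c"])
     (auto intro!: bcontfun_eqI simp: algebra_simps norm_cscale_le intro: order_trans[OF norm_cscale_le])

lemma bounded_linear_apply: "bounded_linear (\<lambda>f :: linf. apply_bcontfun f n)"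
  by (rule bounded_linear_intro[where K=1]) (auto simp: norm_bounded)

lemma cscale_sum: "cscale c (\<Sum>i\<in>I. f i) = (\<Sum>i\<in>I. cscale c (f i))"
  by (rule bcontfun_eqI) (simp add: apply_sum sum_distrib_left)

text \<open>Coordinate \<open>n\<close> of a point will be the process value divided by 2^n; the
  factor 2 restores the weight after the index shift.\<close>

definition bshift :: "linf \<Rightarrow> linf" where
  "bshift f = Bcontfun (\<lambda>n. 2 * apply_bcontfun f (Suc n))"

lemma bshift_apply[simp]: "apply_bcontfun (bshift f) n = 2 * apply_bcontfun f (Suc n)"
  unfolding bshift_def
  by (rule Bcontfun_nat_apply[where K="2 * norm f"]) (auto simp: norm_mult norm_bounded)

lemma norm_bshift_le: "norm (bshift f) \<le> 2 * norm f"
  by (rule norm_bound) (auto simp: norm_mult norm_bounded)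

lemma bounded_linear_bshift: "bounded_linear bshift"
  by (rule bounded_linear_intro[where K=2])
     (auto intro!: bcontfun_eqI simp: algebra_simps norm_bshift_le[unfolded mult.commute[of 2]])

lemma bshift_cscale: "bshift (cscale c f) = cscale c (bshift f)"
  by (rule bcontfun_eqI) (simp add: algebra_simps)

text \<open>Conjugates \<open>bshift\<close> to the plain shift on sequences, where the law of the
  process lives.\<close>

definition unweight :: "linf \<Rightarrow> nat \<Rightarrow> complex" where
  "unweight f n = 2 ^ n * apply_bcontfun f n"

lemma unweight_bshift_power: "unweight ((bshift ^^ k) f) i = unweight f (i + k)"
proof (induction k arbitrary: i)
  case (Suc k)
  have "unweight ((bshift ^^ Suc k) f) i = unweight ((bshift ^^ k) f) (Suc i)" by (simp add: unweight_def)
  then show ?case using Suc[of "Suc i"] by simp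
qed simp

text \<open>Closed balls of the sup norm are countable intersections of coordinate conditions, hence
  visible to the product \<sigma>-algebra.\<close>

lemma dist_le_unweight: "dist f g \<le> r \<longleftrightarrow> (\<forall>n. cmod (unweight f n - unweight g n) \<le> r * 2 ^ n)"
proof -
  have "cmod (unweight f n - unweight g n) = 2 ^ n * dist (apply_bcontfun f n) (apply_bcontfun g n)" for n
    unfolding unweight_def dist_norm by (simp add: norm_mult norm_power flip: right_diff_distrib)
  then have "(\<forall>n. cmod (unweight f n - unweight g n) \<le> r * 2 ^ n) \<longleftrightarrow> (\<forall>n. dist (apply_bcontfun f n) (apply_bcontfun g n) \<le> r)"
    by (simp add: mult.commute)
  also have "\<dots> \<longleftrightarrow> dist f g \<le> r"
    by (meson dist_bound dist_bounded order_trans)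
  finally show ?thesis ..
qed

lemma measurable_apply_bcontfun: "(\<lambda>f :: linf. apply_bcontfun f n) \<in> borel_measurable borel"
  by (intro borel_measurable_continuous_onI bounded_linear.continuous_on[OF bounded_linear_apply] continuous_intros)

text \<open>On a separable set, the Borel sets of the nonseparable space are generated by the coordinates.\<close>

lemma borel_separable_coordinates:
  assumes D: "countable D" "Y \<subseteq> closure D" and B: "B \<in> sets (borel :: linf measure)"
  shows "\<exists>A\<in>sets cseq. \<forall>y\<in>Y. y \<in> B \<longleftrightarrow> unweight y \<in> A"
proof -
  have "B \<in> sigma_sets UNIV (Collect open)" using B by (simp add: borel_def)
  then show ?thesis
  proof (induction rule: sigma_sets.induct)
    case (Basic U)
    then have U: "open U" by simp
    \<comment> \<open>Closed balls inside \<open>U\<close> with centre in \<open>D\<close> and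
      rational radius: countably many, each cut out by coordinates, and together they cover the
      points of \<open>Y\<close> in \<open>U\<close>.\<close>
    define J where "J = {(d, r). d \<in> D \<and> r \<in> \<rat> \<and> cball d r \<subseteq> U}"
    have cJ: "countable J"
      by (rule countable_subset[of _ "D \<times> \<rat>"]) (auto simp: J_def D countable_rat)
    define C where "C p = {x :: nat \<Rightarrow> complex. \<forall>n. cmod (unweight (fst p) n - x n) \<le> snd p * 2 ^ n}" for p
    have "C p \<in> sets cseq" for p
    proof -
      have "{x \<in> space cseq. \<forall>n. cmod (unweight (fst p) n - x n) \<le> snd p * 2 ^ n} \<in> sets cseq" by measurable
      then show ?thesis by (simp add: C_def space_PiM)
    qed
    then have mA: "(\<Union>p\<in>J. C p) \<in> sets cseq" using cJ by (intro sets.countable_UN') auto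
    have "y \<in> U \<longleftrightarrow> unweight y \<in> (\<Union>p\<in>J. C p)" if y: "y \<in> Y" for y
    proof
      assume "y \<in> U"
      then obtain e where e: "e > 0" "ball y e \<subseteq> U" using U openE by blast
      obtain d where d: "d \<in> D" "dist d y < e / 3"
        using y D(2) e(1) closure_approachable[of y D] by (meson subsetD zero_less_divide_iff zero_less_numeral)
      \<comment> \<open>The bound e/3 < r puts \<open>y\<close> into the ball around
        \<open>d\<close>, and e/3 + e/2 < e keeps that ball inside \<open>U\<close>.\<close>
      obtain r where r: "r \<in> \<rat>" "e / 3 < r" "r < e / 2"
        using Rats_dense_in_real[of "e / 3" "e / 2"] e(1) by auto
      have "cball d r \<subseteq> ball y e"
      proof
        fix z assume "z \<in> cball d r"
        then have "dist y z \<le> dist d y + r" using dist_triangle[of y z d] by (simp add: dist_commute)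
        then show "z \<in> ball y e" using d r e by simp
      qed
      then have "(d, r) \<in> J" using d r e by (auto simp: J_def)
      moreover have "unweight y \<in> C (d, r)"
        using d r dist_le_unweight[of d y r] by (simp add: C_def)
      ultimately show "unweight y \<in> (\<Union>p\<in>J. C p)" by blast
    next
      assume "unweight y \<in> (\<Union>p\<in>J. C p)"
      then obtain d r where "(d, r) \<in> J" "unweight y \<in> C (d, r)" by auto
      then show "y \<in> U" using dist_le_unweight[of d y r] by (auto simp: J_def C_def)
    qed
    then show ?case using mA by blast
  next
    case Empty
    then show ?case by (intro bexI[of _ "{}"]) auto
  next
    case (Compl a)
    then obtain A where A: "A \<in> sets cseq" "\<forall>y\<in>Y. y \<in> a \<longleftrightarrow> unweight y \<in> A" by blast
    have "space cseq - A \<in> sets cseq" using A(1) by (rule sets.compl_sets)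
    then show ?case using A(2) by (intro bexI[of _ "space cseq - A"]) (auto simp: space_PiM)
  next
    case (Union a)
    then obtain A where A: "\<And>i. A i \<in> sets cseq" "\<And>i. \<forall>y\<in>Y. y \<in> a i \<longleftrightarrow> unweight y \<in> A i" by metis
    have "(\<Union>i. A i) \<in> sets cseq" using A(1) by auto
    then show ?case using A(2) by (intro bexI[of _ "\<Union>i. A i"]) auto
  qed
qed

context gaussian_shift
begin

subsection \<open>The Banach space\<close>

text \<open>Weighted column \<open>j\<close> of \<open>a\<close>; the random point of the space will
  be the series of the vectors \<open>v j\<close> with Gaussian coefficients.\<close>

definition v :: "nat \<Rightarrow> linf" where
  "v j = Bcontfun (\<lambda>n. a n j / 2 ^ n)"

lemma v_apply: "apply_bcontfun (v j) n = a n j / 2 ^ n"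
  unfolding v_def
proof (rule Bcontfun_nat_apply[where K=1])
  fix n
  have "cmod (a n j) \<le> 1 * 1" using a_le by simp
  also have "\<dots> \<le> 1 * 2 ^ n" by simp
  finally show "cmod (a n j / 2 ^ n) \<le> 1" by (simp add: norm_divide norm_power)
qed

text \<open>By triangularity the column starts at row \<open>j\<close>, where the weight is already
  2^-j. This decay makes the Gaussian series converge.\<close>

lemma norm_v: "norm (v j) \<le> (1/2) ^ j"
proof (rule norm_bound)
  fix n
  show "cmod (apply_bcontfun (v j) n) \<le> (1/2) ^ j"
  proof (cases "n < j")
    case False
    have "cmod (a n j) / 2 ^ n \<le> 1 / 2 ^ n" using a_le by (simp add: divide_right_mono)
    also have "\<dots> \<le> 1 / 2 ^ j" using False by (simp add: frac_le power_increasing)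
    finally show ?thesis by (simp add: v_apply norm_divide norm_power power_one_over)
  qed (simp add: v_apply tri)
qed

lemma norm_cscale_v: "norm (cscale c (v j)) \<le> cmod c / 2 ^ j"
proof -
  have "norm (cscale c (v j)) \<le> cmod c * (1/2) ^ j"
    by (rule order_trans[OF norm_cscale_le]) (intro mult_left_mono norm_v norm_ge_zero)
  then show ?thesis by (simp add: power_one_over)
qed

definition lin :: "nat \<Rightarrow> (nat \<Rightarrow> complex) \<Rightarrow> linf" where
  "lin N c = (\<Sum>j<N. cscale (c j) (v j))"

definition XX :: "linf set" where
  "XX = closure {lin N c |N c. True}"

lemma lin_in_XX: "lin N c \<in> XX"
  unfolding XX_def by (rule closure_subset[THEN subsetD]) auto

lemma lin_extend: "N \<le> M \<Longrightarrow> lin N c = lin M (\<lambda>j. if j < N then c j else 0)"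
  unfolding lin_def by (rule sum.mono_neutral_cong_left) auto

lemma norm_lin_diff: "norm (lin N c - lin N d) \<le> (\<Sum>j<N. cmod (c j - d j) / 2 ^ j)"
proof -
  have "lin N c - lin N d = (\<Sum>j<N. cscale (c j - d j) (v j))"
    by (simp add: lin_def cscale_diff_left sum_subtractf)
  also have "norm \<dots> \<le> (\<Sum>j<N. norm (cscale (c j - d j) (v j)))" by (rule norm_sum)
  also have "\<dots> \<le> (\<Sum>j<N. cmod (c j - d j) / 2 ^ j)" by (intro sum_mono norm_cscale_v)
  finally show ?thesis .
qed

lemma geo_sum_le: "(\<Sum>j<N. r / 2 ^ j) \<le> 2 * r" if "r \<ge> 0" for r :: real
proof -
  have "(\<Sum>j<N. r / 2 ^ j) = r * (\<Sum>j<N. (1/2) ^ j)" by (simp add: sum_distrib_left power_one_over)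
  also have "\<dots> = r * (2 - 2 * (1/2)^N)" by (subst geometric_sum) (auto simp: field_simps)
  also have "\<dots> \<le> r * 2" using that by (intro mult_left_mono) auto
  finally show ?thesis by simp
qed

lemma XX_closed_under:
  assumes f: "bounded_linear f" and "\<And>N c. f (lin N c) \<in> XX" and "x \<in> XX"
  shows "f x \<in> XX"
proof -
  have "f ` XX \<subseteq> XX"
    using assms(2) unfolding XX_def
    by (intro image_closure_subset) (auto intro!: bounded_linear.continuous_on[OF f] continuous_intros)
  then show ?thesis using assms(3) by blast
qed

lemma XX_add: "x \<in> XX \<Longrightarrow> y \<in> XX \<Longrightarrow> x + y \<in> XX"
proof -
  assume "x \<in> XX" "y \<in> XX"
  then obtain xs ys where xs: "\<And>n. xs n \<in> {lin N c |N c. True}" "xs \<longlonglongrightarrow> x"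
    and ys: "\<And>n. ys n \<in> {lin N c |N c. True}" "ys \<longlonglongrightarrow> y"
    unfolding XX_def closure_sequential by blast
  have "xs n + ys n \<in> {lin N c |N c. True}" for n
  proof -
    obtain N c M d where *: "xs n = lin N c" "ys n = lin M d" using xs(1)[of n] ys(1)[of n] by blast
    have "xs n + ys n = lin (max N M) (\<lambda>j. (if j < N then c j else 0) + (if j < M then d j else 0))"
      unfolding * lin_extend[of N "max N M" c, simplified] lin_extend[of M "max N M" d, simplified]
      by (simp add: lin_def cscale_add_left sum.distrib)
    then show ?thesis by blast
  qed
  then show "x + y \<in> XX" unfolding XX_def closure_sequential
    using tendsto_add[OF xs(2) ys(2)] by (intro exI[of _ "\<lambda>n. xs n + ys n"]) auto
qed

lemma XX_cscale: "x \<in> XX \<Longrightarrow> cscale c x \<in> XX"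
proof (rule XX_closed_under[OF bounded_linear_cscale])
  fix N d
  have "cscale c (lin N d) = lin N (\<lambda>j. c * d j)" by (simp add: lin_def cscale_sum cscale_cscale)
  then show "cscale c (lin N d) \<in> XX" by (simp add: lin_in_XX)
qed

lemma XX_0: "0 \<in> XX"
  using lin_in_XX[of 0] by (simp add: lin_def)

lemma closed_XX: "closed XX"
  by (simp add: XX_def)

lemma complex_subspace_XX: "complex_subspace XX"
  by (simp add: complex_subspace_def XX_0 XX_add XX_cscale)

lemma v_in_XX: "v j \<in> XX"
proof -
  have "v j = lin (Suc j) (\<lambda>i. if i = j then 1 else 0)"
    by (rule bcontfun_eqI) (simp add: lin_def apply_sum if_distrib[of "\<lambda>x. x * _"] cong: if_cong)
  then show ?thesis using lin_in_XX by simp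
qed

text \<open>The infinite combination of the \<open>v j\<close>, written coordinatewise:
  triangularity makes every coordinate a finite sum.\<close>

definition csum :: "(nat \<Rightarrow> complex) \<Rightarrow> linf" where
  "csum c = Bcontfun (\<lambda>n. (\<Sum>j<Suc n. c j * a n j) / 2 ^ n)"

text \<open>One estimate with two uses: N = 0 gives boundedness of \<open>csum c\<close>, general
  \<open>N\<close> its distance to a partial sum.\<close>

lemma coordinate_tail_le:
  assumes s: "summable (\<lambda>j. cmod (c j) / 2 ^ j)"
  shows "cmod ((\<Sum>j\<in>{N..<Suc n}. c j * a n j) / 2 ^ n) \<le> (\<Sum>j. cmod (c (j + N)) / 2 ^ (j + N))"
proof -
  have "cmod ((\<Sum>j\<in>{N..<Suc n}. c j * a n j) / 2 ^ n) = cmod (\<Sum>j\<in>{N..<Suc n}. c j * a n j) / 2 ^ n"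
    by (simp add: norm_divide norm_power)
  also have "\<dots> \<le> (\<Sum>j\<in>{N..<Suc n}. cmod (c j * a n j)) / 2 ^ n"
    by (intro divide_right_mono norm_sum) simp
  also have "\<dots> = (\<Sum>j\<in>{N..<Suc n}. cmod (c j * a n j) / 2 ^ n)" by (rule sum_divide_distrib)
  also have "\<dots> \<le> (\<Sum>j\<in>{N..<Suc n}. cmod (c j) / 2 ^ j)"
  proof (rule sum_mono)
    fix j assume "j \<in> {N..<Suc n}"
    then have "(2::real) ^ j \<le> 2 ^ n" by (simp add: power_increasing)
    moreover have "cmod (c j * a n j) \<le> cmod (c j)"
      using a_le[of n j] by (simp add: norm_mult mult_left_le)
    ultimately show "cmod (c j * a n j) / 2 ^ n \<le> cmod (c j) / 2 ^ j" by (intro frac_le) auto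
  qed
  also have "\<dots> = (\<Sum>j<Suc n - N. cmod (c (j + N)) / 2 ^ (j + N))"
    by (rule sum.reindex_bij_witness[of _ "\<lambda>j. j + N" "\<lambda>j. j - N"]) auto
  also have "\<dots> \<le> (\<Sum>j. cmod (c (j + N)) / 2 ^ (j + N))"
    using summable_ignore_initial_segment[OF s, of N] by (intro sum_le_suminf) auto
  finally show ?thesis .
qed

lemma csum_apply:
  assumes "summable (\<lambda>j. cmod (c j) / 2 ^ j)"
  shows "apply_bcontfun (csum c) n = (\<Sum>j<Suc n. c j * a n j) / 2 ^ n"
  unfolding csum_def
proof (rule Bcontfun_nat_apply)
  show "cmod ((\<Sum>j<Suc n. c j * a n j) / 2 ^ n) \<le> (\<Sum>j. cmod (c (j + 0)) / 2 ^ (j + 0))" for n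
    using coordinate_tail_le[where N=0 and n=n, OF assms] unfolding atLeast0LessThan .
qed

lemma norm_csum_diff_lin:
  assumes "summable (\<lambda>j. cmod (c j) / 2 ^ j)"
  shows "norm (csum c - lin N c) \<le> (\<Sum>j. cmod (c (j + N)) / 2 ^ (j + N))"
proof (rule norm_bound)
  fix n
  have "apply_bcontfun (lin N c) n = (\<Sum>j<N. c j * a n j) / 2 ^ n"
    by (simp add: lin_def apply_sum v_apply sum_divide_distrib)
  also have "(\<Sum>j<N. c j * a n j) = (\<Sum>j<min N (Suc n). c j * a n j)"
    by (rule sum.mono_neutral_right) (auto simp: tri)
  finally have "apply_bcontfun (csum c - lin N c) n = ((\<Sum>j<Suc n. c j * a n j) - (\<Sum>j<min N (Suc n). c j * a n j)) / 2 ^ n"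
    by (simp add: csum_apply[OF assms] diff_divide_distrib)
  also have "(\<Sum>j<Suc n. c j * a n j) - (\<Sum>j<min N (Suc n). c j * a n j) = (\<Sum>j\<in>{..<Suc n} - {..<min N (Suc n)}. c j * a n j)"
    by (rule sum_diff[symmetric]) auto
  also have "{..<Suc n} - {..<min N (Suc n)} = {N..<Suc n}" by auto
  finally show "cmod (apply_bcontfun (csum c - lin N c) n) \<le> (\<Sum>j. cmod (c (j + N)) / 2 ^ (j + N))"
    using coordinate_tail_le[OF assms] by simp
qed

lemma lin_tendsto_csum:
  assumes s: "summable (\<lambda>j. cmod (c j) / 2 ^ j)"
  shows "(\<lambda>N. lin N c) \<longlonglongrightarrow> csum c"
proof -
  have "(\<lambda>N. lin N c - csum c) \<longlonglongrightarrow> 0"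
  proof (rule Lim_null_comparison[OF always_eventually])
    show "\<forall>N. norm (lin N c - csum c) \<le> (\<Sum>j. cmod (c (j + N)) / 2 ^ (j + N))"
      using norm_csum_diff_lin[OF s] by (simp add: norm_minus_commute)
    show "(\<lambda>N. \<Sum>j. cmod (c (j + N)) / 2 ^ (j + N)) \<longlonglongrightarrow> 0"
      using suminf_exist_split2[OF s] .
  qed
  then show ?thesis using Lim_null by blast
qed

lemma csum_in_XX:
  assumes s: "summable (\<lambda>j. cmod (c j) / 2 ^ j)"
  shows "csum c \<in> XX"
  using closed_XX lin_in_XX lin_tendsto_csum[OF s] closed_sequentially by metis

text \<open>By \<open>hessenberg\<close>, the shift of \<open>v j\<close> is the infinite
  combination of the \<open>v i\<close> with coefficients \<open>b i j\<close>. These have modulus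
  at most 1, so the combination converges inside the space.\<close>

lemma bshift_XX: "x \<in> XX \<Longrightarrow> bshift x \<in> XX"
proof (rule XX_closed_under[OF bounded_linear_bshift])
  fix N c
  have v: "bshift (v j) \<in> XX" for j
  proof -
    have s: "summable (\<lambda>i. cmod (b i j) / 2 ^ i)"
    proof (rule summable_comparison_test'[of "\<lambda>i. (1/2) ^ i" 0])
      fix i show "norm (cmod (b i j) / 2 ^ i) \<le> (1/2) ^ i"
        using b_le[of i j] by (simp add: power_one_over divide_right_mono)
    qed (simp add: summable_geometric)
    have "bshift (v j) = csum (\<lambda>i. b i j)"
      by (rule bcontfun_eqI)
         (simp add: v_apply csum_apply[OF s] hessenberg mult.commute del: sum.lessThan_Suc)
    then show ?thesis using csum_in_XX[OF s] by simp
  qed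
  show "bshift (lin N c) \<in> XX"
  proof (induction N)
    case 0
    show ?case by (simp add: lin_def bounded_linear.linear[OF bounded_linear_bshift, THEN linear_0] XX_0)
  next
    case (Suc N)
    have "bshift (lin (Suc N) c) = bshift (lin N c) + cscale (c N) (bshift (v N))"
      by (simp add: lin_def linear_add[OF bounded_linear.linear[OF bounded_linear_bshift]] bshift_cscale)
    then show ?case using Suc v by (simp add: XX_add XX_cscale)
  qed
qed

lemma bounded_op_bshift: "bounded_op XX bshift"
  unfolding bounded_op_def
  using bshift_XX norm_bshift_le
  by (auto simp: bshift_cscale linear_add[OF bounded_linear.linear[OF bounded_linear_bshift]])

lemma separable_XX: "\<exists>D. countable D \<and> D \<subseteq> XX \<and> XX \<subseteq> closure D"
proof -
  obtain Q :: "complex set" where Q: "countable Q" "\<And>U. open U \<Longrightarrow> U \<noteq> {} \<Longrightarrow> \<exists>d\<in>Q. d \<in> U"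
    using countable_dense_setE by blast
  define D where "D = (\<lambda>cs. lin (length cs) (\<lambda>j. cs ! j)) ` lists Q"
  have cD: "countable D" unfolding D_def using Q(1) by (intro countable_image countable_lists)
  have sub: "D \<subseteq> XX" by (auto simp: D_def lin_in_XX)
  have "lin N c \<in> closure D" for N c
    unfolding closure_approachable
  proof (intro allI impI)
    fix e :: real assume e: "e > 0"
    \<comment> \<open>Coefficient errors below e/3 add up to at most 2e/3, because the norms of the
      \<open>v j\<close> are dominated by a geometric series with sum 2.\<close>
    have "\<exists>q\<in>Q. q \<in> ball (c j) (e / 3)" for j using e by (intro Q(2)) auto
    then obtain q where q: "\<And>j. q j \<in> Q" "\<And>j. dist (c j) (q j) < e / 3" by (metis mem_ball)
    have eq: "lin N q = lin (length (map q [0..<N])) (\<lambda>j. map q [0..<N] ! j)"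
      by (simp add: lin_def)
    have inD: "lin N q \<in> D"
      unfolding D_def eq by (rule imageI) (use q(1) in auto)
    have "norm (lin N q - lin N c) \<le> (\<Sum>j<N. cmod (q j - c j) / 2 ^ j)" by (rule norm_lin_diff)
    also have "\<dots> \<le> (\<Sum>j<N. (e / 3) / 2 ^ j)"
      using q(2) by (intro sum_mono divide_right_mono) (auto simp: dist_norm norm_minus_commute less_imp_le)
    also have "\<dots> \<le> 2 * (e / 3)" using e by (intro geo_sum_le) auto
    also have "\<dots> < e" using e by simp
    finally show "\<exists>y\<in>D. dist y (lin N c) < e" using inD by (auto simp: dist_norm)
  qed
  then have "XX \<subseteq> closure D" unfolding XX_def by (intro closure_minimal) auto
  then show ?thesis using cD sub by blast
qed

text \<open>The vectors are in echelon form: \<open>v k\<close> is nonzero at coordinate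
  \<open>k\<close>, where all later ones vanish. This gives arbitrarily large independent families,
  over the reals as \<open>span\<close> requires.\<close>

lemma infinite_dim_XX: "\<not> (\<exists>B. finite B \<and> XX \<subseteq> span B)"
proof
  assume "\<exists>B. finite B \<and> XX \<subseteq> span B"
  then obtain B where B: "finite B" "XX \<subseteq> span B" by blast
  have vne: "apply_bcontfun (v k) k \<noteq> 0" for k by (simp add: v_apply diag)
  have vz: "apply_bcontfun (v j) k = 0" if "k < j" for j k using that by (simp add: v_apply tri)
  have ind: "independent (v ` {k..<k + l})" for k l
  proof (induction l arbitrary: k)
    case 0
    then show ?case by (simp add: independent_empty)
  next
    case (Suc l)
    have "apply_bcontfun x k = 0" if "x \<in> span (v ` {Suc k..<Suc k + l})" for x
      using that
    proof (induction rule: span_induct)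
      case base
      show ?case by (simp add: subspace_def)
    next
      case (step x)
      then show ?case using vz by auto
    qed
    then have "v k \<notin> span (v ` {Suc k..<Suc k + l})" using vne by blast
    then have "independent (insert (v k) (v ` {Suc k..<Suc k + l}))"
      using Suc.IH by (intro independent_insertI)
    also have "insert (v k) (v ` {Suc k..<Suc k + l}) = v ` {k..<k + Suc l}"
    proof -
      have "{k..<k + Suc l} = insert k {Suc k..<Suc k + l}" by auto
      then show ?thesis by simp
    qed
    finally show ?case .
  qed
  have inj: "inj v"
  proof (rule injI)
    fix i j assume "v i = v j"
    then show "i = j" using vne[of i] vne[of j] vz[of i j] vz[of j i] by (metis linorder_neqE_nat)
  qed
  have "card (v ` {0..<0 + Suc (card B)}) \<le> card B"
    using independent_span_bound[OF B(1) ind] B(2) v_in_XX by blast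
  then show False using card_image[OF inj_on_subset[OF inj subset_UNIV], of "{0..<Suc (card B)}"] by simp
qed

lemma sep_inf_banach_XX: "sep_inf_banach XX"
  unfolding sep_inf_banach_def
  using complex_subspace_XX closed_XX separable_XX infinite_dim_XX by blast

end

context gaussian_shift
begin

subsection \<open>The Gaussian measure\<close>

definition good :: "(nat \<Rightarrow> complex) \<Rightarrow> bool" where
  "good \<omega> \<longleftrightarrow> summable (\<lambda>j. cmod (\<omega> j) / 2 ^ j)"

text \<open>The expectation of the series is a convergent geometric series.\<close>

lemma AE_good: "AE \<omega> in gseq. good \<omega>"
proof -
  define e where "e = (LINT z|cgauss 1. cmod z)"
  have e0: "e \<ge> 0" by (simp add: e_def)
  have int: "integrable gseq (\<lambda>\<omega>. cmod (\<omega> j) / 2 ^ j)" for j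
    by (intro integrable_divide gseq_integrable_component)
  have "(\<integral>\<^sup>+\<omega>. (\<Sum>j. ennreal (cmod (\<omega> j) / 2 ^ j)) \<partial>gseq) = (\<Sum>j. \<integral>\<^sup>+\<omega>. ennreal (cmod (\<omega> j) / 2 ^ j) \<partial>gseq)"
    by (rule nn_integral_suminf) measurable
  also have "(\<lambda>j. \<integral>\<^sup>+\<omega>. ennreal (cmod (\<omega> j) / 2 ^ j) \<partial>gseq) = (\<lambda>j. ennreal (e * (1/2) ^ j))"
  proof
    fix j
    have "(\<integral>\<^sup>+\<omega>. ennreal (cmod (\<omega> j) / 2 ^ j) \<partial>gseq) = ennreal (LINT \<omega>|gseq. cmod (\<omega> j) / 2 ^ j)"
      by (rule nn_integral_eq_integral[OF int]) auto
    then show "(\<integral>\<^sup>+\<omega>. ennreal (cmod (\<omega> j) / 2 ^ j) \<partial>gseq) = ennreal (e * (1/2) ^ j)"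
      by (simp add: gseq_expectation_component e_def power_one_over)
  qed
  also have "(\<Sum>j. ennreal (e * (1/2) ^ j)) = ennreal (\<Sum>j. e * (1/2) ^ j)"
    using e0 by (intro suminf_ennreal2) (auto intro!: summable_mult summable_geometric)
  finally have "(\<integral>\<^sup>+\<omega>. (\<Sum>j. ennreal (cmod (\<omega> j) / 2 ^ j)) \<partial>gseq) \<noteq> \<infinity>" by simp
  then have "AE \<omega> in gseq. (\<Sum>j. ennreal (cmod (\<omega> j) / 2 ^ j)) \<noteq> \<infinity>"
    by (intro nn_integral_noteq_infinite) auto
  then show ?thesis
    by eventually_elim (auto simp: good_def intro!: summable_suminf_not_top)
qed

lemma measurable_good[measurable]: "Measurable.pred gseq good"
proof -
  have "good \<omega> \<longleftrightarrow> (\<Sum>j. ennreal (cmod (\<omega> j) / 2 ^ j)) \<noteq> top" for \<omega>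
    unfolding good_def
    using summable_suminf_not_top[of "\<lambda>j. cmod (\<omega> j) / 2 ^ j"] ennreal_suminf_neq_top[of "\<lambda>j. cmod (\<omega> j) / 2 ^ j"]
    by (metis divide_nonneg_nonneg norm_ge_zero zero_le_numeral zero_le_power)
  then have "good = (\<lambda>\<omega>. (\<Sum>j. ennreal (cmod (\<omega> j) / 2 ^ j)) \<noteq> top)" by blast
  moreover have "Measurable.pred gseq (\<lambda>\<omega>. (\<Sum>j. ennreal (cmod (\<omega> j) / 2 ^ j)) \<noteq> top)" by measurable
  ultimately show ?thesis by simp
qed

text \<open>The Gaussian series on its almost sure event of convergence; the default 0 keeps every
  value inside \<open>XX\<close>.\<close>

definition \<Phi> :: "(nat \<Rightarrow> complex) \<Rightarrow> linf" where
  "\<Phi> \<omega> = (if good \<omega> then csum \<omega> else 0)"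

lemma \<Phi>_in_XX: "\<Phi> \<omega> \<in> XX"
  by (simp add: \<Phi>_def XX_0 csum_in_XX good_def)

lemma unweight_\<Phi>: "unweight (\<Phi> \<omega>) n = (if good \<omega> then X \<omega> n else 0)"
  by (auto simp: \<Phi>_def unweight_def csum_apply good_def X_def mult.commute simp del: sum.lessThan_Suc)

definition XB :: "linf measure" where
  "XB = restrict_space borel XX"

lemma space_XB[simp]: "space XB = XX"
  by (simp add: XB_def space_restrict_space)

text \<open>Separability of \<open>XX\<close> moves every question about its Borel sets to sequence
  space, where the law is \<open>\<mu>\<close>.\<close>

lemma sets_XB_coordinates:
  assumes "A \<in> sets XB"
  obtains A' where "A' \<in> sets cseq" "A = {y \<in> XX. unweight y \<in> A'}"
proof -
  obtain B where B: "B \<in> sets borel" "A = XX \<inter> B" using assms by (auto simp: XB_def sets_restrict_space)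
  obtain D where "countable D" "XX \<subseteq> closure D" using separable_XX by blast
  from borel_separable_coordinates[OF this B(1)] obtain A' where "A' \<in> sets cseq" "\<forall>y\<in>XX. y \<in> B \<longleftrightarrow> unweight y \<in> A'" by blast
  with B(2) that[of A'] show thesis by auto
qed

lemma measurable_unweight: "unweight \<in> XB \<rightarrow>\<^sub>M cseq"
  unfolding XB_def unweight_def[abs_def]
  by (intro measurable_restrict_space1 measurable_cseqI borel_measurable_times borel_measurable_const measurable_apply_bcontfun)

lemma measurable_to_XB:
  assumes "\<And>x. x \<in> space M \<Longrightarrow> f x \<in> XX" and m: "(\<lambda>x. unweight (f x)) \<in> M \<rightarrow>\<^sub>M cseq"
  shows "f \<in> M \<rightarrow>\<^sub>M XB"
proof (rule measurableI)
  fix A assume "A \<in> sets XB"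
  then obtain A' where A': "A' \<in> sets cseq" "A = {y \<in> XX. unweight y \<in> A'}" by (rule sets_XB_coordinates)
  have "f -` A \<inter> space M = (\<lambda>x. unweight (f x)) -` A' \<inter> space M" using A'(2) assms(1) by auto
  then show "f -` A \<inter> space M \<in> sets M" using measurable_sets[OF m A'(1)] by simp
qed (use assms in auto)

lemma measurable_\<Phi>: "\<Phi> \<in> gseq \<rightarrow>\<^sub>M XB"
proof (rule measurable_to_XB[OF \<Phi>_in_XX measurable_cseqI])
  fix i
  show "(\<lambda>x. unweight (\<Phi> x) i) \<in> borel_measurable gseq" unfolding unweight_\<Phi> by measurable
qed

definition mm :: "linf measure" where
  "mm = distr gseq XB \<Phi>"

lemma prob_mm: "prob_space mm"
  unfolding mm_def by (rule gseq.prob_space_distr[OF measurable_\<Phi>])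

lemma sets_mm: "sets mm = sets XB" and space_mm[simp]: "space mm = XX"
  by (simp_all add: mm_def)

lemma distr_mm_unweight: "distr mm cseq unweight = \<mu>"
proof -
  have "distr mm cseq unweight = distr gseq cseq (\<lambda>\<omega>. unweight (\<Phi> \<omega>))"
    unfolding mm_def by (subst distr_distr[OF measurable_unweight measurable_\<Phi>]) (simp add: comp_def)
  also have "\<dots> = distr gseq cseq X"
  proof (rule distr_cong_AE)
    show "AE \<omega> in gseq. unweight (\<Phi> \<omega>) = X \<omega>"
      using AE_good by eventually_elim (auto simp: fun_eq_iff unweight_\<Phi>)
    show "(\<lambda>\<omega>. unweight (\<Phi> \<omega>)) \<in> gseq \<rightarrow>\<^sub>M cseq" by (rule measurable_compose[OF measurable_\<Phi> measurable_unweight])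
    show "X \<in> gseq \<rightarrow>\<^sub>M cseq" by (rule measurable_X)
  qed auto
  finally show ?thesis by (simp add: \<mu>_def)
qed

lemma measure_mm:
  assumes "A' \<in> sets cseq"
  shows "{y \<in> XX. unweight y \<in> A'} \<in> sets mm" "measure mm {y \<in> XX. unweight y \<in> A'} = measure \<mu> A'"
proof -
  have m: "unweight \<in> mm \<rightarrow>\<^sub>M cseq" using measurable_unweight by (simp add: measurable_cong_sets[OF sets_mm refl])
  have eq: "{y \<in> XX. unweight y \<in> A'} = unweight -` A' \<inter> space mm" by auto
  show "{y \<in> XX. unweight y \<in> A'} \<in> sets mm" unfolding eq by (rule measurable_sets[OF m assms])
  show "measure mm {y \<in> XX. unweight y \<in> A'} = measure \<mu> A'"
    unfolding eq distr_mm_unweight[symmetric] by (rule measure_distr[OF m assms, symmetric])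
qed

lemma bshift_power_XX: "x \<in> XX \<Longrightarrow> (bshift ^^ k) x \<in> XX"
  by (induction k) (auto simp: bshift_XX)

lemma unweight_bshift_power': "unweight ((bshift ^^ k) f) = (\<lambda>i. unweight f (i + k))"
  by (rule ext) (rule unweight_bshift_power)

lemma measurable_shift_set: "A' \<in> sets cseq \<Longrightarrow> {x. (\<lambda>i. x (i + n)) \<in> A'} \<in> sets cseq"
  using measurable_sets[OF measurable_shift[of n], of A'] by (simp add: vimage_def space_PiM)

text \<open>\<open>unweight\<close> carries \<open>mm\<close> to \<open>\<mu>\<close> and
  \<open>bshift\<close> to the shift, and every measurable subset of \<open>XX\<close> is a preimage
  under it.\<close>

lemma weakly_mixing_mm: "weakly_mixing mm bshift"
  unfolding weakly_mixing_def
proof (intro conjI ballI)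
  interpret m: prob_space mm by (rule prob_mm)
  have "(\<lambda>x. unweight (bshift x)) \<in> mm \<rightarrow>\<^sub>M cseq"
  proof -
    have "(\<lambda>x. (\<lambda>x i. x (i + 1)) (unweight x)) \<in> XB \<rightarrow>\<^sub>M cseq"
      by (rule measurable_compose[OF measurable_unweight measurable_shift])
    moreover have "unweight (bshift x) = (\<lambda>i. unweight x (i + 1))" for x
      using unweight_bshift_power'[of 1 x] by simp
    ultimately show ?thesis by (simp add: measurable_cong_sets[OF sets_mm refl])
  qed
  then have mb: "bshift \<in> mm \<rightarrow>\<^sub>M XB" by (intro measurable_to_XB) (auto simp: bshift_XX)
  then show mb': "bshift \<in> mm \<rightarrow>\<^sub>M mm" by (simp add: measurable_cong_sets[OF refl sets_mm])
  have vim: "(bshift ^^ n) -` {y \<in> XX. unweight y \<in> A'} \<inter> XX = {y \<in> XX. unweight y \<in> {x. (\<lambda>i. x (i + n)) \<in> A'}}" for n A'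
    by (auto simp: unweight_bshift_power' bshift_power_XX)
  show "distr mm mm bshift = mm"
  proof (rule measure_eqI)
    fix A assume "A \<in> sets (distr mm mm bshift)"
    then have A: "A \<in> sets mm" by simp
    then obtain A' where A': "A' \<in> sets cseq" "A = {y \<in> XX. unweight y \<in> A'}"
      unfolding sets_mm by (rule sets_XB_coordinates)
    have "measure mm (bshift -` A \<inter> XX) = measure \<mu> {x. (\<lambda>i. x (i + 1)) \<in> A'}"
      using vim[of 1 A'] measure_mm(2)[OF measurable_shift_set[OF A'(1), of 1]] by (simp add: A'(2))
    also have "\<dots> = measure (distr \<mu> cseq (\<lambda>x i. x (i + 1))) A'"
      by (subst measure_distr) (use measurable_shift[of 1] in \<open>auto simp: vimage_def A' measurable_cong_sets[OF sets_\<mu> refl]\<close>)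
    also have "\<dots> = measure mm A" unfolding \<mu>_shift A'(2) measure_mm(2)[OF A'(1)] ..
    finally show "emeasure (distr mm mm bshift) A = emeasure mm A"
      using A by (simp add: emeasure_distr[OF mb' A] m.emeasure_eq_measure)
  qed simp
  fix A B assume A: "A \<in> sets mm" and B: "B \<in> sets mm"
  obtain A' where A': "A' \<in> sets cseq" "A = {y \<in> XX. unweight y \<in> A'}"
    using A unfolding sets_mm by (rule sets_XB_coordinates)
  obtain B' where B': "B' \<in> sets cseq" "B = {y \<in> XX. unweight y \<in> B'}"
    using B unfolding sets_mm by (rule sets_XB_coordinates)
  have "measure mm ((bshift ^^ n) -` A \<inter> space mm \<inter> B) = measure \<mu> {x. (\<lambda>i. x (i + n)) \<in> A' \<and> x \<in> B'}" for n
  proof -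
    have "(bshift ^^ n) -` A \<inter> space mm \<inter> B = {y \<in> XX. unweight y \<in> {x. (\<lambda>i. x (i + n)) \<in> A'} \<inter> B'}"
      unfolding A'(2) B'(2) space_mm vim by auto
    also have "measure mm \<dots> = measure \<mu> ({x. (\<lambda>i. x (i + n)) \<in> A'} \<inter> B')"
      by (rule measure_mm(2)) (intro sets.Int measurable_shift_set A' B')
    finally show ?thesis by (simp add: Collect_conj_eq)
  qed
  moreover have "measure mm A = measure \<mu> A'" "measure mm B = measure \<mu> B'"
    using measure_mm A' B' by auto
  ultimately show "(\<lambda>N. (\<Sum>n<N. \<bar>measure mm ((bshift ^^ n) -` A \<inter> space mm \<inter> B) - measure mm A * measure mm B\<bar>) / real N) \<longlonglongrightarrow> 0"
    using weak_mixing[OF A'(1) B'(1)] by (simp add: cesaro_null_def)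
qed

lemma non_recurrence_mm:
  assumes A': "A' \<in> sets cseq" "measure \<mu> A' > 0"
    and "\<And>k x. k \<in> S \<Longrightarrow> x \<in> A' \<Longrightarrow> (\<lambda>i. x (i + k)) \<in> A' \<Longrightarrow> False"
  shows "non_recurrence_set S mm bshift"
  unfolding non_recurrence_set_def
proof (intro bexI[of _ "{y \<in> XX. unweight y \<in> A'}"] conjI ballI)
  fix k assume "k \<in> S"
  then have "(bshift ^^ k) -` {y \<in> XX. unweight y \<in> A'} \<inter> space mm \<inter> {y \<in> XX. unweight y \<in> A'} = {}"
    using assms(3) by (auto simp: unweight_bshift_power')
  then show "measure mm ((bshift ^^ k) -` {y \<in> XX. unweight y \<in> A'} \<inter> space mm \<inter> {y \<in> XX. unweight y \<in> A'}) = 0"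
    by simp
qed (use measure_mm[OF A'(1)] A'(2) in auto)

text \<open>Continuity at 0 bounds \<phi> on a ball of radius d; the scaling \<open>t\<close> brings
  \<open>v j\<close> to norm at most d/2.\<close>

lemma dual_elem_v_bound:
  assumes \<phi>: "dual_elem XX \<phi>"
  obtains K where "\<And>j. cmod (\<phi> (v j)) \<le> K / 2 ^ j"
proof -
  have cont: "continuous_on XX \<phi>" and sc: "\<And>c x. x \<in> XX \<Longrightarrow> \<phi> (cscale c x) = c * \<phi> x"
    using \<phi> by (auto simp: dual_elem_def)
  have \<phi>0: "\<phi> 0 = 0" using sc[OF XX_0, of 0] by simp
  obtain d where d: "d > 0" "\<And>x. x \<in> XX \<Longrightarrow> dist x 0 < d \<Longrightarrow> dist (\<phi> x) (\<phi> 0) < 1"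
    using cont XX_0 unfolding continuous_on_iff by (metis zero_less_one)
  have "cmod (\<phi> (v j)) \<le> (2 / d) / 2 ^ j" for j
  proof -
    define t where "t = d / 2 * 2 ^ j"
    have t: "t > 0" using d by (simp add: t_def)
    have "norm (cscale (of_real t) (v j)) \<le> t / 2 ^ j" using norm_cscale_v[of "of_real t" j] t by simp
    also have "\<dots> < d" using d by (simp add: t_def)
    finally have "cmod (\<phi> (cscale (of_real t) (v j))) < 1"
      using d(2)[of "cscale (of_real t) (v j)"] v_in_XX by (simp add: XX_cscale \<phi>0)
    then have "t * cmod (\<phi> (v j)) < 1" using t by (simp add: sc v_in_XX norm_mult)
    then show ?thesis using d t by (simp add: t_def field_simps)
  qed
  then show thesis by (rule that)
qed

lemma dual_elem_lin:
  assumes \<phi>: "dual_elem XX \<phi>"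
  shows "\<phi> (lin N c) = (\<Sum>j<N. \<phi> (v j) * c j)"
proof (induction N)
  case 0
  have "\<phi> (cscale 0 0) = 0 * \<phi> 0" using \<phi> XX_0 unfolding dual_elem_def by blast
  then show ?case by (simp add: lin_def)
next
  case (Suc N)
  have "lin (Suc N) c = lin N c + cscale (c N) (v N)" by (simp add: lin_def)
  moreover have "\<phi> (lin N c + cscale (c N) (v N)) = \<phi> (lin N c) + c N * \<phi> (v N)"
    using \<phi> lin_in_XX XX_cscale[OF v_in_XX] v_in_XX unfolding dual_elem_def by metis
  ultimately show ?case using Suc by simp
qed

text \<open>A functional of the random series is the almost sure limit of finite Gaussian sums, so
  its characteristic function follows by dominated convergence. The limiting variance is finite
  because the values at \<open>v j\<close> decay geometrically; variance 0 yields the Dirac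
  mass.\<close>

lemma gaussian_measure_mm: "gaussian_measure XX mm"
  unfolding gaussian_measure_def
proof (intro conjI allI impI)
  show "prob_space mm" by (rule prob_mm)
  show "space mm = XX" by simp
  show "sets mm = sets (restrict_space borel XX)" by (simp add: sets_mm XB_def)
  fix \<phi> assume \<phi>: "dual_elem XX \<phi>"
  interpret m: prob_space mm by (rule prob_mm)
  have m\<phi>: "\<phi> \<in> borel_measurable XB"
    unfolding XB_def using \<phi> by (intro borel_measurable_continuous_on_restrict) (simp add: dual_elem_def)
  then have m\<phi>': "\<phi> \<in> borel_measurable mm" by (simp add: measurable_cong_sets[OF sets_mm refl])
  have m\<phi>\<Phi>[measurable]: "(\<lambda>\<omega>. \<phi> (\<Phi> \<omega>)) \<in> borel_measurable gseq"
    by (rule measurable_compose[OF measurable_\<Phi> m\<phi>])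
  obtain K where K: "\<And>j. cmod (\<phi> (v j)) \<le> K / 2 ^ j" using dual_elem_v_bound[OF \<phi>] by blast
  have sq: "summable (\<lambda>j. (cmod (\<phi> (v j)))\<^sup>2)"
  proof (rule summable_comparison_test'[of "\<lambda>j. K\<^sup>2 * (1/4) ^ j" 0])
    show "norm ((cmod (\<phi> (v j)))\<^sup>2) \<le> K\<^sup>2 * (1/4) ^ j" for j
    proof -
      have "(cmod (\<phi> (v j)))\<^sup>2 \<le> (K / 2 ^ j)\<^sup>2" by (intro power_mono K) simp
      also have "\<dots> = K\<^sup>2 * (1/4) ^ j"
        by (simp add: power_divide power_one_over flip: power_mult) (simp add: power_mult mult.commute[of j])
      finally show ?thesis by simp
    qed
  qed (auto intro!: summable_mult summable_geometric)
  define s where "s = (\<Sum>j. (cmod (\<phi> (v j)))\<^sup>2)"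
  have s0: "s \<ge> 0" unfolding s_def by (intro suminf_nonneg sq) simp
  have lim: "AE \<omega> in gseq. (\<lambda>N. \<Sum>j<N. \<phi> (v j) * \<omega> j) \<longlonglongrightarrow> \<phi> (\<Phi> \<omega>)"
    using AE_good
  proof eventually_elim
    fix \<omega> assume g: "good \<omega>"
    have "(\<lambda>N. \<phi> (lin N \<omega>)) \<longlonglongrightarrow> \<phi> (csum \<omega>)"
      using \<phi> lin_tendsto_csum[OF g[unfolded good_def]] lin_in_XX csum_in_XX[OF g[unfolded good_def]]
      unfolding dual_elem_def continuous_on_sequentially comp_def by simp
    then show "(\<lambda>N. \<Sum>j<N. \<phi> (v j) * \<omega> j) \<longlonglongrightarrow> \<phi> (\<Phi> \<omega>)"
      using g by (simp add: dual_elem_lin[OF \<phi>] \<Phi>_def)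
  qed
  have char: "(LINT x|distr mm borel \<phi>. iexp (Re (c * x))) = of_real (exp (- (sqrt s * cmod c)\<^sup>2 / 2))" for c
  proof -
    have e1: "(LINT x|distr mm borel \<phi>. iexp (Re (c * x))) = (LINT \<omega>|gseq. iexp (Re (c * \<phi> (\<Phi> \<omega>))))"
      by (subst integral_distr[OF m\<phi>'], simp) (unfold mm_def, rule integral_distr[OF measurable_\<Phi>], use m\<phi> in measurable)
    have l1: "(\<lambda>N. LINT \<omega>|gseq. iexp (Re (c * (\<Sum>j<N. \<phi> (v j) * \<omega> j)))) \<longlonglongrightarrow> (LINT \<omega>|gseq. iexp (Re (c * \<phi> (\<Phi> \<omega>))))"
    proof (rule integral_dominated_convergence[where w="\<lambda>_. 1"])
      show "AE \<omega> in gseq. (\<lambda>N. iexp (Re (c * (\<Sum>j<N. \<phi> (v j) * \<omega> j)))) \<longlonglongrightarrow> iexp (Re (c * \<phi> (\<Phi> \<omega>)))"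
        using lim by eventually_elim (intro tendsto_intros)
    qed auto
    have "(LINT \<omega>|gseq. iexp (Re (c * (\<Sum>j<N. \<phi> (v j) * \<omega> j)))) = of_real (exp (- ((cmod c)\<^sup>2 * (\<Sum>j<N. (cmod (\<phi> (v j)))\<^sup>2)) / 2))" for N
      using char_gseq[where d=N and c="\<lambda>j. c * \<phi> (v j)"]
      by (simp only: sum_distrib_left mult.assoc norm_mult power_mult_distrib)
    moreover have "(\<lambda>N. of_real (exp (- ((cmod c)\<^sup>2 * (\<Sum>j<N. (cmod (\<phi> (v j)))\<^sup>2)) / 2)) :: complex) \<longlonglongrightarrow> of_real (exp (- ((cmod c)\<^sup>2 * s) / 2))"
      unfolding s_def by (intro tendsto_intros summable_LIMSEQ[OF sq]) auto
    ultimately have "(LINT \<omega>|gseq. iexp (Re (c * \<phi> (\<Phi> \<omega>)))) = of_real (exp (- ((cmod c)\<^sup>2 * s) / 2))"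
      using LIMSEQ_unique[OF l1] by simp
    then show ?thesis using e1 s0 by (simp add: power_mult_distrib mult.commute)
  qed
  show "centered_complex_gaussian (distr mm borel \<phi>)"
  proof (cases "s = 0")
    case True
    have "distr mm borel \<phi> = return borel 0"
    proof (rule char_unique_complex)
      show "prob_space (distr mm borel \<phi>)" by (rule m.prob_space_distr[OF m\<phi>'])
      show "prob_space (return borel (0::complex))" by (rule prob_space_return) simp
      show "(LINT x|distr mm borel \<phi>. iexp (Re (c * x))) = (LINT x|return borel 0. iexp (Re (c * x)))" for c
        unfolding char by (subst integral_return) (auto simp: True)
    qed auto
    then show ?thesis by (simp add: centered_complex_gaussian_def)
  next
    case False
    then have s: "sqrt s > 0" using s0 by simp
    have "distr mm borel \<phi> = cgauss (sqrt s)"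
    proof (rule char_unique_complex)
      show "prob_space (distr mm borel \<phi>)" by (rule m.prob_space_distr[OF m\<phi>'])
      show "prob_space (cgauss (sqrt s))" by (rule prob_space_cgauss[OF s])
      show "(LINT x|distr mm borel \<phi>. iexp (Re (c * x))) = (LINT x|cgauss (sqrt s). iexp (Re (c * x)))" for c
        unfolding char char_cgauss[OF s] ..
    qed auto
    then show ?thesis using s unfolding centered_complex_gaussian_def cgauss_def by blast
  qed
qed

text \<open>Near a finite combination close to a point of the open set, two independent events of
  positive probability combine: the first N' Gaussians lie near its coefficients, and the tail of
  the series is bounded.\<close>

lemma non_degenerate_mm: "non_degenerate XX mm"
  unfolding non_degenerate_def
proof (intro allI impI, elim conjE)
  fix U assume U: "openin (top_of_set XX) U" "U \<noteq> {}"
  interpret m: prob_space mm by (rule prob_mm)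
  obtain y0 where y0: "y0 \<in> U" using U by blast
  obtain e where e: "e > 0" "\<And>y. y \<in> XX \<Longrightarrow> dist y y0 < e \<Longrightarrow> y \<in> U" and y0X: "y0 \<in> XX"
    using U(1) y0 unfolding openin_euclidean_subtopology_iff by blast
  obtain N c where Nc: "dist (lin N c) y0 < e / 4"
  proof -
    have "\<exists>y\<in>{lin N c |N c. True}. dist y y0 < e / 4"
      using y0X[unfolded XX_def closure_approachable, rule_format, of "e / 4"] e(1) by simp
    then show thesis using that by blast
  qed
  \<comment> \<open>This event will be applied to the noise re-indexed from N' on, which gains a
    factor 2^-N' in the series. Hence the bound \<open>R\<close> can be fixed before N'.\<close>
  define BB where "BB R = {\<omega>. good \<omega> \<and> (\<Sum>j. cmod (\<omega> j) / 2 ^ j) \<le> real R}" for R :: nat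
  have mBB[measurable]: "BB R \<in> sets gseq" for R
  proof -
    have "{\<omega> \<in> space gseq. good \<omega> \<and> (\<Sum>j. cmod (\<omega> j) / 2 ^ j) \<le> real R} \<in> sets gseq" by measurable
    then show ?thesis by (simp add: BB_def)
  qed
  have "(\<Union>R. BB R) = {\<omega>. good \<omega>}" by (auto simp: BB_def intro: real_arch_simple)
  moreover have "measure gseq {\<omega>. good \<omega>} = 1"
  proof -
    have "{\<omega> \<in> space gseq. good \<omega>} \<in> sets gseq" by measurable
    from gseq.prob_Collect_eq_1[OF this] show ?thesis using AE_good by simp
  qed
  ultimately have "measure gseq (\<Union>R. BB R) \<noteq> 0" by simp
  moreover have "measure gseq (\<Union>R. BB R) = 0" if "\<And>R. measure gseq (BB R) = 0"
  proof -
    have "BB R \<in> null_sets gseq" for R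
      using that by (intro null_setsI mBB) (simp add: gseq.emeasure_eq_measure)
    then have "(\<Union>R. BB R) \<in> null_sets gseq" by (rule null_sets_UN)
    then show ?thesis by (rule measure_eq_0_null_sets)
  qed
  ultimately obtain R where R: "measure gseq (BB R) \<noteq> 0" by blast
  obtain M where M: "real R * 4 / e < 2 ^ M" using real_arch_pow[of 2 "real R * 4 / e"] by auto
  define N' where "N' = max N M"
  define c' where "c' j = (if j < N then c j else 0)" for j
  have lin': "lin N c = lin N' c'" unfolding c'_def N'_def by (rule lin_extend) simp
  \<comment> \<open>Radius e/7 makes the error of the initial coordinates at most 2e/7, and e/4 +
    2e/7 + e/4 < e.\<close>
  define E where "E = {\<omega>. \<forall>j\<in>{..<N'}. \<omega> j \<in> ball (c' j) (e / 7)}"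
  have mE[measurable]: "E \<in> sets cseq"
  proof -
    have "{\<omega> \<in> space cseq. \<forall>j\<in>{..<N'}. \<omega> j \<in> ball (c' j) (e / 7)} \<in> sets cseq"
      unfolding mem_ball by measurable
    then show ?thesis by (simp add: E_def space_PiM)
  qed
  have PE: "measure gseq E > 0"
  proof -
    interpret PP: product_prob_space "\<lambda>_::nat. cgauss 1" UNIV
      by (intro product_prob_spaceI prob_space_cgauss_1)
    have "emeasure gseq E = (\<Prod>j<N'. emeasure (cgauss 1) (ball (c' j) (e / 7)))"
      using PP.emeasure_PiM_Collect[of "{..<N'}" "\<lambda>j. ball (c' j) (e / 7)"]
      by (simp add: E_def gseq_def space_PiM)
    also have "\<dots> = ennreal (\<Prod>j<N'. measure (cgauss 1) (ball (c' j) (e / 7)))"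
      by (simp add: PP.M.emeasure_eq_measure prod_ennreal)
    finally have "measure gseq E = (\<Prod>j<N'. measure (cgauss 1) (ball (c' j) (e / 7)))"
      by (simp add: measure_def prod_nonneg)
    also have "\<dots> > 0" using e by (intro prod_pos) (auto intro: cgauss_ball_pos)
    finally show ?thesis .
  qed
  define W where "W = {\<omega>. \<omega> \<in> E \<and> (\<lambda>j. \<omega> (j + N')) \<in> BB R}"
  have msh: "(\<lambda>\<omega> j. \<omega> (j + N')) \<in> gseq \<rightarrow>\<^sub>M cseq"
    by (rule measurable_cseqI) simp
  have mW: "W \<in> sets gseq"
  proof -
    have "W = E \<inter> ((\<lambda>\<omega> j. \<omega> (j + N')) -` BB R \<inter> space gseq)" by (auto simp: W_def)
    moreover have "(\<lambda>\<omega> j. \<omega> (j + N')) -` BB R \<inter> space gseq \<in> sets gseq"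
      by (rule measurable_sets[OF msh]) (use mBB in simp)
    ultimately show ?thesis using mE by auto
  qed
  have "measure gseq W = (LINT \<omega>|gseq. indicator E \<omega> * indicator (BB R) (\<lambda>j. \<omega> (j + N')))"
  proof -
    have "measure gseq W = (LINT \<omega>|gseq. indicator W \<omega>)" using mW by simp
    also have "\<dots> = (LINT \<omega>|gseq. indicator E \<omega> * indicator (BB R) (\<lambda>j. \<omega> (j + N')))"
      by (intro Bochner_Integration.integral_cong) (auto simp: W_def indicator_def)
    finally show ?thesis .
  qed
  also have "\<dots> = (LINT \<omega>|gseq. indicator E \<omega>) * (LINT \<omega>|gseq. indicator (BB R) \<omega>)"
  proof (rule gseq_split_integral)
    show "(indicator (BB R) :: _ \<Rightarrow> real) \<in> borel_measurable cseq" using mBB by simp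
    show "indicator E x = (indicator E y :: real)" if "\<And>j. j < N' \<Longrightarrow> x j = y j" for x y
      using that by (auto simp: E_def indicator_def)
  qed (auto simp: indicator_def)
  also have "\<dots> = measure gseq E * measure gseq (BB R)" using mE mBB by simp
  also have "\<dots> > 0" using PE R by (simp add: zero_less_measure_iff)
  finally have PW: "measure gseq W > 0" .
  have "\<Phi> \<omega> \<in> U" if w: "\<omega> \<in> W" for \<omega>
  proof (rule e(2)[OF \<Phi>_in_XX])
    have gs: "summable (\<lambda>j. cmod (\<omega> (j + N')) / 2 ^ j)" and le: "(\<Sum>j. cmod (\<omega> (j + N')) / 2 ^ j) \<le> real R"
      using w by (auto simp: W_def BB_def good_def)
    have tail: "(\<lambda>j. cmod (\<omega> (j + N')) / 2 ^ (j + N')) = (\<lambda>j. cmod (\<omega> (j + N')) / 2 ^ j / 2 ^ N')"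
      by (simp add: power_add)
    have "summable (\<lambda>j. cmod (\<omega> (j + N')) / 2 ^ (j + N'))"
      unfolding tail by (rule summable_divide[OF gs])
    then have g: "good \<omega>" unfolding good_def by (rule summable_iff_shift[THEN iffD1])
    have "norm (csum \<omega> - lin N' \<omega>) \<le> (\<Sum>j. cmod (\<omega> (j + N')) / 2 ^ (j + N'))"
      using g norm_csum_diff_lin by (simp add: good_def)
    also have "\<dots> = (\<Sum>j. cmod (\<omega> (j + N')) / 2 ^ j) / 2 ^ N'"
      unfolding tail by (rule suminf_divide[OF gs])
    also have "\<dots> \<le> real R / 2 ^ N'" using le by (intro divide_right_mono) auto
    also have "\<dots> \<le> real R / 2 ^ M" by (intro divide_left_mono) (auto simp: N'_def power_increasing)
    also have "\<dots> < e / 4" using M e by (simp add: field_simps)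
    finally have 1: "norm (csum \<omega> - lin N' \<omega>) < e / 4" .
    have "norm (lin N' \<omega> - lin N' c') \<le> (\<Sum>j<N'. cmod (\<omega> j - c' j) / 2 ^ j)" by (rule norm_lin_diff)
    also have "\<dots> \<le> (\<Sum>j<N'. (e / 7) / 2 ^ j)"
      using w by (intro sum_mono divide_right_mono) (auto simp: W_def E_def dist_norm norm_minus_commute less_imp_le)
    also have "\<dots> \<le> 2 * (e / 7)" using e by (intro geo_sum_le) auto
    finally have 2: "norm (lin N' \<omega> - lin N' c') \<le> 2 * (e / 7)" .
    have "dist (csum \<omega>) y0 \<le> dist (csum \<omega>) (lin N' \<omega>) + dist (lin N' \<omega>) (lin N' c') + dist (lin N' c') y0"
      using dist_triangle[of "csum \<omega>" y0 "lin N' \<omega>"] dist_triangle[of "lin N' \<omega>" y0 "lin N' c'"] by linarith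
    also have "\<dots> < e" using 1 2 Nc e unfolding lin' dist_norm by simp
    finally show "dist (\<Phi> \<omega>) y0 < e" using g by (simp add: \<Phi>_def)
  qed
  then have sub: "W \<subseteq> \<Phi> -` U \<inter> space gseq" by auto
  have Um: "U \<in> sets XB"
  proof -
    obtain V where "open V" "U = XX \<inter> V" using U(1) by (auto simp: openin_open)
    then show ?thesis by (auto simp: XB_def sets_restrict_space)
  qed
  have "measure gseq W \<le> measure gseq (\<Phi> -` U \<inter> space gseq)"
    by (rule gseq.finite_measure_mono[OF sub measurable_sets[OF measurable_\<Phi> Um]])
  also have "\<dots> = measure mm U" unfolding mm_def by (rule measure_distr[OF measurable_\<Phi> Um, symmetric])
  finally show "measure mm U > 0" using PW by linarith
qed

lemma wm_linear_dyn_system_mm: "wm_linear_dyn_system XX bshift mm"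
  unfolding wm_linear_dyn_system_def
  using sep_inf_banach_XX bounded_op_bshift gaussian_measure_mm non_degenerate_mm weakly_mixing_mm by blast

end

subsection \<open>Orthogonal polynomials of a random unimodular number\<close>

lemma cesaro_null_unshift:
  assumes "cesaro_null (\<lambda>n. u (n + k))" "\<And>n. 0 \<le> u n" "\<And>n. u n \<le> K"
  shows "cesaro_null u"
proof -
  have le: "(\<Sum>n<N. u n) / real N \<le> (real k * K) / real N + (\<Sum>n<N. u (n + k)) / real N" for N
  proof -
    have "(\<Sum>n<N. u n) \<le> (\<Sum>n\<in>{0..<N + k}. u n)" by (intro sum_mono2) (auto simp: assms)
    also have "\<dots> = (\<Sum>n\<in>{0..<k}. u n) + (\<Sum>n\<in>{k..<N + k}. u n)"
      by (simp add: sum.atLeastLessThan_concat)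
    also have "(\<Sum>n\<in>{0..<k}. u n) \<le> real (card {0..<k}) * K"
      by (intro sum_bounded_above) (auto simp: assms)
    also have "(\<Sum>n\<in>{k..<N + k}. u n) = (\<Sum>n<N. u (n + k))"
      using sum.shift_bounds_nat_ivl[of u 0 k N] by (simp add: atLeast0LessThan)
    finally show ?thesis by (simp add: divide_right_mono flip: add_divide_distrib)
  qed
  have "(\<lambda>N. (real k * K) / real N + (\<Sum>n<N. u (n + k)) / real N) \<longlonglongrightarrow> 0 + 0"
    using assms(1) unfolding cesaro_null_def by (intro tendsto_add lim_const_over_n)
  then have "(\<lambda>N. (real k * K) / real N + (\<Sum>n<N. u (n + k)) / real N) \<longlonglongrightarrow> 0" by simp
  then show ?thesis unfolding cesaro_null_def
    by (rule tendsto_sandwich[OF _ _ tendsto_const, rotated 2])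
       (auto intro!: always_eventually le divide_nonneg_nonneg sum_nonneg assms)
qed

lemma cesaro_null_mono:
  assumes "cesaro_null u" "\<And>n. 0 \<le> v n" "\<And>n. v n \<le> u n"
  shows "cesaro_null v"
  by (rule cesaro_null_approx) (use assms in \<open>auto intro!: exI[of _ u] intro: order_trans add_increasing2\<close>)

lemma mean_powers_tendsto:
  fixes w :: complex
  assumes "cmod w = 1"
  shows "(\<lambda>N. (\<Sum>n<N. w ^ n) / of_nat N) \<longlonglongrightarrow> (if w = 1 then 1 else 0)"
proof (cases "w = 1")
  case True
  have "eventually (\<lambda>N. (\<Sum>n<N. w ^ n) / of_nat N = 1) sequentially"
    using True by (auto intro!: eventually_sequentiallyI[of 1])
  then show ?thesis using True by (simp add: tendsto_eventually)
next
  case False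
  have "(\<lambda>N. (\<Sum>n<N. w ^ n) / of_nat N) \<longlonglongrightarrow> 0"
  proof (rule Lim_null_comparison[OF always_eventually])
    show "\<forall>N. cmod ((\<Sum>n<N. w ^ n) / of_nat N) \<le> (2 / cmod (w - 1)) / real N"
    proof
      fix N
      have "cmod (w ^ N - 1) \<le> cmod (w ^ N) + cmod 1" by (rule norm_triangle_ineq4)
      also have "\<dots> = 2" using assms by (simp add: norm_power)
      finally have "cmod (\<Sum>n<N. w ^ n) \<le> 2 / cmod (w - 1)"
        using False by (simp add: geometric_sum norm_divide divide_right_mono)
      then show "cmod ((\<Sum>n<N. w ^ n) / of_nat N) \<le> (2 / cmod (w - 1)) / real N"
        unfolding norm_divide norm_of_nat by (rule divide_right_mono) simp
    qed
    show "(\<lambda>N. (2 / cmod (w - 1)) / real N) \<longlonglongrightarrow> 0" by (rule lim_const_over_n)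
  qed
  then show ?thesis using False by simp
qed

lemma smult_sum_right: "smult c (\<Sum>i\<in>I. f i) = (\<Sum>i\<in>I. smult c (f i))"
  by (induction I rule: infinite_finite_induct) (auto simp: smult_add_right)

text \<open>The law of \<open>lam\<close> is the spectral measure of the process to be built; the
  last assumption concerns its Fourier coefficients.\<close>

locale unimodular_rv = prob_space M for M :: "'a measure" +
  fixes lam :: "'a \<Rightarrow> complex"
  assumes lam_meas[measurable]: "lam \<in> borel_measurable M"
    and lam_norm: "\<And>\<omega>. cmod (lam \<omega>) = 1"
    and lam_cesaro: "cesaro_null (\<lambda>n. cmod (LINT \<omega>|M. lam \<omega> ^ n))"
begin

lemma lam_cnj: "lam \<omega> * cnj (lam \<omega>) = 1"
  using complex_norm_square[of "lam \<omega>"] lam_norm by simp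

text \<open>Wiener's lemma: the Cesaro means of the powers of lam * cnj \<zeta> converge boundedly
  to the indicator of lam = \<zeta>, while their expectations tend to 0 by
  \<open>lam_cesaro\<close>.\<close>

lemma no_atoms: "AE \<omega> in M. lam \<omega> \<noteq> \<zeta>"
proof (cases "cmod \<zeta> = 1")
  case False
  then show ?thesis using lam_norm by (intro AE_I2) auto
next
  case True
  define w where "w \<omega> = lam \<omega> * cnj \<zeta>" for \<omega>
  have [measurable]: "w \<in> borel_measurable M" unfolding w_def by measurable
  have wn: "cmod (w \<omega>) = 1" for \<omega> using lam_norm True by (simp add: w_def norm_mult)
  have w1: "w \<omega> = 1 \<longleftrightarrow> lam \<omega> = \<zeta>" for \<omega>
  proof -
    have z: "\<zeta> * cnj \<zeta> = 1" using complex_norm_square[of \<zeta>] True by simp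
    then have "cnj \<zeta> \<noteq> 0" by auto
    then show ?thesis unfolding w_def using z by (metis mult_cancel_right)
  qed
  have wi: "integrable M (\<lambda>\<omega>. w \<omega> ^ n)" for n
    by (rule integrable_const_bound[of _ 1]) (auto simp: norm_power wn)
  have 1: "(\<lambda>N. LINT \<omega>|M. (\<Sum>n<N. w \<omega> ^ n) / of_nat N) \<longlonglongrightarrow> (LINT \<omega>|M. (if w \<omega> = 1 then 1 else 0))"
  proof (rule integral_dominated_convergence[where w="\<lambda>_. 1"])
    show "AE \<omega> in M. (\<lambda>N. (\<Sum>n<N. w \<omega> ^ n) / of_nat N) \<longlonglongrightarrow> (if w \<omega> = 1 then 1 else 0)"
      by (intro AE_I2 mean_powers_tendsto wn)
    show "AE \<omega> in M. cmod ((\<Sum>n<N. w \<omega> ^ n) / of_nat N) \<le> 1" for N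
    proof (rule AE_I2)
      fix \<omega>
      have "cmod (\<Sum>n<N. w \<omega> ^ n) \<le> (\<Sum>n<N. cmod (w \<omega> ^ n))" by (rule norm_sum)
      also have "\<dots> = real N" by (simp add: norm_power wn)
      finally show "cmod ((\<Sum>n<N. w \<omega> ^ n) / of_nat N) \<le> 1" by (cases "N = 0") (auto simp: norm_divide divide_le_eq_1)
    qed
  qed auto
  have 2: "(\<lambda>N. LINT \<omega>|M. (\<Sum>n<N. w \<omega> ^ n) / of_nat N) \<longlonglongrightarrow> 0"
  proof (rule Lim_null_comparison[OF always_eventually])
    show "\<forall>N. cmod (LINT \<omega>|M. (\<Sum>n<N. w \<omega> ^ n) / of_nat N) \<le> (\<Sum>n<N. cmod (LINT \<omega>|M. lam \<omega> ^ n)) / real N"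
    proof
      fix N
      have "(LINT \<omega>|M. (\<Sum>n<N. w \<omega> ^ n) / of_nat N) = (\<Sum>n<N. (LINT \<omega>|M. w \<omega> ^ n)) / of_nat N"
        using wi by simp
      also have "cmod \<dots> = cmod (\<Sum>n<N. (LINT \<omega>|M. w \<omega> ^ n)) / real N" by (simp add: norm_divide)
      also have "\<dots> \<le> (\<Sum>n<N. cmod (LINT \<omega>|M. w \<omega> ^ n)) / real N" by (intro divide_right_mono norm_sum) simp
      also have "(\<lambda>n. cmod (LINT \<omega>|M. w \<omega> ^ n)) = (\<lambda>n. cmod (LINT \<omega>|M. lam \<omega> ^ n))"
        using True by (simp add: w_def power_mult_distrib norm_mult norm_power)
      finally show "cmod (LINT \<omega>|M. (\<Sum>n<N. w \<omega> ^ n) / of_nat N) \<le> (\<Sum>n<N. cmod (LINT \<omega>|M. lam \<omega> ^ n)) / real N" .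
    qed
  qed (use lam_cesaro in \<open>simp add: cesaro_null_def\<close>)
  have "(LINT \<omega>|M. (if w \<omega> = 1 then 1 else 0 :: complex)) = 0" by (rule LIMSEQ_unique[OF 1 2])
  moreover have "(\<lambda>\<omega>. if w \<omega> = 1 then 1 else 0 :: complex) = (\<lambda>\<omega>. of_real (if w \<omega> = 1 then 1 else 0))" by auto
  ultimately have "(LINT \<omega>|M. (if w \<omega> = 1 then 1 else 0 :: real)) = 0"
    by (simp only: integral_complex_of_real of_real_eq_0_iff)
  then have "AE \<omega> in M. (if w \<omega> = 1 then 1 else 0 :: real) = 0"
    by (subst (asm) integral_nonneg_eq_0_iff_AE) (auto intro!: integrable_const_bound[of _ 1])
  then show ?thesis by eventually_elim (auto simp: w1 split: if_splits)
qed

section \<open>The inner product on polynomials and Gram-Schmidt\<close>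

definition ip :: "complex poly \<Rightarrow> complex poly \<Rightarrow> complex" where
  "ip p q = (LINT \<omega>|M. poly p (lam \<omega>) * cnj (poly q (lam \<omega>)))"

lemma poly_lam_meas[measurable]: "(\<lambda>\<omega>. poly p (lam \<omega>)) \<in> borel_measurable M"
  by (induction p) auto

lemma cnj_poly_lam_meas[measurable]: "(\<lambda>\<omega>. cnj (poly p (lam \<omega>))) \<in> borel_measurable M"
  by (rule measurable_compose[OF poly_lam_meas]) (intro borel_measurable_continuous_onI continuous_intros)

lemma poly_lam_bound: "\<exists>K. \<forall>\<omega>. cmod (poly p (lam \<omega>)) \<le> K"
proof (induction p)
  case (pCons c p)
  then obtain K where K: "\<And>\<omega>. cmod (poly p (lam \<omega>)) \<le> K" by blast
  have "cmod (poly (pCons c p) (lam \<omega>)) \<le> cmod c + K" for \<omega>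
  proof -
    have "cmod (poly (pCons c p) (lam \<omega>)) \<le> cmod c + cmod (lam \<omega> * poly p (lam \<omega>))"
      by (simp add: norm_triangle_ineq)
    then show ?thesis using K[of \<omega>] by (simp add: norm_mult lam_norm)
  qed
  then show ?case by blast
qed auto

lemma ip_int[simp]: "integrable M (\<lambda>\<omega>. poly p (lam \<omega>) * cnj (poly q (lam \<omega>)))"
proof -
  obtain K L where K: "\<And>\<omega>. cmod (poly p (lam \<omega>)) \<le> K" and L: "\<And>\<omega>. cmod (poly q (lam \<omega>)) \<le> L"
    using poly_lam_bound by metis
  show ?thesis
    by (rule integrable_const_bound[of _ "K * L"])
       (auto simp: norm_mult intro!: mult_mono K L order_trans[OF norm_ge_zero K] AE_I2)
qed

lemma ip_add_left: "ip (p + p') q = ip p q + ip p' q"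
  unfolding ip_def by (simp add: distrib_right)

lemma ip_smult_left: "ip (smult c p) q = c * ip p q"
  unfolding ip_def by (simp add: mult.assoc)

lemma ip_0_left: "ip 0 q = 0" by (simp add: ip_def)

lemma ip_sum_left: "ip (\<Sum>i\<in>I. p i) q = (\<Sum>i\<in>I. ip (p i) q)"
  by (induction I rule: infinite_finite_induct) (auto simp: ip_0_left ip_add_left)

lemma ip_diff_left: "ip (p - p') q = ip p q - ip p' q"
  unfolding ip_def by (simp add: left_diff_distrib)

lemma ip_cnj: "cnj (ip p q) = ip q p"
  unfolding ip_def by (subst Bochner_Integration.integral_cnj[symmetric]) (simp add: mult.commute)

lemma ip_smult_right: "ip p (smult c q) = cnj c * ip p q"
  using ip_smult_left[of c q p] ip_cnj by (metis complex_cnj_mult)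

lemma ip_sum_right: "ip q (\<Sum>i\<in>I. p i) = (\<Sum>i\<in>I. ip q (p i))"
  using arg_cong[OF ip_sum_left[of p I q], of cnj] by (simp add: ip_cnj)

lemma ip_self: "ip p p = of_real (LINT \<omega>|M. (cmod (poly p (lam \<omega>)))\<^sup>2)"
  unfolding ip_def integral_complex_of_real[symmetric]
  by (simp only: complex_norm_square)

lemma int_sq: "integrable M (\<lambda>\<omega>. (cmod (poly p (lam \<omega>)))\<^sup>2)"
proof -
  have "integrable M (\<lambda>\<omega>. Re (poly p (lam \<omega>) * cnj (poly p (lam \<omega>))))" by (rule integrable_Re) (rule ip_int)
  then show ?thesis by (simp only: complex_norm_square[symmetric] Re_complex_of_real)
qed

text \<open>A nonzero polynomial has finitely many roots, each avoided almost surely. The powers of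
  \<open>lam\<close> are thus linearly independent in L^2.\<close>

lemma ip_pos:
  assumes "p \<noteq> 0"
  shows "Re (ip p p) > 0"
proof -
  have "Re (ip p p) \<ge> 0" by (simp add: ip_self)
  moreover have "Re (ip p p) \<noteq> 0"
  proof
    assume "Re (ip p p) = 0"
    then have "(LINT \<omega>|M. (cmod (poly p (lam \<omega>)))\<^sup>2) = 0" by (simp add: ip_self)
    then have z: "AE \<omega> in M. poly p (lam \<omega>) = 0"
      by (subst (asm) integral_nonneg_eq_0_iff_AE) (auto simp: int_sq)
    have fin: "finite {z. poly p z = 0}" by (rule poly_roots_finite[OF assms])
    have "AE \<omega> in M. \<forall>z\<in>{z. poly p z = 0}. lam \<omega> \<noteq> z"
      by (intro AE_finite_allI fin no_atoms)
    with z have "AE \<omega> in M. False" by eventually_elim auto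
    then show False by simp
  qed
  ultimately show ?thesis by simp
qed

context
  notes [fundef_cong] = sum.cong
begin

text \<open>Gram-Schmidt on the monomials: monic orthogonal polynomials for the law of
  \<open>lam\<close>. The congruence rule for sums exposes j < n to the termination proof.\<close>

fun u :: "nat \<Rightarrow> complex poly" where
  "u n = monom 1 n - (\<Sum>j<n. smult (ip (monom 1 n) (u j) / ip (u j) (u j)) (u j))"

end

declare u.simps[simp del]

lemma degree_u: "degree (u n) \<le> n"
proof (induction n rule: less_induct)
  case (less n)
  have "degree (\<Sum>j<n. smult (ip (monom 1 n) (u j) / ip (u j) (u j)) (u j)) \<le> n"
    by (rule degree_sum_le) (use less in \<open>auto intro: order_trans[OF degree_smult_le] less_imp_le order_trans\<close>)
  then show ?case unfolding u.simps[of n]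
    by (intro degree_diff_le) (auto simp: degree_monom_le)
qed

lemma u_nz: "u n \<noteq> 0"
proof -
  have "coeff (u n) n = 1"
  proof -
    have "coeff (u j) n = 0" if "j < n" for j using degree_u[of j] that by (intro coeff_eq_0) simp
    then show ?thesis unfolding u.simps[of n] by (simp add: coeff_sum)
  qed
  then show ?thesis by auto
qed

lemma ip_u_nz: "ip (u n) (u n) \<noteq> 0"
  using ip_pos[OF u_nz, of n] by auto

lemma u_orth_less: "k < n \<Longrightarrow> ip (u n) (u k) = 0"
proof (induction n arbitrary: k rule: less_induct)
  case (less n)
  have o: "ip (u j) (u k) = 0" if "j < n" "j \<noteq> k" for j
  proof (cases "k < j")
    case True
    then show ?thesis using less that by auto
  next
    case False
    then have "ip (u k) (u j) = 0" using less that by auto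
    then show ?thesis using ip_cnj[of "u k" "u j"] by simp
  qed
  have "(\<Sum>j<n. ip (monom 1 n) (u j) / ip (u j) (u j) * ip (u j) (u k)) = (\<Sum>j\<in>{k}. ip (monom 1 n) (u j) / ip (u j) (u j) * ip (u j) (u k))"
    using less.prems by (intro sum.mono_neutral_right) (auto simp: o)
  also have "\<dots> = ip (monom 1 n) (u k)" using ip_u_nz by simp
  finally show ?case unfolding u.simps[of n] by (simp add: ip_diff_left ip_sum_left ip_smult_left)
qed

lemma u_orth: "n \<noteq> k \<Longrightarrow> ip (u n) (u k) = 0"
  using u_orth_less[of k n] u_orth_less[of n k] ip_cnj[of "u k" "u n"] by (cases "k < n") auto

definition nu :: "nat \<Rightarrow> real" where
  "nu n = sqrt (Re (ip (u n) (u n)))"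

lemma nu_pos: "nu n > 0"
  using ip_pos[OF u_nz] by (simp add: nu_def)

lemma ip_u_self: "ip (u n) (u n) = of_real ((nu n)\<^sup>2)"
  using ip_pos[OF u_nz, of n] ip_self[of "u n"] by (simp add: nu_def)

definition e :: "nat \<Rightarrow> complex poly" where
  "e n = smult (1 / of_real (nu n)) (u n)"

lemma e_orth: "ip (e i) (e j) = (if i = j then 1 else 0)"
  using nu_pos[of i] by (auto simp: e_def ip_smult_left ip_smult_right u_orth ip_u_self power2_eq_square)

definition a :: "nat \<Rightarrow> nat \<Rightarrow> complex" where
  "a n j = ip (monom 1 n) (e j)"

text \<open>Matrix of multiplication by \<open>lam\<close> in the basis \<open>e\<close>, since
  \<open>pCons 0\<close> multiplies a polynomial by its variable.\<close>

definition b :: "nat \<Rightarrow> nat \<Rightarrow> complex" where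
  "b i j = ip (pCons 0 (e i)) (e j)"

lemma parseval: "ip (\<Sum>j<D. smult (c j) (e j)) (\<Sum>j<D. smult (d j) (e j)) = (\<Sum>j<D. c j * cnj (d j))"
  by (simp add: ip_sum_left ip_sum_right ip_smult_left ip_smult_right e_orth if_distrib cong: if_cong)
     (simp add: mult.commute)

lemma monom_expand: "monom 1 n = (\<Sum>j<Suc n. smult (a n j) (e j))"
proof -
  have t: "smult (a n j) (e j) = smult (ip (monom 1 n) (u j) / ip (u j) (u j)) (u j)" for j
    by (simp add: a_def e_def ip_smult_right ip_u_self power2_eq_square)
  have "u n = monom 1 n - (\<Sum>j<n. smult (ip (monom 1 n) (u j) / ip (u j) (u j)) (u j))" by (rule u.simps)
  then have m: "monom 1 n = u n + (\<Sum>j<n. smult (ip (monom 1 n) (u j) / ip (u j) (u j)) (u j))"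
    by (simp add: algebra_simps)
  then have "ip (monom 1 n) (u n) = ip (u n + (\<Sum>j<n. smult (ip (monom 1 n) (u j) / ip (u j) (u j)) (u j))) (u n)" by simp
  also have "\<dots> = ip (u n) (u n)"
    by (simp add: ip_add_left ip_sum_left ip_smult_left u_orth)
  finally have "smult (a n n) (e n) = u n" using t[of n] ip_u_nz by simp
  then show ?thesis using m by (simp add: t add.commute)
qed

lemma a_tri: "n < j \<Longrightarrow> a n j = 0"
proof -
  assume "n < j"
  have "a n j = ip (\<Sum>i<Suc n. smult (a n i) (e i)) (e j)" unfolding a_def[of n j] by (subst monom_expand) simp
  also have "\<dots> = 0" using \<open>n < j\<close> by (simp add: ip_sum_left ip_smult_left e_orth del: sum.lessThan_Suc)
  finally show ?thesis .
qed

lemma monom_expand_ge: "n < D \<Longrightarrow> monom 1 n = (\<Sum>j<D. smult (a n j) (e j))"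
  by (subst monom_expand) (rule sum.mono_neutral_left, auto simp: a_tri)

lemma gram_a:
  assumes "n < D" "m < D"
  shows "(\<Sum>j<D. a n j * cnj (a m j)) = ip (monom 1 n) (monom 1 m)"
  using parseval[of "a n" D "a m"] monom_expand_ge[OF assms(1)] monom_expand_ge[OF assms(2)] by simp

lemma ip_monom: "ip (monom 1 n) (monom 1 m) = (LINT \<omega>|M. lam \<omega> ^ n * cnj (lam \<omega>) ^ m)"
  by (simp add: ip_def poly_monom)

text \<open>Turns the Gaussian scale of a difference of two process values into an L^2 distance
  between powers of \<open>lam\<close>, which the digit estimates control.\<close>

lemma gram_a_combination:
  assumes "n < D" "m < D"
  shows "(\<Sum>j<D. (cmod (a n j - c * a m j))\<^sup>2) = (LINT \<omega>|M. (cmod (lam \<omega> ^ n - c * lam \<omega> ^ m))\<^sup>2)"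
proof -
  let ?p = "\<Sum>j<D. smult (a n j - c * a m j) (e j)"
  have "?p = monom 1 n - smult c (monom 1 m)"
    unfolding monom_expand_ge[OF assms(1)] monom_expand_ge[OF assms(2)]
    by (simp add: smult_diff_left sum_subtractf smult_sum_right)
  then have p: "poly ?p z = z ^ n - c * z ^ m" for z by (simp add: poly_monom)
  have "of_real (\<Sum>j<D. (cmod (a n j - c * a m j))\<^sup>2) = ip ?p ?p"
    unfolding parseval by (simp only: of_real_sum complex_norm_square)
  also have "\<dots> = of_real (LINT \<omega>|M. (cmod (lam \<omega> ^ n - c * lam \<omega> ^ m))\<^sup>2)"
    unfolding ip_self p ..
  finally show ?thesis by (simp only: of_real_eq_iff)
qed

text \<open>With both norms equal to 1, the arithmetic-geometric mean inequality suffices. Comparing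
  only moduli allows p = pCons 0 p', as \<open>lam\<close> is unimodular.\<close>

lemma ip_cauchy_schwarz_1:
  assumes "\<And>\<omega>. cmod (poly p (lam \<omega>)) = cmod (poly p' (lam \<omega>))" "ip p' p' = 1" "ip q q = 1"
  shows "cmod (ip p q) \<le> 1"
proof -
  have 1: "(LINT \<omega>|M. (cmod (poly p (lam \<omega>)))\<^sup>2) = 1" using assms(2) unfolding ip_self assms(1) by simp
  have 2: "(LINT \<omega>|M. (cmod (poly q (lam \<omega>)))\<^sup>2) = 1" using assms(3) unfolding ip_self by simp
  have "cmod (ip p q) \<le> (LINT \<omega>|M. cmod (poly p (lam \<omega>) * cnj (poly q (lam \<omega>))))"
    unfolding ip_def by (rule integral_norm_bound)
  also have "\<dots> \<le> (LINT \<omega>|M. ((cmod (poly p (lam \<omega>)))\<^sup>2 + (cmod (poly q (lam \<omega>)))\<^sup>2) / 2)"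
  proof (rule integral_mono)
    show "integrable M (\<lambda>\<omega>. cmod (poly p (lam \<omega>) * cnj (poly q (lam \<omega>))))" by (rule integrable_norm) (rule ip_int)
    show "integrable M (\<lambda>\<omega>. ((cmod (poly p (lam \<omega>)))\<^sup>2 + (cmod (poly q (lam \<omega>)))\<^sup>2) / 2)"
      by (intro integrable_divide Bochner_Integration.integrable_add int_sq)
    show "cmod (poly p (lam \<omega>) * cnj (poly q (lam \<omega>))) \<le> ((cmod (poly p (lam \<omega>)))\<^sup>2 + (cmod (poly q (lam \<omega>)))\<^sup>2) / 2" for \<omega>
      using sum_squares_bound[of "cmod (poly p (lam \<omega>))" "cmod (poly q (lam \<omega>))"] by (simp add: norm_mult)
  qed
  also have "\<dots> = 1" using 1 2 int_sq by simp
  finally show ?thesis .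
qed

lemma ip_monom_cesaro: "cesaro_null (\<lambda>n. cmod (ip (monom 1 n) (monom 1 k)))"
proof (rule cesaro_null_unshift[of _ k 1])
  have "ip (monom 1 (n + k)) (monom 1 k) = (LINT \<omega>|M. lam \<omega> ^ n)" for n
  proof -
    have "lam \<omega> ^ (n + k) * cnj (lam \<omega>) ^ k = lam \<omega> ^ n" for \<omega>
      using lam_cnj[of \<omega>] by (simp add: power_add mult.assoc flip: power_mult_distrib)
    then show ?thesis by (simp add: ip_monom)
  qed
  then show "cesaro_null (\<lambda>n. cmod (ip (monom 1 (n + k)) (monom 1 k)))" using lam_cesaro by simp
  have "ip (monom 1 n) (monom 1 n) = 1" for n
    unfolding ip_self by (simp add: poly_monom norm_power lam_norm prob_space)
  then show "cmod (ip (monom 1 n) (monom 1 k)) \<le> 1" for n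
    by (intro ip_cauchy_schwarz_1[of _ "monom 1 n"]) auto
qed simp

sublocale gaussian_shift a b
proof
  show "a n j = 0" if "n < j" for n j using that by (rule a_tri)
  show "(\<Sum>j<Suc (Suc (max n m)). a (Suc n) j * cnj (a (Suc m) j)) = (\<Sum>j<Suc (max n m). a n j * cnj (a m j))" for n m
  proof -
    have "lam \<omega> ^ Suc n * cnj (lam \<omega>) ^ Suc m = lam \<omega> ^ n * cnj (lam \<omega>) ^ m" for \<omega>
    proof -
      have "lam \<omega> ^ Suc n * cnj (lam \<omega>) ^ Suc m = (lam \<omega> * cnj (lam \<omega>)) * (lam \<omega> ^ n * cnj (lam \<omega>) ^ m)" by simp
      then show ?thesis by (simp only: lam_cnj mult_1)
    qed
    then have "ip (monom 1 (Suc n)) (monom 1 (Suc m)) = ip (monom 1 n) (monom 1 m)" by (simp only: ip_monom)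
    then show ?thesis by (subst (1 2) gram_a) auto
  qed
  show "(\<Sum>j<Suc n. (cmod (a n j))\<^sup>2) = 1" for n
    using gram_a_combination[of n "Suc n" n 0] by (simp add: norm_power lam_norm prob_space)
  show "a n n \<noteq> 0" for n
  proof
    assume "a n n = 0"
    then have "monom 1 n = (\<Sum>j<n. smult (a n j) (e j))" using monom_expand[of n] by simp
    then have "coeff (monom 1 n :: complex poly) n = coeff (\<Sum>j<n. smult (a n j) (e j)) n" by simp
    moreover have "coeff (e j) n = 0" if "j < n" for j
      using degree_u[of j] that by (simp add: e_def coeff_eq_0)
    ultimately show False by (simp add: coeff_sum)
  qed
  \<comment> \<open>For fixed \<open>j\<close>, \<open>e j\<close> combines finitely many monomials,
    and the inner products with each of them are Cesaro-null.\<close>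
  show "cesaro_null (\<lambda>n. cmod (a n j))" for j
  proof (rule cesaro_null_mono)
    define p where "p = e j"
    show "cesaro_null (\<lambda>n. \<Sum>k\<le>degree p. cmod (coeff p k) * cmod (ip (monom 1 n) (monom 1 k)))"
      by (intro cesaro_null_sum cesaro_null_cmult ip_monom_cesaro)
    have "p = (\<Sum>k\<le>degree p. smult (coeff p k) (monom 1 k))"
      using poly_as_sum_of_monoms[of p] by (simp add: smult_monom)
    then have "ip (monom 1 n) p = (\<Sum>k\<le>degree p. cnj (coeff p k) * ip (monom 1 n) (monom 1 k))" for n
      by (metis (no_types, lifting) ip_sum_right ip_smult_right sum.cong)
    then show "cmod (a n j) \<le> (\<Sum>k\<le>degree p. cmod (coeff p k) * cmod (ip (monom 1 n) (monom 1 k)))" for n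
      unfolding a_def p_def[symmetric] by (auto intro!: order_trans[OF norm_sum] sum_mono simp: norm_mult)
  qed simp
  \<comment> \<open>The expansion of the monomial of degree \<open>n\<close> is multiplied by the
    variable and paired with \<open>e j\<close>.\<close>
  show "a (Suc n) j = (\<Sum>i<Suc n. a n i * b i j)" for n j
  proof -
    have "poly (monom 1 (Suc n)) z = poly (\<Sum>i<Suc n. smult (a n i) (pCons 0 (e i))) z" for z
      using arg_cong[OF monom_expand[of n], of "\<lambda>p. z * poly p z"]
      by (simp add: poly_monom poly_sum sum_distrib_left algebra_simps del: sum.lessThan_Suc)
    then have "monom 1 (Suc n) = (\<Sum>i<Suc n. smult (a n i) (pCons 0 (e i)))" by (simp add: poly_eq_poly_eq_iff[symmetric] fun_eq_iff)
    then show ?thesis unfolding a_def[of "Suc n"] b_def by (simp only: ip_sum_left ip_smult_left)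
  qed
  show "cmod (b i j) \<le> 1" for i j
    unfolding b_def by (rule ip_cauchy_schwarz_1[of _ "e i"]) (auto simp: norm_mult lam_norm e_orth)
qed

end

subsection \<open>Random rotation numbers with sparse digits\<close>

text \<open>The square is 4 sin^2 (y/2); one sine is bounded by 1, the other by |y/2|. A bound
  linear in \<open>y\<close> lets expectations of digit sums be taken term by term.\<close>

lemma cis_diff_1_le: "(cmod (cis y - 1))\<^sup>2 \<le> 2 * \<bar>y\<bar>"
proof -
  have "(cmod (cis y - 1))\<^sup>2 = (cos y - 1)\<^sup>2 + (sin y)\<^sup>2" by (simp add: cmod_power2)
  also have "\<dots> = 2 - 2 * cos y" using sin_cos_squared_add[of y] by (simp add: power2_eq_square algebra_simps)
  also have "\<dots> = 4 * (sin (y / 2))\<^sup>2" using cos_double_sin[of "y / 2"] by simp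
  also have "\<dots> = 4 * (\<bar>sin (y / 2)\<bar> * \<bar>sin (y / 2)\<bar>)" by (simp add: power2_eq_square)
  also have "\<dots> \<le> 4 * (1 * \<bar>y / 2\<bar>)"
    by (intro mult_left_mono mult_mono) (use abs_sin_x_le_abs_x[of "y / 2"] in auto)
  finally show ?thesis by simp
qed

lemma sum_cos_roots:
  assumes "q \<ge> 2"
  shows "(\<Sum>b<q. cos (x + 2 * pi * real b / real q)) = 0"
proof -
  define w where "w = cis (2 * pi / real q)"
  have "w ^ q = cis (real q * (2 * pi / real q))" unfolding w_def by (rule Complex.DeMoivre)
  also have "\<dots> = 1" using assms by (simp add: complex_eq_iff)
  finally have wq: "w ^ q = 1" .
  have w1: "w \<noteq> 1"
  proof
    assume "w = 1"
    then have "cos (2 * pi / real q) = 1" by (simp add: w_def complex_eq_iff)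
    moreover have "cos (2 * pi / real q) < cos 0"
      using assms pi_gt_zero by (intro cos_monotone_0_pi) (auto simp: field_simps)
    ultimately show False by simp
  qed
  have "cis (x + 2 * pi * real b / real q) = cis x * w ^ b" for b
    unfolding w_def Complex.DeMoivre cis_mult by (simp add: mult.commute)
  then have "(\<Sum>b<q. cis (x + 2 * pi * real b / real q)) = cis x * (\<Sum>b<q. w ^ b)"
    by (simp add: sum_distrib_left)
  also have "\<dots> = 0" using w1 wq by (simp add: geometric_sum)
  finally have "Re (\<Sum>b<q. cis (x + 2 * pi * real b / real q)) = 0" by simp
  then show ?thesis by simp
qed

lemma sum_periodic:
  fixes f :: "nat \<Rightarrow> real"
  assumes "\<And>n. f (n + L) = f n"
  shows "(\<Sum>n<L * k. f n) = real k * (\<Sum>n<L. f n)"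
proof -
  have per: "f (n + L * k) = f n" for n k
  proof (induction k)
    case (Suc k)
    have "f (n + L * Suc k) = f ((n + L * k) + L)" by (simp add: algebra_simps)
    then show ?case using assms Suc by simp
  qed simp
  show ?thesis
  proof (induction k)
    case (Suc k)
    have "(\<Sum>n<L * Suc k. f n) = (\<Sum>n<L * k. f n) + (\<Sum>n\<in>{L * k..<L * k + L}. f n)"
      using sum.atLeastLessThan_concat[of 0 "L * k" "L * k + L" f]
      by (simp add: atLeast0LessThan algebra_simps)
    also have "(\<Sum>n\<in>{L * k..<L * k + L}. f n) = (\<Sum>n<L. f (n + L * k))"
      using sum.shift_bounds_nat_ivl[of f 0 "L * k" L] by (simp add: atLeast0LessThan algebra_simps)
    finally show ?case using Suc by (simp add: per algebra_simps)
  qed simp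
qed

lemma sum_grid:
  fixes g :: "nat \<Rightarrow> real"
  shows "(\<Sum>n<L * q. g n) = (\<Sum>m<L. \<Sum>b<q. g (m + L * b))"
proof (induction q)
  case (Suc q)
  have "(\<Sum>n<L * Suc q. g n) = (\<Sum>n<L * q. g n) + (\<Sum>n\<in>{L * q..<L * q + L}. g n)"
    using sum.atLeastLessThan_concat[of 0 "L * q" "L * q + L" g]
    by (simp add: atLeast0LessThan algebra_simps)
  also have "(\<Sum>n\<in>{L * q..<L * q + L}. g n) = (\<Sum>n<L. g (n + L * q))"
    using sum.shift_bounds_nat_ivl[of g 0 "L * q" L] by (simp add: atLeast0LessThan algebra_simps)
  finally show ?case using Suc by (simp add: sum.distrib)
qed simp

text \<open>\<open>N\<close> will be the given sequence without its first term, since divisibility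
  starts only at index 1. The bound 2 \<le> N 0 makes the quotients used in the period argument at
  least 2 from the first digit on.\<close>

locale sparse_digits =
  fixes N :: "nat \<Rightarrow> nat" and \<theta> c :: real
  assumes N0: "2 \<le> N 0" and N_dvd: "\<And>i. N i dvd N (Suc i)" and N_less: "\<And>i. N i < N (Suc i)"
    and c: "0 < c" "c \<le> 1/2"
begin

lemma N_pos: "N i > 0"
  using N0 N_less by (induction i) (auto intro: less_trans)

lemma N_dvd_le: "i \<le> j \<Longrightarrow> N i dvd N j"
  by (induction j rule: dec_induct) (auto intro: dvd_trans N_dvd)

lemma N_double: "2 * N i \<le> N (Suc i)"
proof -
  obtain q where q: "N (Suc i) = N i * q" using N_dvd by (auto elim: dvdE)
  then have "q \<noteq> 0" "q \<noteq> 1" using N_less[of i] by auto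
  then have "q \<ge> 2" by simp
  then show ?thesis using q by simp
qed

lemma N_ratio: "real (N j) / real (N (j + k)) \<le> (1/2) ^ k"
proof (induction k)
  case 0
  then show ?case using N_pos by simp
next
  case (Suc k)
  have "real (N j) / real (N (j + Suc k)) \<le> real (N j) / (2 * real (N (j + k)))"
    using N_double[of "j + k"] N_pos by (intro divide_left_mono) (auto simp flip: of_nat_mult)
  also have "\<dots> = (real (N j) / real (N (j + k))) / 2" by simp
  also have "\<dots> \<le> (1/2) ^ k / 2" using Suc by (intro divide_right_mono) auto
  finally show ?case by simp
qed

lemma inverse_N_le: "1 / real (N i) \<le> (1/2) ^ Suc i"
proof -
  have "1 / real (N i) = (1 / real (N 0)) * (real (N 0) / real (N (0 + i)))" using N_pos[of 0] by simp
  also have "\<dots> \<le> (1/2) * (1/2) ^ i"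
    using N0 N_ratio[of 0 i] by (intro mult_mono) (auto simp: field_simps)
  finally show ?thesis by simp
qed

definition p :: "nat \<Rightarrow> real" where
  "p i = c / (real i + 1)"

lemma p_pos: "0 < p i" and p_le: "p i \<le> 1/2"
proof -
  show "0 < p i" using c by (simp add: p_def)
  have "c / (real i + 1) \<le> c / 1" using c by (intro divide_left_mono) auto
  then show "p i \<le> 1/2" using c by (simp add: p_def)
qed

lemma p01: "0 \<le> p i" "p i \<le> 1"
  using p_pos[of i] p_le[of i] by auto

lemma p_antimono: "i \<le> j \<Longrightarrow> p j \<le> p i"
  unfolding p_def using c by (intro divide_left_mono) auto

section \<open>Independent digits and the random rotation\<close>

definition B :: "(nat \<Rightarrow> bool) measure" where
  "B = PiM UNIV (\<lambda>i. measure_pmf (bernoulli_pmf (p i)))"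

lemma prob_B: "prob_space B"
  unfolding B_def by (intro prob_space_PiM prob_space_measure_pmf)

interpretation B: prob_space B by (rule prob_B)

lemma digit_meas[measurable]: "(\<lambda>\<omega>. \<omega> i) \<in> B \<rightarrow>\<^sub>M count_space UNIV"
proof -
  have "(\<lambda>\<omega>. \<omega> i) \<in> B \<rightarrow>\<^sub>M measure_pmf (bernoulli_pmf (p i))"
    unfolding B_def by (rule measurable_component_singleton) simp
  then show ?thesis by (simp add: measurable_cong_sets[OF refl sets_measure_pmf_count_space])
qed

lemma digit_fun_meas: "(\<lambda>\<omega>. f (\<omega> i)) \<in> borel_measurable B"
  by (rule measurable_compose[OF digit_meas]) simp

lemma digit_integral:
  fixes f :: "bool \<Rightarrow> 'b :: {banach, second_countable_topology}"
  shows "(LINT \<omega>|B. f (\<omega> i)) = p i *\<^sub>R f True + (1 - p i) *\<^sub>R f False"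
proof -
  have "distr B (measure_pmf (bernoulli_pmf (p i))) (\<lambda>\<omega>. \<omega> i) = measure_pmf (bernoulli_pmf (p i))"
    unfolding B_def by (rule distr_PiM_component) (auto intro: prob_space_measure_pmf)
  then have "(LINT x|measure_pmf (bernoulli_pmf (p i)). f x) = (LINT x|distr B (measure_pmf (bernoulli_pmf (p i))) (\<lambda>\<omega>. \<omega> i). f x)"
    by simp
  also have "\<dots> = (LINT \<omega>|B. f (\<omega> i))"
    by (rule integral_distr) (use digit_meas in \<open>auto simp: measurable_cong_sets[OF refl sets_measure_pmf_count_space]\<close>)
  finally have "(LINT \<omega>|B. f (\<omega> i)) = (LINT x|measure_pmf (bernoulli_pmf (p i)). f x)" ..
  also have "\<dots> = p i *\<^sub>R f True + (1 - p i) *\<^sub>R f False"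
    by (subst integral_measure_pmf[of UNIV]) (auto simp: UNIV_bool p01)
  finally show ?thesis .
qed

definition \<xi> :: "(nat \<Rightarrow> bool) \<Rightarrow> real" where
  "\<xi> \<omega> = (\<Sum>i. of_bool (\<omega> i) / real (N i))"

lemma digit_summable:
  assumes "\<And>i. 0 \<le> d i" "summable d"
  shows "summable (\<lambda>i. of_bool (\<omega> i) * d i :: real)"
  by (rule summable_comparison_test'[OF assms(2), of 0]) (use assms(1) in auto)

lemma summable_inverse_N: "summable (\<lambda>i. 1 / real (N i))"
  by (rule summable_comparison_test'[of "\<lambda>i. (1/2) ^ Suc i" 0])
     (use inverse_N_le in \<open>auto intro!: summable_geometric simp del: power_Suc simp: summable_Suc_iff\<close>)

lemma \<xi>_sums: "(\<lambda>i. of_bool (\<omega> i) / real (N i)) sums \<xi> \<omega>"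
  unfolding \<xi>_def
  using digit_summable[OF _ summable_inverse_N, of \<omega>] by (intro summable_sums) simp

lemma \<xi>_meas[measurable]: "\<xi> \<in> borel_measurable B"
  unfolding \<xi>_def using digit_fun_meas by (intro borel_measurable_suminf) auto

definition lam :: "(nat \<Rightarrow> bool) \<Rightarrow> complex" where
  "lam \<omega> = cis (2 * pi * (\<theta> + \<xi> \<omega>))"

lemma cis_meas[measurable]: "cis \<in> borel_measurable borel"
  by (intro borel_measurable_continuous_onI continuous_intros)

lemma lam_meas': "lam \<in> borel_measurable B"
  unfolding lam_def by measurable

text \<open>Comes from the Fourier coefficient of one digit: |1 - p + p e^(it)|^2 = 1 - \<kappa> (1
  - cos t).\<close>

definition \<kappa> :: "nat \<Rightarrow> real" where
  "\<kappa> i = 2 * p i * (1 - p i)"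

lemma \<kappa>_bounds: "p i \<le> \<kappa> i" "\<kappa> i \<le> 1/2"
proof -
  have "0 \<le> p i * (1 - 2 * p i)" using p_pos[of i] p_le[of i] by (intro mult_nonneg_nonneg) auto
  then show "p i \<le> \<kappa> i" by (simp add: \<kappa>_def algebra_simps)
  have "0 \<le> (1 - 2 * p i)\<^sup>2" by simp
  then show "\<kappa> i \<le> 1/2" by (simp add: \<kappa>_def power2_eq_square algebra_simps)
qed

text \<open>Squared moduli of the first \<open>I\<close> digit factors at frequency
  \<open>n\<close>; the omitted factors have modulus at most 1, so this bounds the whole squared
  Fourier coefficient.\<close>

definition F :: "nat \<Rightarrow> nat \<Rightarrow> real" where
  "F I n = (\<Prod>i<I. 1 - \<kappa> i * (1 - cos (2 * pi * real n / real (N i))))"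

lemma factor_nonneg: "0 \<le> 1 - \<kappa> i * (1 - cos t)"
proof -
  have "\<kappa> i * (1 - cos t) \<le> 1/2 * 2"
    using \<kappa>_bounds[of i] p_pos[of i] cos_ge_minus_one[of t] by (intro mult_mono) (auto simp: cos_le_one)
  then show ?thesis by simp
qed

lemma F_nonneg: "0 \<le> F I n"
  unfolding F_def by (intro prod_nonneg ballI factor_nonneg)

lemma lam_moment_bound: "(cmod (LINT \<omega>|B. lam \<omega> ^ n))\<^sup>2 \<le> F I n"
proof -
  define g where "g i x = cis (2 * pi * real n * (of_bool x / real (N i)))" for i x
  define h where "h i = (LINT \<omega>|B. g i (\<omega> i))" for i
  have gm[measurable]: "(\<lambda>\<omega>. g i (\<omega> i)) \<in> borel_measurable B" for i by (rule digit_fun_meas)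
  have hi: "h i = of_real (1 - p i) + of_real (p i) * cis (2 * pi * real n / real (N i))" for i
    using digit_integral[of "g i" i] unfolding h_def[symmetric] by (simp add: g_def scaleR_conv_of_real)
  have alg: "(1 - x + x * C)\<^sup>2 + (x * S)\<^sup>2 = (1 - x)\<^sup>2 + 2 * (1 - x) * x * C + x\<^sup>2 * (S\<^sup>2 + C\<^sup>2)" for x C S :: real
    by (simp add: power2_eq_square algebra_simps)
  have h2: "(cmod (h i))\<^sup>2 = 1 - \<kappa> i * (1 - cos (2 * pi * real n / real (N i)))" for i
  proof -
    let ?t = "2 * pi * real n / real (N i)"
    have "(cmod (h i))\<^sup>2 = (1 - p i + p i * cos ?t)\<^sup>2 + (p i * sin ?t)\<^sup>2"
      unfolding hi cmod_power2 by simp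
    also have "\<dots> = (1 - p i)\<^sup>2 + 2 * (1 - p i) * p i * cos ?t + (p i)\<^sup>2 * ((sin ?t)\<^sup>2 + (cos ?t)\<^sup>2)"
      by (rule alg)
    also have "\<dots> = 1 - \<kappa> i * (1 - cos ?t)" unfolding \<kappa>_def sin_cos_squared_add by (simp add: power2_eq_square algebra_simps)
    finally show ?thesis .
  qed
  have h1: "cmod (h i) \<le> 1" for i
  proof -
    have "(cmod (h i))\<^sup>2 \<le> 1\<^sup>2" unfolding h2 using \<kappa>_bounds[of i] p_pos[of i] by (simp add: cos_le_one)
    then show ?thesis by (rule power2_le_imp_le) simp
  qed
  have prod: "(LINT \<omega>|B. (\<Prod>i<J. g i (\<omega> i))) = (\<Prod>i<J. h i)" for J
    unfolding h_def
  proof (rule B.indep_vars_lebesgue_integral)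
    have "B.indep_vars (\<lambda>i. measure_pmf (bernoulli_pmf (p i))) (\<lambda>i \<omega>. \<omega> i) UNIV"
      unfolding B_def by (rule indep_vars_PiM_coordinates) (rule prob_space_measure_pmf)
    then have "B.indep_vars (\<lambda>i. measure_pmf (bernoulli_pmf (p i))) (\<lambda>i \<omega>. \<omega> i) {..<J}"
      by (rule B.indep_vars_subset) auto
    then show "B.indep_vars (\<lambda>_. borel) (\<lambda>i \<omega>. g i (\<omega> i)) {..<J}"
      by (rule B.indep_vars_compose2) (simp add: measurable_cong_sets[OF sets_measure_pmf_count_space refl])
    show "integrable B (\<lambda>\<omega>. g i (\<omega> i))" for i
      by (rule B.integrable_const_bound[of _ 1]) (auto simp: g_def gm[unfolded g_def])
  qed simp
  have lim: "(\<lambda>J. LINT \<omega>|B. cis (2 * pi * real n * \<theta>) * (\<Prod>i<J. g i (\<omega> i))) \<longlonglongrightarrow> (LINT \<omega>|B. lam \<omega> ^ n)"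
  proof (rule integral_dominated_convergence[where w="\<lambda>_. 1"])
    show "(\<lambda>\<omega>. lam \<omega> ^ n) \<in> borel_measurable B" using lam_meas' by measurable
    show "AE \<omega> in B. (\<lambda>J. cis (2 * pi * real n * \<theta>) * (\<Prod>i<J. g i (\<omega> i))) \<longlonglongrightarrow> lam \<omega> ^ n"
    proof (rule AE_I2)
      fix \<omega>
      have "(\<Prod>i<J. g i (\<omega> i)) = cis (2 * pi * real n * (\<Sum>i<J. of_bool (\<omega> i) / real (N i)))" for J
        by (induction J) (auto simp: g_def cis_mult algebra_simps)
      moreover have "(\<lambda>J. cis (2 * pi * real n * \<theta>) * cis (2 * pi * real n * (\<Sum>i<J. of_bool (\<omega> i) / real (N i))))
         \<longlonglongrightarrow> cis (2 * pi * real n * \<theta>) * cis (2 * pi * real n * \<xi> \<omega>)"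
        using \<xi>_sums[of \<omega>] unfolding sums_def by (intro tendsto_intros)
      moreover have "lam \<omega> ^ n = cis (2 * pi * real n * \<theta>) * cis (2 * pi * real n * \<xi> \<omega>)"
        unfolding lam_def Complex.DeMoivre cis_mult by (simp add: algebra_simps)
      ultimately show "(\<lambda>J. cis (2 * pi * real n * \<theta>) * (\<Prod>i<J. g i (\<omega> i))) \<longlonglongrightarrow> lam \<omega> ^ n" by simp
    qed
    show "AE \<omega> in B. cmod (cis (2 * pi * real n * \<theta>) * (\<Prod>i<J. g i (\<omega> i))) \<le> 1" for J
      by (intro AE_I2) (simp add: norm_mult g_def prod_norm[symmetric])
  qed auto
  have "(LINT \<omega>|B. cis (2 * pi * real n * \<theta>) * (\<Prod>i<J. g i (\<omega> i))) = cis (2 * pi * real n * \<theta>) * (\<Prod>i<J. h i)" for J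
    by (simp add: prod)
  with lim have "(\<lambda>J. cis (2 * pi * real n * \<theta>) * (\<Prod>i<J. h i)) \<longlonglongrightarrow> (LINT \<omega>|B. lam \<omega> ^ n)" by simp
  then have lim2: "(\<lambda>J. cmod (cis (2 * pi * real n * \<theta>) * (\<Prod>i<J. h i))) \<longlonglongrightarrow> cmod (LINT \<omega>|B. lam \<omega> ^ n)"
    by (rule tendsto_norm)
  have "cmod (LINT \<omega>|B. lam \<omega> ^ n) \<le> cmod (\<Prod>i<I. h i)"
  proof (rule LIMSEQ_le_const2[OF lim2])
    have "cmod (cis (2 * pi * real n * \<theta>) * (\<Prod>i<J. h i)) \<le> cmod (\<Prod>i<I. h i)" if "J \<ge> I" for J
    proof -
      have "(\<Prod>i<J. cmod (h i)) \<le> (\<Prod>i<I. cmod (h i))"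
        using that
      proof (induction J rule: dec_induct)
        case (step J)
        have "(\<Prod>i<Suc J. cmod (h i)) \<le> (\<Prod>i<J. cmod (h i)) * 1"
          unfolding prod.lessThan_Suc by (intro mult_left_mono h1 prod_nonneg) auto
        then show ?case using step by simp
      qed simp
      then show ?thesis by (simp add: norm_mult prod_norm[symmetric])
    qed
    then show "\<exists>J0. \<forall>J\<ge>J0. cmod (cis (2 * pi * real n * \<theta>) * (\<Prod>i<J. h i)) \<le> cmod (\<Prod>i<I. h i)" by blast
  qed
  then have "(cmod (LINT \<omega>|B. lam \<omega> ^ n))\<^sup>2 \<le> (cmod (\<Prod>i<I. h i))\<^sup>2" by (intro power_mono) auto
  also have "\<dots> = (\<Prod>i<I. (cmod (h i))\<^sup>2)" by (simp add: prod_norm[symmetric] prod_power_distrib)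
  also have "\<dots> = F I n" by (simp add: h2 F_def)
  finally show ?thesis .
qed

text \<open>A common period of the first \<open>I\<close> factors: the largest of their
  denominators, because these form a divisor chain, and 1 for the empty product.\<close>

definition L :: "nat \<Rightarrow> nat" where
  "L I = (case I of 0 \<Rightarrow> 1 | Suc i \<Rightarrow> N i)"

lemma L_pos: "L I > 0"
  by (auto simp: L_def N_pos split: nat.split)

lemma N_eq_L_mult: "\<exists>q\<ge>2. N i = L i * q"
proof (cases i)
  case 0
  then show ?thesis using N0 by (auto simp: L_def)
next
  case (Suc k)
  obtain q where q: "N (Suc k) = N k * q" using N_dvd by (auto elim: dvdE)
  then have "q \<noteq> 0" "q \<noteq> 1" using N_less[of k] by auto
  then have "q \<ge> 2" by simp
  then show ?thesis using q Suc by (auto simp: L_def)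
qed

lemma F_periodic: "F I (n + L I) = F I n"
proof -
  have "cos (2 * pi * real (n + L I) / real (N i)) = cos (2 * pi * real n / real (N i))" if "i < I" for i
  proof -
    obtain k where k: "I = Suc k" using \<open>i < I\<close> by (cases I) auto
    then have "N i dvd L I" using that by (simp add: L_def N_dvd_le)
    then obtain q where q: "L I = N i * q" by (auto elim: dvdE)
    have "2 * pi * real (n + L I) / real (N i) = 2 * pi * real n / real (N i) + 2 * pi * real q"
      using N_pos[of i] by (simp add: q field_simps)
    moreover have "2 * pi * real q = 2 * real q * pi" by simp
    ultimately show ?thesis by (simp add: cos_add cos_2npi sin_2npi del: of_nat_add)
  qed
  then show ?thesis unfolding F_def by (intro prod.cong) auto
qed

text \<open>When the period grows by the factor q, the phases of the new cosine are spread over the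
  q-th roots of unity while the old factors stay fixed. As q \<ge> 2 the cosine averages to 0, and
  the new digit contributes exactly 1 - \<kappa>.\<close>

lemma F_period_sum: "(\<Sum>n<L I. F I n) = real (L I) * (\<Prod>i<I. 1 - \<kappa> i)"
proof (induction I)
  case 0
  then show ?case by (simp add: L_def F_def)
next
  case (Suc I)
  obtain q where q: "q \<ge> 2" "N I = L I * q" using N_eq_L_mult by blast
  have perF: "F I (m + L I * b) = F I m" for m b
  proof (induction b)
    case (Suc b)
    have "F I (m + L I * Suc b) = F I ((m + L I * b) + L I)" by (simp add: algebra_simps)
    then show ?case using F_periodic Suc by simp
  qed simp
  have inner: "(\<Sum>b<q. F (Suc I) (m + L I * b)) = F I m * (real q * (1 - \<kappa> I))" for m
  proof -
    have "2 * pi * real (m + L I * b) / real (N I) = 2 * pi * real m / real (N I) + 2 * pi * real b / real q" for b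
      using L_pos[of I] q by (simp add: field_simps)
    then have "F (Suc I) (m + L I * b) = F I m * (1 - \<kappa> I + \<kappa> I * cos (2 * pi * real m / real (N I) + 2 * pi * real b / real q))" for b
      using perF[of m b] by (simp add: F_def algebra_simps)
    then have "(\<Sum>b<q. F (Suc I) (m + L I * b)) = F I m * (real q * (1 - \<kappa> I) + \<kappa> I * (\<Sum>b<q. cos (2 * pi * real m / real (N I) + 2 * pi * real b / real q)))"
      by (simp add: sum.distrib flip: sum_distrib_left)
    then show ?thesis using sum_cos_roots[OF q(1)] by simp
  qed
  have "(\<Sum>n<L (Suc I). F (Suc I) n) = (\<Sum>n<L I * q. F (Suc I) n)" using q by (simp add: L_def)
  also have "\<dots> = (\<Sum>m<L I. \<Sum>b<q. F (Suc I) (m + L I * b))" by (rule sum_grid)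
  also have "\<dots> = (\<Sum>m<L I. F I m) * (real q * (1 - \<kappa> I))" by (simp add: inner sum_distrib_right)
  also have "\<dots> = real (L (Suc I)) * (\<Prod>i<Suc I. 1 - \<kappa> i)" using q Suc by (simp add: L_def)
  finally show ?case .
qed

text \<open>\<open>K\<close> is rounded up to a multiple of the period, which costs at most one
  additional period.\<close>

lemma F_sum_le: "(\<Sum>n<K. F I n) \<le> (real K + real (L I)) * (\<Prod>i<I. 1 - \<kappa> i)"
proof -
  have "0 \<le> 1 - \<kappa> i" for i using \<kappa>_bounds(2)[of i] by simp
  then have pos: "0 \<le> (\<Prod>i<I. 1 - \<kappa> i)" by (intro prod_nonneg) auto
  have "K \<le> L I * Suc (K div L I)"
    using L_pos[of I] by (metis less_imp_le dividend_less_times_div mult_Suc_right add.commute)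
  then have "(\<Sum>n<K. F I n) \<le> (\<Sum>n<L I * Suc (K div L I). F I n)"
    by (intro sum_mono2 F_nonneg) auto
  also have "\<dots> = real (Suc (K div L I)) * (real (L I) * (\<Prod>i<I. 1 - \<kappa> i))"
    by (subst sum_periodic[where f="F I" and L="L I", OF F_periodic]) (simp add: F_period_sum)
  also have "\<dots> = (real (K div L I * L I) + real (L I)) * (\<Prod>i<I. 1 - \<kappa> i)" by (simp add: algebra_simps)
  also have "\<dots> \<le> (real K + real (L I)) * (\<Prod>i<I. 1 - \<kappa> i)"
    using pos by (intro mult_right_mono add_right_mono) (simp_all only: of_nat_le_iff div_times_less_eq_dividend)
  finally show ?thesis .
qed

text \<open>Each factor is at most exp (- p i), and the p i sum to c times the harmonic
  series.\<close>

lemma prod_\<kappa>_tendsto: "(\<lambda>I. \<Prod>i<I. 1 - \<kappa> i) \<longlonglongrightarrow> 0"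
proof (rule tendsto_sandwich[OF _ _ tendsto_const])
  have nn: "0 \<le> 1 - \<kappa> i" for i using \<kappa>_bounds(2)[of i] by simp
  show "eventually (\<lambda>I. 0 \<le> (\<Prod>i<I. 1 - \<kappa> i)) sequentially"
    by (intro always_eventually allI prod_nonneg ballI nn)
  have le: "1 - \<kappa> i \<le> exp (- p i)" for i
    using exp_ge_add_one_self[of "- p i"] \<kappa>_bounds(1)[of i] by simp
  have "(\<Prod>i<I. 1 - \<kappa> i) \<le> exp (- (c * harm I))" for I
  proof -
    have "(\<Prod>i<I. 1 - \<kappa> i) \<le> (\<Prod>i<I. exp (- p i))" by (intro prod_mono) (use nn le in auto)
    also have "\<dots> = exp (- (\<Sum>i<I. p i))" by (simp add: exp_sum[symmetric] sum_negf)
    also have "(\<Sum>i<I. p i) = c * harm I"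
      unfolding harm_def p_def sum_distrib_left
      by (rule sum.reindex_bij_witness[of _ "\<lambda>i. i - 1" Suc]) (auto simp: divide_inverse add.commute)
    finally show ?thesis .
  qed
  then show "eventually (\<lambda>I. (\<Prod>i<I. 1 - \<kappa> i) \<le> exp (- (c * harm I))) sequentially"
    by (intro always_eventually allI)
  have "filterlim (\<lambda>I. c * harm I) at_top sequentially"
    using c by (intro filterlim_tendsto_pos_mult_at_top[OF tendsto_const _ harm_at_top])
  then have "filterlim (\<lambda>I. - (c * harm I)) at_bot sequentially" by (simp add: filterlim_uminus_at_top)
  then show "(\<lambda>I. exp (- (c * harm I))) \<longlonglongrightarrow> 0"
    by (rule filterlim_compose[OF exp_at_bot])
qed

lemma cesaro_sq: "cesaro_null (\<lambda>n. (cmod (LINT \<omega>|B. lam \<omega> ^ n))\<^sup>2)"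
  unfolding cesaro_null_def
proof (rule LIMSEQ_I)
  fix r :: real assume r: "r > 0"
  obtain I where I: "(\<Prod>i<I. 1 - \<kappa> i) < r / 2"
    using order_tendstoD(2)[OF prod_\<kappa>_tendsto, of "r / 2"] r by (auto simp: eventually_sequentially)
  show "\<exists>K0. \<forall>K\<ge>K0. norm ((\<Sum>n<K. (cmod (LINT \<omega>|B. lam \<omega> ^ n))\<^sup>2) / real K - 0) < r"
  proof (intro exI[of _ "L I"] allI impI)
    fix K assume K: "L I \<le> K"
    then have K0: "real K > 0" using L_pos[of I] by simp
    have "(\<Sum>n<K. (cmod (LINT \<omega>|B. lam \<omega> ^ n))\<^sup>2) \<le> (\<Sum>n<K. F I n)" by (intro sum_mono lam_moment_bound)
    also have "\<dots> \<le> (real K + real (L I)) * (\<Prod>i<I. 1 - \<kappa> i)" by (rule F_sum_le)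
    also have "\<dots> < (real K + real (L I)) * (r / 2)" using I K0 by (intro mult_strict_left_mono) auto
    also have "\<dots> \<le> (real K + real K) * (r / 2)" using K r by (intro mult_right_mono) auto
    finally have "(\<Sum>n<K. (cmod (LINT \<omega>|B. lam \<omega> ^ n))\<^sup>2) < real K * r" by simp
    then show "norm ((\<Sum>n<K. (cmod (LINT \<omega>|B. lam \<omega> ^ n))\<^sup>2) / real K - 0) < r"
      using K0 by (simp add: sum_nonneg field_simps)
  qed
qed

lemma unimodular_rv_lam: "unimodular_rv B lam"
proof (intro unimodular_rv.intro unimodular_rv_axioms.intro prob_B)
  show "lam \<in> borel_measurable B" by (rule lam_meas')
  show "cmod (lam \<omega>) = 1" for \<omega> by (simp add: lam_def)
  show "cesaro_null (\<lambda>n. cmod (LINT \<omega>|B. lam \<omega> ^ n))"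
  proof (rule cesaro_null_approx)
    fix \<epsilon> :: real assume e: "\<epsilon> > 0"
    \<comment> \<open>Completing the square passes from Cesaro decay of the squares to that of the
      moduli.\<close>
    have "x \<le> 1 / (4 * \<epsilon>) * x\<^sup>2 + \<epsilon>" for x
    proof -
      have "0 \<le> (x - 2 * \<epsilon>)\<^sup>2" by simp
      then have "4 * \<epsilon> * x \<le> x\<^sup>2 + 4 * \<epsilon> * \<epsilon>" by (simp add: power2_eq_square algebra_simps)
      then show ?thesis using e by (simp add: field_simps)
    qed
    then show "\<exists>u. cesaro_null u \<and> (\<forall>n. cmod (LINT \<omega>|B. lam \<omega> ^ n) \<le> u n + \<epsilon>)"
      by (intro exI[of _ "\<lambda>n. 1 / (4 * \<epsilon>) * (cmod (LINT \<omega>|B. lam \<omega> ^ n))\<^sup>2"] conjI allI cesaro_null_cmult cesaro_sq)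
  qed simp
qed

text \<open>Only the fractional part of m / N i matters for the digit with index i, so it may be replaced
  by any d i that differs from it by an integer.\<close>

lemma variance_bound:
  assumes d: "\<And>i. 0 \<le> d i" "summable d" and z: "\<And>i. real m / real (N i) - d i \<in> \<int>"
    and fin: "\<And>i. i \<ge> K \<Longrightarrow> d i = real m / real (N i)"
  shows "(LINT \<omega>|B. (cmod (lam \<omega> ^ (m + v) - cis (2 * pi * real m * \<theta>) * lam \<omega> ^ v))\<^sup>2) \<le> 4 * pi * (\<Sum>i. p i * d i)"
proof -
  define y where "y \<omega> = (\<Sum>i. of_bool (\<omega> i) * d i)" for \<omega> :: "nat \<Rightarrow> bool"
  have ys: "(\<lambda>i. of_bool (\<omega> i) * d i) sums y \<omega>" for \<omega>
    unfolding y_def by (intro summable_sums digit_summable d)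
  have y0: "0 \<le> y \<omega>" for \<omega> unfolding y_def by (intro suminf_nonneg digit_summable d) (use d in auto)
  have ym[measurable]: "y \<in> borel_measurable B"
    unfolding y_def by (intro borel_measurable_suminf digit_fun_meas)
  \<comment> \<open>From index \<open>K\<close> on the terms cancel, so the two series differ by a
    finite sum of integers, which \<open>cis\<close> does not see.\<close>
  have int: "real m * \<xi> \<omega> - y \<omega> \<in> \<int>" for \<omega>
  proof -
    have "(\<lambda>i. real m * (of_bool (\<omega> i) / real (N i)) - of_bool (\<omega> i) * d i) sums (real m * \<xi> \<omega> - y \<omega>)"
      by (intro sums_diff sums_mult \<xi>_sums ys)
    moreover have "(\<lambda>i. real m * (of_bool (\<omega> i) / real (N i)) - of_bool (\<omega> i) * d i) sums
       (\<Sum>i<K. real m * (of_bool (\<omega> i) / real (N i)) - of_bool (\<omega> i) * d i)"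
      by (rule sums_finite) (auto simp: fin)
    ultimately have "real m * \<xi> \<omega> - y \<omega> = (\<Sum>i<K. real m * (of_bool (\<omega> i) / real (N i)) - of_bool (\<omega> i) * d i)"
      by (rule sums_unique2)
    also have "\<dots> \<in> \<int>"
    proof (rule Ints_sum)
      fix i show "real m * (of_bool (\<omega> i) / real (N i)) - of_bool (\<omega> i) * d i \<in> \<int>"
        using z[of i] by (cases "\<omega> i") auto
    qed
    finally show ?thesis .
  qed
  have eq: "cmod (lam \<omega> ^ (m + v) - cis (2 * pi * real m * \<theta>) * lam \<omega> ^ v) = cmod (cis (2 * pi * y \<omega>) - 1)" for \<omega>
  proof -
    obtain k where k: "real m * \<xi> \<omega> - y \<omega> = of_int k" using int[of \<omega>] by (auto elim: Ints_cases)
    have "2 * pi * real m * \<xi> \<omega> = 2 * pi * (real m * \<xi> \<omega>)" by simp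
    also have "real m * \<xi> \<omega> = y \<omega> + of_int k" using k by simp
    also have "2 * pi * (y \<omega> + of_int k) = 2 * pi * y \<omega> + 2 * pi * of_int k" by (rule distrib_left)
    finally have "cis (2 * pi * real m * \<xi> \<omega>) = cis (2 * pi * y \<omega>)"
      by (simp add: complex_eq_iff cos_add sin_add cos_int_2pin sin_int_2pin)
    moreover have "lam \<omega> ^ m = cis (2 * pi * real m * \<theta>) * cis (2 * pi * real m * \<xi> \<omega>)"
      unfolding lam_def Complex.DeMoivre cis_mult by (simp add: algebra_simps)
    ultimately have "lam \<omega> ^ (m + v) - cis (2 * pi * real m * \<theta>) * lam \<omega> ^ v
      = lam \<omega> ^ v * cis (2 * pi * real m * \<theta>) * (cis (2 * pi * y \<omega>) - 1)"
      by (simp add: power_add algebra_simps)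
    then show ?thesis by (simp add: norm_mult norm_power lam_def)
  qed
  have le1: "(cmod (cis (2 * pi * y \<omega>) - 1))\<^sup>2 \<le> 4 * pi * y \<omega>" for \<omega>
    using cis_diff_1_le[of "2 * pi * y \<omega>"] y0[of \<omega>] by (simp add: abs_mult)
  have ybound: "y \<omega> \<le> suminf d" for \<omega>
    unfolding y_def by (intro suminf_le digit_summable d) (use d in auto)
  have yint: "integrable B y"
    by (rule B.integrable_const_bound[of _ "suminf d"]) (use y0 ybound in auto)
  have digint: "integrable B (\<lambda>\<omega>. of_bool (\<omega> i) * d i)" for i
    by (rule B.integrable_const_bound[of _ "d i"]) (use d digit_fun_meas in auto)
  have dig: "(LINT \<omega>|B. of_bool (\<omega> i) * d i) = p i * d i" for i
    using digit_integral[of "\<lambda>x. of_bool x * d i" i] by simp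
  have Ey: "(LINT \<omega>|B. y \<omega>) = (\<Sum>i. p i * d i)"
  proof -
    have "(\<lambda>J. LINT \<omega>|B. (\<Sum>i<J. of_bool (\<omega> i) * d i)) \<longlonglongrightarrow> (LINT \<omega>|B. y \<omega>)"
    proof (rule integral_dominated_convergence[where w="\<lambda>_. suminf d"])
      show "AE \<omega> in B. (\<lambda>J. \<Sum>i<J. of_bool (\<omega> i) * d i) \<longlonglongrightarrow> y \<omega>"
        using ys unfolding sums_def by (intro AE_I2)
      show "AE \<omega> in B. norm (\<Sum>i<J. of_bool (\<omega> i) * d i) \<le> suminf d" for J
      proof (rule AE_I2)
        fix \<omega> :: "nat \<Rightarrow> bool"
        have "(\<Sum>i<J. of_bool (\<omega> i) * d i) \<le> y \<omega>" unfolding y_def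
          by (intro sum_le_suminf digit_summable d) (use d in auto)
        then show "norm (\<Sum>i<J. of_bool (\<omega> i) * d i) \<le> suminf d"
          using ybound[of \<omega>] d by (simp add: sum_nonneg)
      qed
      show "(\<lambda>\<omega>. \<Sum>i<J. of_bool (\<omega> i) * d i) \<in> borel_measurable B" for J
        by (intro borel_measurable_sum digit_fun_meas)
    qed auto
    moreover have "(LINT \<omega>|B. (\<Sum>i<J. of_bool (\<omega> i) * d i)) = (\<Sum>i<J. p i * d i)" for J
      using Bochner_Integration.integral_sum[of "{..<J}" B "\<lambda>i \<omega>. of_bool (\<omega> i) * d i"] digint
      by (simp only: dig)
    ultimately have "(\<lambda>i. p i * d i) sums (LINT \<omega>|B. y \<omega>)" by (simp add: sums_def)
    then show ?thesis by (simp add: sums_unique)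
  qed
  have "(LINT \<omega>|B. (cmod (cis (2 * pi * y \<omega>) - 1))\<^sup>2) \<le> (LINT \<omega>|B. 4 * pi * y \<omega>)"
  proof (rule integral_mono)
    show i4: "integrable B (\<lambda>\<omega>. 4 * pi * y \<omega>)" by (intro integrable_mult_right yint)
    show "integrable B (\<lambda>\<omega>. (cmod (cis (2 * pi * y \<omega>) - 1))\<^sup>2)"
      by (rule Bochner_Integration.integrable_bound[OF i4]) (use le1 y0 in \<open>auto intro!: AE_I2\<close>)
  qed (rule le1)
  also have "\<dots> = 4 * pi * (\<Sum>i. p i * d i)" using yint Ey by simp
  finally show ?thesis unfolding eq .
qed

text \<open>Only parameters at indices in the support of \<open>d\<close> enter, so a support far
  out yields a small bound.\<close>

lemma weighted_sum_le:
  assumes "\<And>i. 0 \<le> d i" "summable d" "\<And>i. d i \<noteq> 0 \<Longrightarrow> p i \<le> q" "suminf d \<le> s" "0 \<le> q"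
  shows "(\<Sum>i. p i * d i) \<le> q * s"
proof -
  have le: "p i * d i \<le> q * d i" for i
    using assms(1)[of i] assms(3)[of i] by (cases "d i = 0") (auto intro: mult_right_mono)
  have s2: "summable (\<lambda>i. q * d i)" by (rule summable_mult[OF assms(2)])
  have "summable (\<lambda>i. p i * d i)"
    by (rule summable_comparison_test'[OF s2, of 0]) (use le p01 assms(1) in auto)
  then have "(\<Sum>i. p i * d i) \<le> (\<Sum>i. q * d i)" using s2 le by (intro suminf_le)
  also have "\<dots> = q * suminf d" by (rule suminf_mult[OF assms(2)])
  also have "\<dots> \<le> q * s" using assms by (intro mult_left_mono)
  finally show ?thesis .
qed

text \<open>For an arbitrary time \<open>m\<close> every digit may contribute; the ratios m / N i
  sum to at most m and each parameter is at most c. Serves the time \<open>n 0\<close> and the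
  offsets caused by the integer shift.\<close>

lemma variance_const:
  "(LINT \<omega>|B. (cmod (lam \<omega> ^ (m + v) - cis (2 * pi * real m * \<theta>) * lam \<omega> ^ v))\<^sup>2) \<le> 4 * pi * (c * real m)"
proof -
  have s: "summable (\<lambda>i. real m / real (N i))"
    using summable_mult[OF summable_inverse_N, of "real m"] by simp
  have h: "(\<lambda>i. real m * (1/2) ^ Suc i) sums (real m * 1)"
    by (intro sums_mult power_half_series)
  have "suminf (\<lambda>i. real m / real (N i)) \<le> suminf (\<lambda>i. real m * (1/2) ^ Suc i)"
  proof (intro suminf_le s sums_summable[OF h])
    fix i
    have "real m * (1 / real (N i)) \<le> real m * (1/2) ^ Suc i" by (intro mult_left_mono inverse_N_le) simp
    then show "real m / real (N i) \<le> real m * (1/2) ^ Suc i" by simp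
  qed
  also have "\<dots> = real m" using sums_unique[OF h] by simp
  finally have le: "suminf (\<lambda>i. real m / real (N i)) \<le> real m" .
  have pc: "p i \<le> c" for i using p_antimono[of 0 i] by (simp add: p_def)
  have "(LINT \<omega>|B. (cmod (lam \<omega> ^ (m + v) - cis (2 * pi * real m * \<theta>) * lam \<omega> ^ v))\<^sup>2) \<le> 4 * pi * (\<Sum>i. p i * (real m / real (N i)))"
    by (rule variance_bound[where K=0]) (use s in auto)
  also have "\<dots> \<le> 4 * pi * (c * real m)"
    by (intro mult_left_mono weighted_sum_le s le pc) (use c in auto)
  finally show ?thesis .
qed

text \<open>N j / N i is an integer for i \<le> j, so only later digits rotate. Their parameters are
  at most c / (j + 2), and the ratios N j / N i for i > j sum to at most 1.\<close>

lemma variance_N: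
  "(LINT \<omega>|B. (cmod (lam \<omega> ^ (N j + v) - cis (2 * pi * real (N j) * \<theta>) * lam \<omega> ^ v))\<^sup>2) \<le> 4 * pi * (c / (real j + 2))"
proof -
  define d where "d i = (if i \<le> j then 0 else real (N j) / real (N i))" for i
  have d0: "0 \<le> d i" for i by (simp add: d_def)
  have "summable (\<lambda>i. real (N j) / real (N i))"
    using summable_mult[OF summable_inverse_N, of "real (N j)"] by simp
  then have s: "summable d"
    by (rule summable_comparison_test'[where N=0]) (auto simp: d_def)
  have h: "(\<lambda>i. (1/2) ^ Suc i) sums (1 :: real)" by (rule power_half_series)
  have dle: "d (i + Suc j) \<le> (1/2) ^ Suc i" for i
    using N_ratio[of j "Suc i"] by (simp add: d_def add.commute)
  have "suminf d = (\<Sum>i. d (i + Suc j)) + (\<Sum>i<Suc j. d i)" by (rule suminf_split_initial_segment[OF s])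
  also have "(\<Sum>i<Suc j. d i) = 0" by (simp add: d_def)
  also have "(\<Sum>i. d (i + Suc j)) \<le> (\<Sum>i. (1/2) ^ Suc i)"
    by (intro suminf_le summable_ignore_initial_segment[OF s] sums_summable[OF h] dle)
  also have "\<dots> = 1" using sums_unique[OF h] by simp
  finally have le: "suminf d \<le> 1" by simp
  have z: "real (N j) / real (N i) - d i \<in> \<int>" for i
  proof (cases "i \<le> j")
    case True
    then obtain q where "N j = N i * q" using N_dvd_le[OF True] by (auto elim: dvdE)
    then show ?thesis using True N_pos[of i] by (simp add: d_def)
  qed (simp add: d_def)
  have "(LINT \<omega>|B. (cmod (lam \<omega> ^ (N j + v) - cis (2 * pi * real (N j) * \<theta>) * lam \<omega> ^ v))\<^sup>2) \<le> 4 * pi * (\<Sum>i. p i * d i)"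
    by (rule variance_bound[OF d0 s z, of "Suc j"]) (simp add: d_def)
  also have "\<dots> \<le> 4 * pi * (p (Suc j) * 1)"
    using p01 by (intro mult_left_mono weighted_sum_le d0 s le p_antimono) (auto simp: d_def split: if_splits)
  finally show ?thesis by (simp add: p_def add.commute)
qed

end

subsection \<open>The base rotation\<close>

lemma cos_nonpos_middle:
  assumes "1/4 \<le> s" "s \<le> 3/4"
  shows "cos (2 * pi * s) \<le> 0"
proof -
  have "cos (2 * pi * s - pi) \<ge> 0"
  proof (rule cos_ge_zero)
    have "2 * pi * (1/4) \<le> 2 * pi * s" using assms(1) by (intro mult_left_mono) auto
    then show "- (pi / 2) \<le> 2 * pi * s - pi" by linarith
    have "2 * pi * s \<le> 2 * pi * (3/4)" using assms(2) by (intro mult_left_mono) auto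
    then show "2 * pi * s - pi \<le> pi / 2" by linarith
  qed
  moreover have "cos (2 * pi * s - pi) = - cos (2 * pi * s)" by (simp add: cos_diff)
  ultimately show ?thesis by simp
qed

lemma cos_add_int: "cos (2 * pi * (s + of_int z)) = cos (2 * pi * s)"
  by (simp add: distrib_left cos_add cos_int_2pin sin_int_2pin)

lemma cis_ne_1:
  assumes "0 < s" "s < (1::real)"
  shows "cis (2 * pi * s) \<noteq> 1"
proof
  assume "cis (2 * pi * s) = 1"
  then have "cos (2 * pi * s) = 1" by (simp add: complex_eq_iff)
  then obtain k :: int where "2 * pi * s = of_int k * 2 * pi" unfolding cos_one_2pi_int by blast
  then have "s = of_int k" by simp
  then show False using assms by simp
qed

text \<open>The last phase can be prescribed modulo 1 anywhere in [1/4, 3/4]. The induction step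
  needs a preceding phase s' in this interval with q s' = s modulo 1; it exists because q times the
  interval has length q/2 \<ge> 1.\<close>

lemma base_rotation_finite:
  fixes N :: "nat \<Rightarrow> nat"
  assumes N0: "N 0 > 0" and dvd: "\<And>i. N i dvd N (Suc i)" and less: "\<And>i. N i < N (Suc i)"
    and s: "1/4 \<le> s" "s \<le> 3/4"
  shows "\<exists>t. t \<in> {1 / (4 * real (N 0))..3 / (4 * real (N 0))} \<and> real (N k) * t - s \<in> \<int>
     \<and> (\<forall>i\<le>k. cos (2 * pi * (real (N i) * t)) \<le> 0)"
  using s
proof (induction k arbitrary: s)
  case 0
  then show ?case using N0 cos_nonpos_middle[of s]
    by (intro exI[of _ "s / real (N 0)"]) (auto simp: field_simps)
next
  case (Suc k)
  obtain q where q: "N (Suc k) = N k * q" using dvd by (auto elim: dvdE)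
  have "q \<noteq> 0" "q \<noteq> 1" using q less[of k] by auto
  then have q2: "q \<ge> 2" by simp
  \<comment> \<open>The least integer with q/4 \<le> s + d; it overshoots by less than 1 \<le> q/2,
    so s + d stays below 3q/4.\<close>
  define d where "d = \<lceil>real q / 4 - s\<rceil>"
  define s' where "s' = (s + of_int d) / real q"
  have "real q / 4 - s \<le> of_int d" "of_int d < real q / 4 - s + 1" unfolding d_def by linarith+
  then have "real q / 4 \<le> s + of_int d" "s + of_int d \<le> real q * (3/4)" using q2 by auto
  then have s': "1/4 \<le> s'" "s' \<le> 3/4" using q2 by (auto simp: s'_def field_simps)
  from Suc.IH[OF s'] obtain t where t: "t \<in> {1 / (4 * real (N 0))..3 / (4 * real (N 0))}"
    "real (N k) * t - s' \<in> \<int>" "\<forall>i\<le>k. cos (2 * pi * (real (N i) * t)) \<le> 0" by blast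
  from t(2) obtain z where z: "real (N k) * t - s' = of_int z" by (auto elim: Ints_cases)
  have "real (N (Suc k)) * t = real q * (real (N k) * t)" by (simp add: q)
  also have "real (N k) * t = s' + of_int z" using z by simp
  also have "real q * (s' + of_int z) = s + of_int (d + int q * z)"
    using q2 by (simp add: s'_def field_simps)
  finally have eq: "real (N (Suc k)) * t = s + of_int (d + int q * z)" .
  have "cos (2 * pi * (real (N (Suc k)) * t)) \<le> 0"
    unfolding eq cos_add_int by (rule cos_nonpos_middle[OF Suc.prems])
  moreover have "real (N (Suc k)) * t - s \<in> \<int>" unfolding eq by simp
  ultimately show ?case using t by (auto simp: le_Suc_eq)
qed

lemma base_rotation:
  fixes N :: "nat \<Rightarrow> nat"
  assumes N0: "N 0 > 0" and dvd: "\<And>i. N i dvd N (Suc i)" and less: "\<And>i. N i < N (Suc i)"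
  obtains t where "t \<in> {1 / (4 * real (N 0))..3 / (4 * real (N 0))}"
    "\<And>i. cos (2 * pi * (real (N i) * t)) \<le> 0"
proof -
  define S where "S k = {1 / (4 * real (N 0))..3 / (4 * real (N 0))} \<inter> {t. \<forall>i\<in>{..k}. cos (2 * pi * (real (N i) * t)) \<le> 0}" for k
  have "\<Inter> (range S) \<noteq> {}"
  proof (rule compact_nest)
    show "compact (S k)" for k unfolding S_def
      by (intro compact_Int_closed compact_Icc closed_Collect_all closed_Collect_imp open_Collect_const
          closed_Collect_le continuous_intros closed_INT) (auto simp: Ball_def intro!: closed_Collect_all closed_Collect_imp closed_Collect_le continuous_intros)
    show "S k \<noteq> {}" for k
      using base_rotation_finite[where N=N and s="1/2" and k=k, OF N0 dvd less] unfolding S_def by fastforce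
    show "S n \<subseteq> S m" if "m \<le> n" for m n using that by (auto simp: S_def)
  qed
  then obtain t where "\<And>k. t \<in> S k" by auto
  then show thesis by (intro that[of t]) (auto simp: S_def)
qed

lemma separated_rotation:
  fixes n :: "nat \<Rightarrow> nat" and p :: int
  assumes mono: "strict_mono n" and pos: "\<And>k. n k > 0" and dvd: "\<And>k. k \<ge> 1 \<Longrightarrow> n k dvd n (Suc k)"
  obtains \<theta> \<delta> where "\<delta> > 0" "\<And>k. int (n k) - p > 0 \<Longrightarrow> \<delta> \<le> cmod (cis (2 * pi * (of_int (int (n k) - p) * \<theta>)) - 1)"
proof (cases "p = 0")
  case True
  define N where "N i = n (Suc i)" for i
  have N0: "N 0 > 0" using pos by (simp add: N_def)
  obtain t where t: "t \<in> {1 / (4 * real (N 0))..3 / (4 * real (N 0))}" "\<And>i. cos (2 * pi * (real (N i) * t)) \<le> 0"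
    by (rule base_rotation[where N=N, OF N0]) (use dvd mono in \<open>auto simp: N_def strict_mono_def\<close>)
  \<comment> \<open>\<open>n 0\<close> need not divide \<open>n 1\<close>, so its phase is treated
    separately: the interval containing \<open>t\<close> forces 0 < n 0 * t < 1.\<close>
  have n01: "n 0 < N 0" using mono by (simp add: N_def strict_mono_def)
  have "real (n 0) * t \<le> real (N 0) * t" using n01 t(1) N0 by (intro mult_right_mono) (auto intro: order_trans[rotated])
  also have "\<dots> \<le> real (N 0) * (3 / (4 * real (N 0)))" using t(1) by (intro mult_left_mono) auto
  finally have le: "real (n 0) * t < 1" using N0 by simp
  have "0 < 1 / (4 * real (N 0))" using N0 by simp
  moreover have "1 / (4 * real (N 0)) \<le> t" using t(1) by simp
  ultimately have tp: "0 < t" by (rule less_le_trans)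
  then have "0 < real (n 0) * t" using pos[of 0] by simp
  then have ne: "cis (2 * pi * (real (n 0) * t)) \<noteq> 1" using le by (intro cis_ne_1)
  show thesis
  proof (rule that[of "min 1 (cmod (cis (2 * pi * (real (n 0) * t)) - 1))" t])
    show "0 < min 1 (cmod (cis (2 * pi * (real (n 0) * t)) - 1))" using ne by simp
    fix k
    show "min 1 (cmod (cis (2 * pi * (real (n 0) * t)) - 1)) \<le> cmod (cis (2 * pi * (of_int (int (n k) - p) * t)) - 1)"
    proof (cases k)
      case 0
      then show ?thesis using True by simp
    next
      case (Suc i)
      let ?z = "cis (2 * pi * (real (N i) * t))"
      \<comment> \<open>A nonpositive cosine already puts the point at distance at least 1 from
        1.\<close>
      have "1 \<le> \<bar>Re (?z - 1)\<bar>" using t(2)[of i] by simp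
      also have "\<dots> \<le> cmod (?z - 1)" by (rule abs_Re_le_cmod)
      finally show ?thesis using Suc True by (simp add: N_def)
    qed
  qed
next
  case False
  \<comment> \<open>Chosen so that m = n (K - 1) exceeds |p| and K - 1 \<ge> 1, where divisibility
    holds; then q \<ge> 2m. No positive n k - p is divisible by q: for k < K it is below q, and for
    k \<ge> K it is congruent to -p with 0 < |p| < q.\<close>
  define K where "K = nat \<bar>p\<bar> + 2"
  define q where "q = n K"
  define m where "m = n (K - 1)"
  have Km: "Suc (K - 1) = K" "K - 1 \<ge> 1" by (auto simp: K_def)
  have mp: "int m > \<bar>p\<bar>"
  proof -
    have "K - 1 \<le> n (K - 1)" by (rule strict_mono_imp_increasing[OF mono])
    then show ?thesis by (simp add: m_def K_def)
  qed
  have "m dvd q" using dvd[OF Km(2)] Km(1) by (simp add: m_def q_def)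
  moreover have "m < q" using mono Km(1) by (metis m_def q_def strict_mono_Suc_iff)
  ultimately have q2: "2 * m \<le> q"
  proof -
    obtain j where j: "q = m * j" using \<open>m dvd q\<close> by (auto elim: dvdE)
    then have "j \<noteq> 0" "j \<noteq> 1" using \<open>m < q\<close> by auto
    then have "j \<ge> 2" by simp
    then show ?thesis using j by simp
  qed
  have q1: "q > 1" using q2 mp False by linarith
  define \<delta> where "\<delta> = Min ((\<lambda>j. cmod (cis (2 * pi * (real j / real q)) - 1)) ` {1..<q})"
  have fin: "finite ((\<lambda>j. cmod (cis (2 * pi * (real j / real q)) - 1)) ` {1..<q})"
    "(\<lambda>j. cmod (cis (2 * pi * (real j / real q)) - 1)) ` {1..<q} \<noteq> {}" using q1 by auto
  have dpos: "\<delta> > 0" unfolding \<delta>_def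
  proof (subst Min_gr_iff[OF fin], intro ballI)
    fix x assume "x \<in> (\<lambda>j. cmod (cis (2 * pi * (real j / real q)) - 1)) ` {1..<q}"
    then obtain j where j: "j \<in> {1..<q}" "x = cmod (cis (2 * pi * (real j / real q)) - 1)" by blast
    have "cis (2 * pi * (real j / real q)) \<noteq> 1" using j by (intro cis_ne_1) auto
    then show "0 < x" using j by simp
  qed
  show thesis
  proof (rule that[OF dpos, of "1 / real q"])
    fix k assume sp: "int (n k) - p > 0"
    define s where "s = int (n k) - p"
    have nd: "\<not> int q dvd s"
    proof (cases "k < K")
      case True
      then have "n k \<le> m" using mono unfolding m_def by (metis Km(1) less_Suc_eq_le strict_mono_less_eq)
      then have "s < int q" using mp q2 unfolding s_def by linarith
      then show ?thesis using sp zdvd_not_zless s_def by blast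
    next
      case False
      have "n K dvd n (K + i)" for i
      proof (induction i)
        case (Suc i)
        have "n (K + i) dvd n (Suc (K + i))" by (rule dvd) (simp add: K_def)
        then show ?case using Suc by (auto intro: dvd_trans)
      qed simp
      from this[of "k - K"] False have "q dvd n k" by (simp add: q_def)
      then have "int q dvd int (n k)" by simp
      moreover have "\<not> int q dvd p"
      proof
        assume "int q dvd p"
        then have "int q \<le> \<bar>p\<bar>" using \<open>p \<noteq> 0\<close> by (metis dvd_abs_iff zdvd_imp_le zero_less_abs_iff)
        then show False using mp q2 by linarith
      qed
      ultimately show ?thesis unfolding s_def by (metis dvd_diff_right_iff)
    qed
    define j where "j = nat (s mod int q)"
    have j0: "s mod int q \<noteq> 0" using nd by (simp add: dvd_eq_mod_eq_0)
    have jr: "0 \<le> s mod int q" "s mod int q < int q" using q1 by auto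
    have j: "j \<in> {1..<q}" using j0 jr by (auto simp: j_def)
    have ij: "int j = s mod int q" using jr by (simp add: j_def)
    have "s = int q * (s div int q) + int j" by (simp add: ij)
    then have "real_of_int s = real q * of_int (s div int q) + real j" by (metis of_int_add of_int_mult of_int_of_nat_eq)
    then have eq: "real_of_int s * (1 / real q) = real j / real q + of_int (s div int q)"
      using q1 by (simp add: field_simps)
    have "cis (2 * pi * (real_of_int s * (1 / real q))) = cis (2 * pi * (real j / real q))"
      unfolding eq distrib_left cis_mult[symmetric] by (simp add: complex_eq_iff cos_int_2pin sin_int_2pin)
    then show "\<delta> \<le> cmod (cis (2 * pi * (of_int (int (n k) - p) * (1 / real q))) - 1)"
      unfolding \<delta>_def s_def[symmetric] using j fin by (intro Min_le) auto
  qed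
qed

subsection \<open>Non-recurrence\<close>

context unimodular_rv
begin

text \<open>Combines the fourth-moment bound with the isometry between the process and the powers of
  \<open>lam\<close>.\<close>

lemma \<mu>_tail:
  assumes r: "r > 0"
  shows "{x. r \<le> cmod (x m - \<zeta> * x l)} \<in> sets cseq"
    "measure \<mu> {x. r \<le> cmod (x m - \<zeta> * x l)}
      \<le> cgauss_moment4 * (LINT \<omega>|M. (cmod (lam \<omega> ^ m - \<zeta> * lam \<omega> ^ l))\<^sup>2)\<^sup>2 / r ^ 4"
proof -
  let ?A = "{x :: nat \<Rightarrow> complex. r \<le> cmod (x m - \<zeta> * x l)}"
  have "{x \<in> space cseq. r \<le> cmod (x m - \<zeta> * x l)} \<in> sets cseq" by measurable
  then show A: "?A \<in> sets cseq" by (simp add: space_PiM)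
  define D where "D = Suc (max m l)"
  have D: "m < D" "l < D" by (auto simp: D_def)
  have "X \<omega> m - \<zeta> * X \<omega> l = (\<Sum>j<D. (a m j - \<zeta> * a l j) * \<omega> j)" for \<omega>
    unfolding X_extend[OF D(1)] X_extend[OF D(2)]
    by (simp add: left_diff_distrib sum_subtractf sum_distrib_left mult.assoc)
  then have "measure \<mu> ?A = measure gseq {\<omega>. r \<le> cmod (\<Sum>j<D. (a m j - \<zeta> * a l j) * \<omega> j)}"
    unfolding \<mu>_def measure_distr[OF measurable_X A] by (simp add: vimage_def)
  also have "\<dots> \<le> cgauss_moment4 * (\<Sum>j<D. (cmod (a m j - \<zeta> * a l j))\<^sup>2)\<^sup>2 / r ^ 4"
    by (rule gseq_linear_tail[OF r])
  finally show "measure \<mu> ?A \<le> cgauss_moment4 * (LINT \<omega>|M. (cmod (lam \<omega> ^ m - \<zeta> * lam \<omega> ^ l))\<^sup>2)\<^sup>2 / r ^ 4"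
    unfolding gram_a_combination[OF D] .
qed

lemma \<mu>_first: "measure \<mu> {x. x 0 \<in> ball 1 r} = measure (cgauss 1) (ball 1 r)" "{x. x 0 \<in> ball 1 r} \<in> sets cseq"
proof -
  have "{x \<in> space cseq. x 0 \<in> ball 1 r} \<in> sets cseq" unfolding mem_ball by measurable
  then show A: "{x. x 0 \<in> ball 1 r} \<in> sets cseq" by (simp add: space_PiM)
  have u: "(\<Sum>j<1. (cmod (a 0 j))\<^sup>2) = 1" using unit[of 0] by simp
  have "measure \<mu> {x. x 0 \<in> ball 1 r} = measure gseq {\<omega>. X \<omega> 0 \<in> ball 1 r}"
    unfolding \<mu>_def measure_distr[OF measurable_X A] by (simp add: vimage_def)
  also have "\<dots> = measure (distr gseq borel (\<lambda>\<omega>. \<Sum>j<1. a 0 j * \<omega> j)) (ball 1 r)"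
    by (subst measure_distr) (auto simp: vimage_def X_def)
  also have "distr gseq borel (\<lambda>\<omega>. \<Sum>j<1. a 0 j * \<omega> j) = cgauss 1"
    using distr_gseq_linear[of "a 0" 1] unfolding u by simp
  finally show "measure \<mu> {x. x 0 \<in> ball 1 r} = measure (cgauss 1) (ball 1 r)" .
qed

end

theorem theorem2:
  fixes n :: "nat \<Rightarrow> nat"
  assumes "strict_mono n"
    and "\<And>k. n k > 0"
    and "\<And>k. k \<ge> 1 \<Longrightarrow> n k dvd n (Suc k)"
  shows "\<forall>p::int. \<exists>X T m. wm_linear_dyn_system X T m \<and>
           non_recurrence_set {nat (int (n k) - p) | k. int (n k) - p > 0} m T"
proof
  fix p :: int
  obtain \<theta> \<delta> where \<delta>: "\<delta> > 0"
    and sep: "\<And>k. int (n k) - p > 0 \<Longrightarrow> \<delta> \<le> cmod (cis (2 * pi * (of_int (int (n k) - p) * \<theta>)) - 1)"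
    using separated_rotation[OF assms] by blast
  \<comment> \<open>The return argument compares two estimates with errors 2r and 3r.\<close>
  define r where "r = \<delta> / 5"
  have r: "r > 0" using \<delta> by (simp add: r_def)
  \<comment> \<open>Positive and negative part of \<open>p\<close>: a return time t = n k - p
    satisfies u + t = n k + v, with natural numbers throughout.\<close>
  define u v where "u = nat p" and "v = nat (- p)"
  have uv: "p = int u - int v" by (simp add: u_def v_def)
  \<comment> \<open>Squared variance bounds without the common factor (4 \<pi> c)^2. Indices 0 and 1
    belong to the offsets \<open>u\<close> and \<open>v\<close>, index k + 2 to \<open>n k\<close>;
    the factor n 0 + 1 absorbs the exceptional first time.\<close>
  define z where "z i = (if i = 0 then (real u)\<^sup>2 else if i = 1 then (real v)\<^sup>2
    else ((real (n 0) + 1) / (real (i - 2) + 1))\<^sup>2)" for i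
  have z0: "0 \<le> z i" for i by (simp add: z_def)
  have zs: "summable z"
  proof -
    have "summable (\<lambda>i. (real (n 0) + 1)\<^sup>2 * (1 / (real i + 1)\<^sup>2))"
      using sums_summable[OF inverse_squares_sums] by (intro summable_mult) (simp add: add.commute)
    then have "summable (\<lambda>i. z (i + 2))" by (simp add: z_def power_divide)
    then show ?thesis by (rule summable_iff_shift[THEN iffD1])
  qed
  define p0 where "p0 = measure (cgauss 1) (ball 1 r)"
  have p0: "p0 > 0" unfolding p0_def by (rule cgauss_ball_pos[OF r])
  \<comment> \<open>Q c^2 will bound the probability of all bad events together. \<open>Q\<close>
    does not involve \<open>c\<close>, so \<open>c\<close> can be chosen small afterwards.\<close>
  define Q where "Q = cgauss_moment4 * (4 * pi)\<^sup>2 / r ^ 4 * suminf z"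
  have Q: "Q \<ge> 0" unfolding Q_def using r cgauss_moment4_nonneg by (intro mult_nonneg_nonneg divide_nonneg_pos suminf_nonneg zs z0) auto
  define c where "c = min (1/2) (p0 / (Q + 1))"
  have c: "0 < c" "c \<le> 1/2" unfolding c_def using p0 Q by (simp, intro min.cobounded1)
  have Qc: "Q * c\<^sup>2 < p0"
  proof -
    have "c\<^sup>2 \<le> c" using c by (simp add: power2_eq_square mult_left_le)
    then have "Q * c\<^sup>2 \<le> Q * c" using Q by (intro mult_left_mono)
    also have "\<dots> \<le> Q * (p0 / (Q + 1))" using Q by (intro mult_left_mono) (auto simp: c_def)
    also have "\<dots> < p0" using Q p0 by (simp add: field_simps)
    finally show ?thesis .
  qed
  define N where "N i = n (Suc i)" for i
  interpret S: sparse_digits N \<theta> c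
  proof
    have "n 0 < n 1" using assms(1) by (simp add: strict_mono_def)
    then show "2 \<le> N 0" using assms(2)[of 0] by (simp add: N_def)
    show "N i dvd N (Suc i)" for i using assms(3) by (simp add: N_def)
    show "N i < N (Suc i)" for i using assms(1) by (simp add: N_def strict_mono_def)
  qed (use c in auto)
  interpret U: unimodular_rv S.B S.lam by (rule S.unimodular_rv_lam)
  interpret \<mu>: prob_space U.\<mu> by (rule U.prob_\<mu>)
  define ee where "ee x = cis (2 * pi * x * \<theta>)" for x
  \<comment> \<open>Each event is the failure of one relation: the values at \<open>u\<close> and
    \<open>v\<close> should be rotations of the value at 0, the value at n k + v a rotation of the
    value at \<open>v\<close>.\<close>
  define bad where "bad i = (if i = 0 then {x. r \<le> cmod (x (u + 0) - ee (real u) * x 0)}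
     else if i = 1 then {x. r \<le> cmod (x (v + 0) - ee (real v) * x 0)}
     else {x. r \<le> cmod (x (n (i - 2) + v) - ee (real (n (i - 2))) * x v)})" for i
  have bad_sets: "bad i \<in> sets cseq" for i
    unfolding bad_def using U.\<mu>_tail(1)[OF r] by auto
  have var_n: "(LINT \<omega>|S.B. (cmod (S.lam \<omega> ^ (n k + v) - ee (real (n k)) * S.lam \<omega> ^ v))\<^sup>2)
    \<le> 4 * pi * (c * ((real (n 0) + 1) / (real k + 1)))" for k
  proof (cases k)
    case 0
    have "(LINT \<omega>|S.B. (cmod (S.lam \<omega> ^ (n 0 + v) - ee (real (n 0)) * S.lam \<omega> ^ v))\<^sup>2) \<le> 4 * pi * (c * real (n 0))"
      unfolding ee_def by (rule S.variance_const)
    also have "\<dots> \<le> 4 * pi * (c * (real (n 0) + 1))" using c by (intro mult_left_mono) auto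
    finally show ?thesis using 0 by simp
  next
    case (Suc j)
    have "(LINT \<omega>|S.B. (cmod (S.lam \<omega> ^ (n k + v) - ee (real (n k)) * S.lam \<omega> ^ v))\<^sup>2) \<le> 4 * pi * (c / (real j + 2))"
      using S.variance_N[of j v] unfolding ee_def N_def Suc by simp
    also have "c / (real j + 2) \<le> c * ((real (n 0) + 1) / (real k + 1))"
      using c Suc by (simp add: divide_right_mono add.commute)
    finally show ?thesis by (simp add: mult_left_mono)
  qed
  have bad_le: "measure U.\<mu> (bad i) \<le> cgauss_moment4 * (4 * pi)\<^sup>2 / r ^ 4 * c\<^sup>2 * z i" for i
  proof -
    have gen: "measure U.\<mu> {x. r \<le> cmod (x m - \<zeta> * x l)} \<le> cgauss_moment4 * (4 * pi)\<^sup>2 / r ^ 4 * c\<^sup>2 * y\<^sup>2"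
      if "(LINT \<omega>|S.B. (cmod (S.lam \<omega> ^ m - \<zeta> * S.lam \<omega> ^ l))\<^sup>2) \<le> 4 * pi * (c * y)" for m l \<zeta> y
    proof -
      have "measure U.\<mu> {x. r \<le> cmod (x m - \<zeta> * x l)}
        \<le> cgauss_moment4 * (LINT \<omega>|S.B. (cmod (S.lam \<omega> ^ m - \<zeta> * S.lam \<omega> ^ l))\<^sup>2)\<^sup>2 / r ^ 4"
        by (rule U.\<mu>_tail(2)[OF r])
      also have "\<dots> \<le> cgauss_moment4 * (4 * pi * (c * y))\<^sup>2 / r ^ 4"
        using r cgauss_moment4_nonneg that
        by (intro divide_right_mono mult_left_mono power_mono) auto
      also have "\<dots> = cgauss_moment4 * (4 * pi)\<^sup>2 / r ^ 4 * c\<^sup>2 * y\<^sup>2" by (simp add: power_mult_distrib)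
      finally show ?thesis .
    qed
    consider "i = 0" | "i = 1" | "i \<ge> 2" by linarith
    then show ?thesis
    proof cases
      case 1
      show ?thesis unfolding bad_def z_def using gen[OF S.variance_const[of u 0]] 1 by (simp add: ee_def)
    next
      case 2
      show ?thesis unfolding bad_def z_def using gen[OF S.variance_const[of v 0]] 2 by (simp add: ee_def)
    next
      case 3
      then show ?thesis unfolding bad_def z_def using gen[OF var_n[of "i - 2"]] by simp
    qed
  qed
  have bsum: "summable (\<lambda>i. cgauss_moment4 * (4 * pi)\<^sup>2 / r ^ 4 * c\<^sup>2 * z i)" by (rule summable_mult[OF zs])
  have bad_summable: "summable (\<lambda>i. measure U.\<mu> (bad i))"
    by (rule summable_comparison_test'[OF bsum, of 0]) (use bad_le in auto)
  have badU: "(\<Union>i. bad i) \<in> sets cseq" using bad_sets by auto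
  have "measure U.\<mu> (\<Union>i. bad i) \<le> (\<Sum>i. measure U.\<mu> (bad i))"
    by (rule \<mu>.finite_measure_subadditive_countably[OF _ bad_summable]) (use bad_sets in auto)
  also have "\<dots> \<le> (\<Sum>i. cgauss_moment4 * (4 * pi)\<^sup>2 / r ^ 4 * c\<^sup>2 * z i)"
    by (intro suminf_le bad_le bad_summable bsum)
  also have "\<dots> = cgauss_moment4 * (4 * pi)\<^sup>2 / r ^ 4 * c\<^sup>2 * suminf z" by (rule suminf_mult[OF zs])
  also have "\<dots> = Q * c\<^sup>2" by (simp add: Q_def)
  finally have bad_small: "measure U.\<mu> (\<Union>i. bad i) < p0" using Qc by linarith
  define A where "A = {x. x 0 \<in> ball 1 r} - (\<Union>i. bad i)"
  have A_sets: "A \<in> sets cseq" unfolding A_def by (intro sets.Diff U.\<mu>_first(2) badU)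
  have "p0 - measure U.\<mu> (\<Union>i. bad i) \<le> measure U.\<mu> A"
  proof -
    have "measure U.\<mu> {x. x 0 \<in> ball 1 r} \<le> measure U.\<mu> (A \<union> (\<Union>i. bad i))"
    proof (rule \<mu>.finite_measure_mono)
      show "A \<union> (\<Union>i. bad i) \<in> sets U.\<mu>" using A_sets badU by simp
    qed (auto simp: A_def)
    also have "\<dots> \<le> measure U.\<mu> A + measure U.\<mu> (\<Union>i. bad i)"
      using A_sets badU by (intro measure_Un_le) auto
    finally show ?thesis unfolding p0_def U.\<mu>_first(1) by simp
  qed
  then have A_pos: "measure U.\<mu> A > 0" using bad_small by linarith
  have ee_norm: "cmod (ee x) = 1" for x by (simp add: ee_def)
  have notbad: "x \<notin> bad i" if "x \<in> A" for x i using that by (auto simp: A_def)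
  have A_u: "cmod (x u - ee (real u) * x 0) < r" and A_v: "cmod (x v - ee (real v) * x 0) < r"
    and A_n: "cmod (x (n k + v) - ee (real (n k)) * x v) < r" and A_0: "cmod (x 0 - 1) < r" if "x \<in> A" for x k
  proof -
    show "cmod (x u - ee (real u) * x 0) < r" using notbad[OF that, of 0] by (simp add: bad_def)
    show "cmod (x v - ee (real v) * x 0) < r" using notbad[OF that, of 1] by (simp add: bad_def)
    show "cmod (x (n k + v) - ee (real (n k)) * x v) < r" using notbad[OF that, of "k + 2"] by (simp add: bad_def)
    show "cmod (x 0 - 1) < r" using that by (simp add: A_def dist_norm norm_minus_commute)
  qed
  \<comment> \<open>The coordinate x (n k + v) = x (u + t) is estimated in two ways: from the
    returned point it is close to ee u, from the starting point to ee (n k) * ee v. These two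
    numbers would be closer than \<delta>, against \<open>sep\<close>.\<close>
  have disj: False if k: "int (n k) - p > 0" and x: "x \<in> A" and y: "(\<lambda>i. x (i + nat (int (n k) - p))) \<in> A" for k x
  proof -
    define t where "t = nat (int (n k) - p)"
    have tu: "u + t = n k + v" using k uv by (simp add: t_def)
    let ?w = "x (n k + v)"
    have y1: "cmod (?w - ee (real u) * x t) < r" using A_u[OF y] tu by (simp add: t_def[symmetric])
    have y2: "cmod (x t - 1) < r" using A_0[OF y] by (simp add: t_def[symmetric])
    have "?w - ee (real u) = (?w - ee (real u) * x t) + ee (real u) * (x t - 1)" by (simp add: algebra_simps)
    then have "cmod (?w - ee (real u)) \<le> cmod (?w - ee (real u) * x t) + cmod (ee (real u) * (x t - 1))"
      by (metis norm_triangle_ineq)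
    then have l: "cmod (?w - ee (real u)) < 2 * r" using y1 y2 by (simp add: norm_mult ee_norm)
    have "?w - ee (real (n k)) * ee (real v) = (?w - ee (real (n k)) * x v)
        + (ee (real (n k)) * (x v - ee (real v) * x 0) + ee (real (n k)) * ee (real v) * (x 0 - 1))"
      by (simp add: algebra_simps)
    then have "cmod (?w - ee (real (n k)) * ee (real v)) \<le> cmod (?w - ee (real (n k)) * x v)
        + (cmod (ee (real (n k)) * (x v - ee (real v) * x 0)) + cmod (ee (real (n k)) * ee (real v) * (x 0 - 1)))"
      by (metis (no_types, lifting) norm_triangle_ineq norm_triangle_le add_left_mono order_trans)
    then have l2: "cmod (?w - ee (real (n k)) * ee (real v)) < 3 * r"
      using A_n[OF x, of k] A_v[OF x] A_0[OF x] by (simp add: norm_mult ee_norm)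
    have "cmod (ee (real (n k)) * ee (real v) - ee (real u)) \<le> cmod (?w - ee (real u)) + cmod (?w - ee (real (n k)) * ee (real v))"
      using norm_triangle_ineq4[of "?w - ee (real u)" "?w - ee (real (n k)) * ee (real v)"] by simp
    then have l3: "cmod (ee (real (n k)) * ee (real v) - ee (real u)) < \<delta>" using l l2 by (simp add: r_def)
    have "ee (real (n k)) * ee (real v) = ee (real u) * cis (2 * pi * (of_int (int (n k) - p) * \<theta>))"
      unfolding ee_def cis_mult uv by (simp add: algebra_simps)
    then have "ee (real (n k)) * ee (real v) - ee (real u) = ee (real u) * (cis (2 * pi * (of_int (int (n k) - p) * \<theta>)) - 1)"
      by (simp add: algebra_simps)
    then have "cmod (ee (real (n k)) * ee (real v) - ee (real u)) = cmod (cis (2 * pi * (of_int (int (n k) - p) * \<theta>)) - 1)"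
      by (simp add: norm_mult ee_norm)
    then show False using l3 sep[OF k] by linarith
  qed
  have "non_recurrence_set {nat (int (n k) - p) | k. int (n k) - p > 0} U.mm bshift"
    by (rule U.non_recurrence_mm[OF A_sets A_pos]) (use disj in blast)
  then show "\<exists>X T m. wm_linear_dyn_system X T m \<and>
           non_recurrence_set {nat (int (n k) - p) | k. int (n k) - p > 0} m T"
    using U.wm_linear_dyn_system_mm by blast
qed

end
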